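(* Let $G$ be a finitely generated group. Let $C$ be a non-singleton connected component of the Morse boundary $\partial_* G$. If the orbit $G\cdot C=\{g\cdot C \mid g\in G\}$ is point-convergent (as a family of subsets of $\partial_* G$), then $(\partial_* H, G) = C$, where $H\leq G$ is the stabiliser of $C$ under the action of $G$ on $\partial_* G$.
   Context: Morse gauges and Morse quasi-geodesics. A Morse gauge is a function $M:\mathbb{R}_{\geq 1}\times\mathbb{R}_{\geq 0}\to\mathbb{R}_{\geq 0}$ that is increasing and continuous in the second coordinate. A quasi-geodesic $\gamma$ in a geodesic metric space is $M$-Morse if for all $s\le t$ and all $q\geq 1,Q\geq 0$, every $(q,Q)$-quasi-geodesic with endpoints $\gamma(s),\gamma(t)$ stays in the closed $M(q,Q)$-neighbourhood of $\gamma[s,t]$; it is Morse if it is $M$-Morse for some Morse gauge $M$. Put $\delta_M=\max\{4M(1,2M(5,0))+2M(5,0),\,8M(3,0)\}$. Morse boundary. Let $(X,d)$ be a proper geodesic metric space with basepoint $e$. For a Morse gauge $N$, $\partial_e^N X$ is the set of $N$-Morse geodesic rays $\gamma:[0,\infty)\to X$ starting at $e$, modulo bounded Hausdorff distance, with topology given by the neighbourhood bases $U_k^N(\gamma)_e=\{[\gamma'] \mid d(\gamma(t),\gamma'(t))\le\delta_N \text{ for all } t\le k\}$. The Morse boundary $\partial_* X$ is the direct limit $\varinjlim_M \partial_e^M X$ over all Morse gauges (ordered pointwise), with the direct limit topology; it does not depend on $e$ as a topological space. A Morse (quasi-)geodesic ray $\gamma$ with any starting point represents a point $[\gamma]=\gamma^+\in\partial_*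 X$, namely the class of Morse geodesic rays from $e$ at bounded Hausdorff distance from $\gamma$. Groups. For a finitely generated group $G$ with finite generating set $S$, let $X=\mathrm{Cay}(G,S)$ (with vertex set $G$) and $\partial_* G:=\partial_* X$. The left multiplication action of $G$ on $X$ induces an action on $\partial_* G$ by $g\cdot[\gamma]=[g\gamma]$; it permutes the connected components. Relative Morse boundary. For a subset $Y\subset X$, the relative Morse boundary $(\partial_* Y,X)$ is the set of all $\gamma^+\in\partial_* X$, $\gamma$ a Morse geodesic ray, such that $\gamma$ is contained in the $k$-neighbourhood of $Y$ for some $k$; it carries the subspace topology. For $H\le G$, viewed as a set of vertices of $X$, one writes $(\partial_* H,G)$ for $(\partial_* H,X)$. Point-convergence. For a sequence $(A_n)_{n\in\mathbb{N}}$ of subsets of a topological space $Y$, $\lim_{n\to\infty}A_n$ is the set of points $x\in Y$ that can be written as $x=\lim_{n\to\infty}x_n$ with $x_n\in A_n$. A family of subsets of $Y$ is point-convergent if for every sequence $(A_n)_{n\in\mathbb{N}}$ of distinct elements of the family, $|\lim_{n\to\infty}A_n|\le 1$. *)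

theory Defs
  imports "HOL-Analysis.Analysis" "HOL-Algebra.Generated_Groups"
begin

section \<open>Morse geodesic rays\<close>

(* Only the values on the domain q >= 1, Q >= 0 are constrained; the values elsewhere
   are never used below. *)
definition morse_gauge :: "(real \<Rightarrow> real \<Rightarrow> real) \<Rightarrow> bool" where
  "morse_gauge N \<longleftrightarrow>
     (\<forall>q\<ge>1. (\<forall>Q\<ge>0. 0 \<le> N q Q) \<and> mono_on {0..} (N q) \<and> continuous_on {0..} (N q))"

definition morse_delta :: "(real \<Rightarrow> real \<Rightarrow> real) \<Rightarrow> real" where
  "morse_delta N = max (4 * N 1 (2 * N 5 0) + 2 * N 5 0) (8 * N 3 0)"

definition closed_nbhd :: "'p metric \<Rightarrow> real \<Rightarrow> 'p set \<Rightarrow> 'p set" where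
  "closed_nbhd X r A = {x \<in> mspace X. A \<noteq> {} \<and> (INF a\<in>A. mdist X x a) \<le> r}"

definition finite_Hausdorff_dist :: "'p metric \<Rightarrow> 'p set \<Rightarrow> 'p set \<Rightarrow> bool" where
  "finite_Hausdorff_dist X A B \<longleftrightarrow> (\<exists>r. A \<subseteq> closed_nbhd X r B \<and> B \<subseteq> closed_nbhd X r A)"

(* Quasi-geodesics are not required to be continuous. *)
definition quasi_geodesic ::
  "'p metric \<Rightarrow> real \<Rightarrow> real \<Rightarrow> real set \<Rightarrow> (real \<Rightarrow> 'p) \<Rightarrow> bool" where
  "quasi_geodesic X q Q I \<eta> \<longleftrightarrow> \<eta> ` I \<subseteq> mspace X \<and>
     (\<forall>s\<in>I. \<forall>t\<in>I. \<bar>s - t\<bar> / q - Q \<le> mdist X (\<eta> s) (\<eta> t) \<and>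
                  mdist X (\<eta> s) (\<eta> t) \<le> q * \<bar>s - t\<bar> + Q)"

(* Paths are total functions on the reals, of which only the restriction to the parameter
   interval (here {0..}) matters. *)
definition geodesic_ray :: "'p metric \<Rightarrow> (real \<Rightarrow> 'p) \<Rightarrow> bool" where
  "geodesic_ray X \<gamma> \<longleftrightarrow> \<gamma> ` {0..} \<subseteq> mspace X \<and>
     (\<forall>s\<ge>0. \<forall>t\<ge>0. mdist X (\<gamma> s) (\<gamma> t) = \<bar>s - t\<bar>)"

definition morse_on ::
  "'p metric \<Rightarrow> (real \<Rightarrow> real \<Rightarrow> real) \<Rightarrow> real set \<Rightarrow> (real \<Rightarrow> 'p) \<Rightarrow> bool" where
  "morse_on X N I \<gamma> \<longleftrightarrow>
     (\<forall>s\<in>I. \<forall>t\<in>I. s \<le> t \<longrightarrow>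
       (\<forall>q\<ge>1. \<forall>Q\<ge>0. \<forall>a b \<eta>.
          a \<le> b \<and> quasi_geodesic X q Q {a..b} \<eta> \<and> \<eta> a = \<gamma> s \<and> \<eta> b = \<gamma> t \<longrightarrow>
          \<eta> ` {a..b} \<subseteq> closed_nbhd X (N q Q) (\<gamma> ` {s..t})))"

definition gauge_morse_ray :: "'p metric \<Rightarrow> (real \<Rightarrow> real \<Rightarrow> real) \<Rightarrow> (real \<Rightarrow> 'p) \<Rightarrow> bool" where
  "gauge_morse_ray X N \<gamma> \<longleftrightarrow> geodesic_ray X \<gamma> \<and> morse_on X N {0..} \<gamma>"

definition morse_ray :: "'p metric \<Rightarrow> (real \<Rightarrow> 'p) \<Rightarrow> bool" where
  "morse_ray X \<gamma> \<longleftrightarrow> (\<exists>N. morse_gauge N \<and> gauge_morse_ray X N \<gamma>)"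


section \<open>The Morse boundary\<close>

(* The point of the Morse boundary with basepoint e represented by gamma: a set of rays
   starting at e, where gamma itself may start anywhere. *)
definition ray_class :: "'p metric \<Rightarrow> 'p \<Rightarrow> (real \<Rightarrow> 'p) \<Rightarrow> (real \<Rightarrow> 'p) set" where
  "ray_class X e \<gamma> =
     {\<alpha>. morse_ray X \<alpha> \<and> \<alpha> 0 = e \<and> finite_Hausdorff_dist X (\<alpha> ` {0..}) (\<gamma> ` {0..})}"

(* A point of the N-stratum is represented by its class among all Morse rays from e rather
   than among the N-Morse ones only. These two kinds of classes correspond bijectively, and
   with this choice the maps of the direct system over the Morse gauges become inclusions,
   so that the direct limit is the union of the strata. *)
definition morse_stratum_points ::
  "'p metric \<Rightarrow> 'p \<Rightarrow> (real \<Rightarrow> real \<Rightarrow> real) \<Rightarrow> (real \<Rightarrow> 'p) set set" where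
  "morse_stratum_points X e N = {ray_class X e \<gamma> |\<gamma>. gauge_morse_ray X N \<gamma> \<and> \<gamma> 0 = e}"

definition morse_stratum_nbhd ::
  "'p metric \<Rightarrow> 'p \<Rightarrow> (real \<Rightarrow> real \<Rightarrow> real) \<Rightarrow> nat \<Rightarrow> (real \<Rightarrow> 'p) \<Rightarrow> (real \<Rightarrow> 'p) set set" where
  "morse_stratum_nbhd X e N k \<gamma> =
     {ray_class X e \<gamma>' |\<gamma>'. gauge_morse_ray X N \<gamma>' \<and> \<gamma>' 0 = e \<and>
        (\<forall>t. 0 \<le> t \<and> t \<le> real k \<longrightarrow> mdist X (\<gamma> t) (\<gamma>' t) \<le> morse_delta N)}"

definition morse_stratum ::
  "'p metric \<Rightarrow> 'p \<Rightarrow> (real \<Rightarrow> real \<Rightarrow> real) \<Rightarrow> (real \<Rightarrow> 'p) set topology" where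
  "morse_stratum X e N = topology (\<lambda>U. U \<subseteq> morse_stratum_points X e N \<and>
     (\<forall>\<gamma>. gauge_morse_ray X N \<gamma> \<and> \<gamma> 0 = e \<and> ray_class X e \<gamma> \<in> U \<longrightarrow>
        (\<exists>k. morse_stratum_nbhd X e N k \<gamma> \<subseteq> U)))"

lemma morse_stratum_nbhd_antimono:
  assumes "k \<le> l"
  shows "morse_stratum_nbhd X e N l \<gamma> \<subseteq> morse_stratum_nbhd X e N k \<gamma>"
  using assms unfolding morse_stratum_nbhd_def by fastforce

lemma openin_morse_stratum:
  "openin (morse_stratum X e N) U \<longleftrightarrow> U \<subseteq> morse_stratum_points X e N \<and>
     (\<forall>\<gamma>. gauge_morse_ray X N \<gamma> \<and> \<gamma> 0 = e \<and> ray_class X e \<gamma> \<in> U \<longrightarrow>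
        (\<exists>k. morse_stratum_nbhd X e N k \<gamma> \<subseteq> U))"
proof -
  let ?P = "\<lambda>U. U \<subseteq> morse_stratum_points X e N \<and>
     (\<forall>\<gamma>. gauge_morse_ray X N \<gamma> \<and> \<gamma> 0 = e \<and> ray_class X e \<gamma> \<in> U \<longrightarrow>
        (\<exists>k. morse_stratum_nbhd X e N k \<gamma> \<subseteq> U))"
  have "istopology ?P"
    unfolding istopology_def
  proof (intro conjI allI impI)
    fix S T assume S: "?P S" and T: "?P T"
    show "S \<inter> T \<subseteq> morse_stratum_points X e N" using S by blast
    fix \<gamma> assume \<gamma>: "gauge_morse_ray X N \<gamma> \<and> \<gamma> 0 = e \<and> ray_class X e \<gamma> \<in> S \<inter> T"
    obtain k where k: "morse_stratum_nbhd X e N k \<gamma> \<subseteq> S" using S \<gamma> by blast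
    obtain l where l: "morse_stratum_nbhd X e N l \<gamma> \<subseteq> T" using T \<gamma> by blast
    have "morse_stratum_nbhd X e N (max k l) \<gamma> \<subseteq> S \<inter> T"
      using k l morse_stratum_nbhd_antimono[of k "max k l" X e N \<gamma>]
        morse_stratum_nbhd_antimono[of l "max k l" X e N \<gamma>] by auto
    then show "\<exists>k. morse_stratum_nbhd X e N k \<gamma> \<subseteq> S \<inter> T" ..
  next
    fix \<K> assume K: "\<forall>K\<in>\<K>. ?P K"
    show "\<Union>\<K> \<subseteq> morse_stratum_points X e N" using K by blast
    fix \<gamma> assume \<gamma>: "gauge_morse_ray X N \<gamma> \<and> \<gamma> 0 = e \<and> ray_class X e \<gamma> \<in> \<Union>\<K>"
    then obtain K where "K \<in> \<K>" "ray_class X e \<gamma> \<in> K" by blast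
    then obtain k where "morse_stratum_nbhd X e N k \<gamma> \<subseteq> K" using K \<gamma> by blast
    with \<open>K \<in> \<K>\<close> show "\<exists>k. morse_stratum_nbhd X e N k \<gamma> \<subseteq> \<Union>\<K>" by blast
  qed
  then show ?thesis
    unfolding morse_stratum_def by (simp add: topology_inverse')
qed

lemma topspace_morse_stratum [simp]:
  "topspace (morse_stratum X e N) = morse_stratum_points X e N"
proof -
  have "openin (morse_stratum X e N) (morse_stratum_points X e N)"
    unfolding openin_morse_stratum
    by (auto simp: morse_stratum_nbhd_def morse_stratum_points_def)
  moreover have "topspace (morse_stratum X e N) \<subseteq> morse_stratum_points X e N"
    using openin_topspace[of "morse_stratum X e N"] unfolding openin_morse_stratum by blast
  ultimately show ?thesis
    using openin_subset by blast
qed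

definition morse_boundary_points :: "'p metric \<Rightarrow> 'p \<Rightarrow> (real \<Rightarrow> 'p) set set" where
  "morse_boundary_points X e = (\<Union>N\<in>Collect morse_gauge. morse_stratum_points X e N)"

(* The direct limit (final) topology with respect to the inclusions of the strata. *)
definition morse_boundary :: "'p metric \<Rightarrow> 'p \<Rightarrow> (real \<Rightarrow> 'p) set topology" where
  "morse_boundary X e = topology (\<lambda>U. U \<subseteq> morse_boundary_points X e \<and>
     (\<forall>N. morse_gauge N \<longrightarrow> openin (morse_stratum X e N) (U \<inter> morse_stratum_points X e N)))"

lemma openin_morse_boundary:
  "openin (morse_boundary X e) U \<longleftrightarrow> U \<subseteq> morse_boundary_points X e \<and>
     (\<forall>N. morse_gauge N \<longrightarrow> openin (morse_stratum X e N) (U \<inter> morse_stratum_points X e N))"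
proof -
  let ?P = "\<lambda>U. U \<subseteq> morse_boundary_points X e \<and>
     (\<forall>N. morse_gauge N \<longrightarrow> openin (morse_stratum X e N) (U \<inter> morse_stratum_points X e N))"
  have "istopology ?P"
    unfolding istopology_def
  proof (intro conjI allI impI)
    fix S T assume S: "?P S" and T: "?P T"
    show "S \<inter> T \<subseteq> morse_boundary_points X e" using S by blast
    fix N assume N: "morse_gauge N"
    have "S \<inter> T \<inter> morse_stratum_points X e N =
        (S \<inter> morse_stratum_points X e N) \<inter> (T \<inter> morse_stratum_points X e N)" by blast
    then show "openin (morse_stratum X e N) (S \<inter> T \<inter> morse_stratum_points X e N)"
      using S T N by (simp add: openin_Int)
  next
    fix \<K> assume K: "\<forall>K\<in>\<K>. ?P K"
    show "\<Union>\<K> \<subseteq> morse_boundary_points X e" using K by blast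
    fix N assume N: "morse_gauge N"
    have "\<Union>\<K> \<inter> morse_stratum_points X e N = (\<Union>K\<in>\<K>. K \<inter> morse_stratum_points X e N)" by blast
    moreover have "openin (morse_stratum X e N) (\<Union>K\<in>\<K>. K \<inter> morse_stratum_points X e N)"
      by (rule openin_Union) (use K N in blast)
    ultimately show "openin (morse_stratum X e N) (\<Union>\<K> \<inter> morse_stratum_points X e N)"
      by simp
  qed
  then show ?thesis
    unfolding morse_boundary_def by (simp add: topology_inverse')
qed

lemma topspace_morse_boundary [simp]:
  "topspace (morse_boundary X e) = morse_boundary_points X e"
proof -
  have "morse_boundary_points X e \<inter> morse_stratum_points X e N = morse_stratum_points X e N"
    if "morse_gauge N" for N
    using that unfolding morse_boundary_points_def by blast
  moreover have "openin (morse_stratum X e N) (morse_stratum_points X e N)" for N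
    using openin_topspace[of "morse_stratum X e N"] by simp
  ultimately have "openin (morse_boundary X e) (morse_boundary_points X e)"
    unfolding openin_morse_boundary by simp
  moreover have "topspace (morse_boundary X e) \<subseteq> morse_boundary_points X e"
    using openin_topspace[of "morse_boundary X e"] unfolding openin_morse_boundary by blast
  ultimately show ?thesis
    using openin_subset by blast
qed

definition relative_morse_boundary :: "'p metric \<Rightarrow> 'p \<Rightarrow> 'p set \<Rightarrow> (real \<Rightarrow> 'p) set set" where
  "relative_morse_boundary X e Y =
     {ray_class X e \<gamma> |\<gamma>. morse_ray X \<gamma> \<and> (\<exists>k. \<gamma> ` {0..} \<subseteq> closed_nbhd X k Y)}"


section \<open>Cayley graphs\<close>

(* The geometric realisation of the (simple, undirected) Cayley graph in barycentric
   coordinates: a point is a finitely supported function on the group, the vertex g being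
   the indicator function of g. Edges are undirected, so S need not be symmetric. *)

definition cayley_vertex :: "'a \<Rightarrow> 'a \<Rightarrow> real" where
  "cayley_vertex g = (\<lambda>h. if h = g then 1 else 0)"

definition cayley_adjacent :: "('a, 'b) monoid_scheme \<Rightarrow> 'a set \<Rightarrow> 'a \<Rightarrow> 'a \<Rightarrow> bool" where
  "cayley_adjacent G S u v \<longleftrightarrow> u \<in> carrier G \<and> v \<in> carrier G \<and>
     (\<exists>s\<in>S. v = u \<otimes>\<^bsub>G\<^esub> s \<or> u = v \<otimes>\<^bsub>G\<^esub> s)"

definition cayley_segment :: "'a \<Rightarrow> 'a \<Rightarrow> ('a \<Rightarrow> real) set" where
  "cayley_segment u v =
     {\<lambda>h. (1 - t) * cayley_vertex u h + t * cayley_vertex v h |t. 0 \<le> t \<and> t \<le> 1}"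

definition cayley_points :: "('a, 'b) monoid_scheme \<Rightarrow> 'a set \<Rightarrow> ('a \<Rightarrow> real) set" where
  "cayley_points G S = cayley_vertex ` carrier G \<union>
     \<Union>{cayley_segment u v |u v. cayley_adjacent G S u v}"

(* cayley_chain G S x y r: there is a polygonal path of length r from x to y, each piece of
   which lies in one closed edge. On an edge between distinct u and v, which has length 1,
   the coordinate at u is an arc length parameter. *)
inductive cayley_chain ::
  "('a, 'b) monoid_scheme \<Rightarrow> 'a set \<Rightarrow> ('a \<Rightarrow> real) \<Rightarrow> ('a \<Rightarrow> real) \<Rightarrow> real \<Rightarrow> bool"
  for G S where
  refl: "x \<in> cayley_points G S \<Longrightarrow> cayley_chain G S x x 0"
| step: "cayley_chain G S x y r \<Longrightarrow> cayley_adjacent G S u v \<Longrightarrow>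
     y \<in> cayley_segment u v \<Longrightarrow> z \<in> cayley_segment u v \<Longrightarrow>
     cayley_chain G S x z (r + \<bar>y u - z u\<bar>)"

definition cayley_dist ::
  "('a, 'b) monoid_scheme \<Rightarrow> 'a set \<Rightarrow> ('a \<Rightarrow> real) \<Rightarrow> ('a \<Rightarrow> real) \<Rightarrow> real" where
  "cayley_dist G S x y = (if x \<in> cayley_points G S \<and> y \<in> cayley_points G S
     then Inf {r. cayley_chain G S x y r} else 0)"

definition cayley_graph :: "('a, 'b) monoid_scheme \<Rightarrow> 'a set \<Rightarrow> ('a \<Rightarrow> real) metric" where
  "cayley_graph G S = metric (cayley_points G S, cayley_dist G S)"

lemma cayley_segment_coordinate_le:
  assumes "y \<in> cayley_segment u v" "z \<in> cayley_segment u v"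
  shows "\<bar>y h - z h\<bar> \<le> \<bar>y u - z u\<bar>"
proof -
  obtain s where y: "y = (\<lambda>h. (1 - s) * cayley_vertex u h + s * cayley_vertex v h)"
    using assms(1) unfolding cayley_segment_def by blast
  obtain t where z: "z = (\<lambda>h. (1 - t) * cayley_vertex u h + t * cayley_vertex v h)"
    using assms(2) unfolding cayley_segment_def by blast
  show ?thesis unfolding y z cayley_vertex_def by auto
qed

lemma cayley_chain_coordinate_le:
  "cayley_chain G S x y r \<Longrightarrow> \<bar>x h - y h\<bar> \<le> r"
proof (induction rule: cayley_chain.induct)
  case (step x y r u v z)
  then show ?case using cayley_segment_coordinate_le[of y u v z h] by linarith
qed simp

lemma cayley_chain_nonneg: "cayley_chain G S x y r \<Longrightarrow> 0 \<le> r"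
  using order_trans[OF abs_ge_zero cayley_chain_coordinate_le] by blast

lemma cayley_chain_points:
  "cayley_chain G S x y r \<Longrightarrow> x \<in> cayley_points G S \<and> y \<in> cayley_points G S"
  by (induction rule: cayley_chain.induct) (auto simp: cayley_points_def)

lemma cayley_chain_trans:
  "cayley_chain G S y z r' \<Longrightarrow> cayley_chain G S x y r \<Longrightarrow> cayley_chain G S x z (r + r')"
proof (induction rule: cayley_chain.induct)
  case (step y y' r' u v z)
  from cayley_chain.step[OF step.IH[OF step.prems] step.hyps(2-4)]
  show ?case by (simp add: add.assoc)
qed simp

lemma cayley_chain_sym: "cayley_chain G S x y r \<Longrightarrow> cayley_chain G S y x r"
proof (induction rule: cayley_chain.induct)
  case (step x y r u v z)
  have "z \<in> cayley_points G S" using step unfolding cayley_points_def by blast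
  from cayley_chain.step[OF cayley_chain.refl[OF this] step.hyps(2) step.hyps(4,3)]
  have "cayley_chain G S z y \<bar>y u - z u\<bar>" by (simp add: abs_minus_commute)
  from cayley_chain_trans[OF step.IH this] show ?case by (simp add: add.commute)
qed (rule cayley_chain.refl)

lemma cayley_segment_ends [simp]:
  "cayley_vertex u \<in> cayley_segment u v" "cayley_vertex v \<in> cayley_segment u v"
  unfolding cayley_segment_def mem_Collect_eq
  by (rule exI[of _ 0], simp, rule exI[of _ 1], simp)

lemma cayley_chain_exists:
  assumes "group G" "S \<subseteq> carrier G" "generate G S = carrier G"
    and "x \<in> cayley_points G S" "y \<in> cayley_points G S"
  shows "\<exists>r. cayley_chain G S x y r"
proof -
  interpret group G by fact
  have edge: "\<exists>r. cayley_chain G S x y r"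
    if "cayley_adjacent G S u v" "x \<in> cayley_segment u v" "y \<in> cayley_segment u v" for x y u v
  proof -
    have "x \<in> cayley_points G S" using that unfolding cayley_points_def by blast
    from cayley_chain.step[OF cayley_chain.refl[OF this] that] show ?thesis ..
  qed
  have nbr: "\<exists>r. cayley_chain G S (cayley_vertex u) (cayley_vertex v) r"
    if "cayley_adjacent G S u v" for u v
    by (rule edge[OF that]) simp_all
  have gen: "\<forall>u\<in>carrier G. \<exists>r. cayley_chain G S (cayley_vertex u) (cayley_vertex (u \<otimes>\<^bsub>G\<^esub> g)) r"
    if "g \<in> generate G S" for g
    using that
  proof (induction rule: generate.induct)
    case one
    have "cayley_chain G S (cayley_vertex u) (cayley_vertex (u \<otimes>\<^bsub>G\<^esub> \<one>\<^bsub>G\<^esub>)) 0"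
      if "u \<in> carrier G" for u
      using that by (auto intro: cayley_chain.refl simp: cayley_points_def)
    then show ?case by blast
  next
    case (incl h)
    then show ?case using assms(2) nbr unfolding cayley_adjacent_def by blast
  next
    case (inv h)
    show ?case
    proof
      fix u assume u: "u \<in> carrier G"
      have h: "h \<in> carrier G" using inv assms(2) by blast
      then have "u = (u \<otimes>\<^bsub>G\<^esub> inv\<^bsub>G\<^esub> h) \<otimes>\<^bsub>G\<^esub> h" using u by (simp add: m_assoc)
      then have "cayley_adjacent G S u (u \<otimes>\<^bsub>G\<^esub> inv\<^bsub>G\<^esub> h)"
        unfolding cayley_adjacent_def using u h inv by blast
      then show "\<exists>r. cayley_chain G S (cayley_vertex u) (cayley_vertex (u \<otimes>\<^bsub>G\<^esub> inv\<^bsub>G\<^esub> h)) r"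
        by (rule nbr)
    qed
  next
    case (eng g h)
    show ?case
    proof
      fix u assume u: "u \<in> carrier G"
      have g: "g \<in> carrier G" and h: "h \<in> carrier G" using eng(1,2) assms(3) by auto
      obtain r where r: "cayley_chain G S (cayley_vertex u) (cayley_vertex (u \<otimes>\<^bsub>G\<^esub> g)) r"
        using eng u by blast
      obtain r' where "cayley_chain G S (cayley_vertex (u \<otimes>\<^bsub>G\<^esub> g)) (cayley_vertex (u \<otimes>\<^bsub>G\<^esub> g \<otimes>\<^bsub>G\<^esub> h)) r'"
        using eng u g by blast
      from cayley_chain_trans[OF this r]
      show "\<exists>r. cayley_chain G S (cayley_vertex u) (cayley_vertex (u \<otimes>\<^bsub>G\<^esub> (g \<otimes>\<^bsub>G\<^esub> h))) r"
        using u g h by (auto simp: m_assoc)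
    qed
  qed
  have vert: "\<exists>r. cayley_chain G S (cayley_vertex u) (cayley_vertex v) r"
    if u: "u \<in> carrier G" and v: "v \<in> carrier G" for u v
  proof -
    have "inv\<^bsub>G\<^esub> u \<otimes>\<^bsub>G\<^esub> v \<in> generate G S" using u v assms(3) by simp
    moreover have "u \<otimes>\<^bsub>G\<^esub> (inv\<^bsub>G\<^esub> u \<otimes>\<^bsub>G\<^esub> v) = v" using u v by (simp add: m_assoc[symmetric])
    ultimately show ?thesis using gen u by metis
  qed
  have to_vert: "\<exists>u\<in>carrier G. \<exists>r. cayley_chain G S x (cayley_vertex u) r"
    if x: "x \<in> cayley_points G S" for x
  proof -
    consider u where "u \<in> carrier G" "x = cayley_vertex u"
      | u v where "cayley_adjacent G S u v" "x \<in> cayley_segment u v"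
      using x unfolding cayley_points_def by blast
    then show ?thesis
    proof cases
      case 1
      with cayley_chain.refl[OF x] show ?thesis by blast
    next
      case 2
      then have "u \<in> carrier G" unfolding cayley_adjacent_def by blast
      with edge[OF 2 cayley_segment_ends(1)] show ?thesis by blast
    qed
  qed
  show ?thesis
  proof -
    obtain u r where u: "u \<in> carrier G" "cayley_chain G S x (cayley_vertex u) r"
      using to_vert[OF assms(4)] by blast
    obtain v r' where v: "v \<in> carrier G" "cayley_chain G S y (cayley_vertex v) r'"
      using to_vert[OF assms(5)] by blast
    obtain r'' where w: "cayley_chain G S (cayley_vertex u) (cayley_vertex v) r''"
      using vert u v by blast
    show ?thesis
      using cayley_chain_trans[OF cayley_chain_sym[OF v(2)] cayley_chain_trans[OF w u(2)]] ..
  qed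
qed

lemma Metric_space_cayley:
  assumes "group G" "S \<subseteq> carrier G" "generate G S = carrier G"
  shows "Metric_space (cayley_points G S) (cayley_dist G S)"
proof
  let ?X = "cayley_points G S"
  have ne: "{r. cayley_chain G S x y r} \<noteq> {}" if "x \<in> ?X" "y \<in> ?X" for x y
    using cayley_chain_exists[OF assms that] by blast
  have bdd: "bdd_below {r. cayley_chain G S x y r}" for x y
    using cayley_chain_nonneg by (intro bdd_belowI[of _ 0]) blast
  show "0 \<le> cayley_dist G S x y" for x y
    unfolding cayley_dist_def using ne by (auto intro!: cInf_greatest dest: cayley_chain_nonneg)
  show "cayley_dist G S x y = cayley_dist G S y x" for x y
  proof -
    have "{r. cayley_chain G S x y r} = {r. cayley_chain G S y x r}"
      using cayley_chain_sym by blast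
    then show ?thesis unfolding cayley_dist_def by simp
  qed
  show "cayley_dist G S x y = 0 \<longleftrightarrow> x = y" if x: "x \<in> ?X" and y: "y \<in> ?X" for x y
  proof
    assume "cayley_dist G S x y = 0"
    then have 0: "Inf {r. cayley_chain G S x y r} = 0" using x y by (simp add: cayley_dist_def)
    have "\<bar>x h - y h\<bar> \<le> Inf {r. cayley_chain G S x y r}" for h
      using ne[OF x y] by (auto intro!: cInf_greatest dest: cayley_chain_coordinate_le)
    then show "x = y" using 0 by auto
  next
    assume "x = y"
    then have "0 \<in> {r. cayley_chain G S x y r}" using x cayley_chain.refl by auto
    then have "Inf {r. cayley_chain G S x y r} \<le> 0" using bdd by (rule cInf_lower)
    moreover have "0 \<le> Inf {r. cayley_chain G S x y r}"
      using ne[OF x y] by (auto intro!: cInf_greatest dest: cayley_chain_nonneg)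
    ultimately show "cayley_dist G S x y = 0" using x y by (simp add: cayley_dist_def)
  qed
  show "cayley_dist G S x z \<le> cayley_dist G S x y + cayley_dist G S y z"
    if x: "x \<in> ?X" and y: "y \<in> ?X" and z: "z \<in> ?X" for x y z
  proof (rule field_le_epsilon)
    fix \<epsilon> :: real assume "0 < \<epsilon>"
    then have \<epsilon>: "0 < \<epsilon> / 2" by simp
    obtain r where r: "cayley_chain G S x y r" "r < cayley_dist G S x y + \<epsilon> / 2"
      using cInf_lessD[OF ne[OF x y], of "cayley_dist G S x y + \<epsilon> / 2"] x y \<epsilon>
      by (auto simp: cayley_dist_def)
    obtain r' where r': "cayley_chain G S y z r'" "r' < cayley_dist G S y z + \<epsilon> / 2"
      using cInf_lessD[OF ne[OF y z], of "cayley_dist G S y z + \<epsilon> / 2"] y z \<epsilon>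
      by (auto simp: cayley_dist_def)
    have "r + r' \<in> {r. cayley_chain G S x z r}"
      using cayley_chain_trans[OF r'(1) r(1)] by simp
    then have "cayley_dist G S x z \<le> r + r'"
      using cInf_lower[OF _ bdd] x z by (simp add: cayley_dist_def)
    then show "cayley_dist G S x z \<le> cayley_dist G S x y + cayley_dist G S y z + \<epsilon>"
      using r(2) r'(2) by linarith
  qed
qed

lemma
  assumes "group G" "S \<subseteq> carrier G" "generate G S = carrier G"
  shows mspace_cayley_graph: "mspace (cayley_graph G S) = cayley_points G S"
    and mdist_cayley_graph: "mdist (cayley_graph G S) = cayley_dist G S"
  using Metric_space.mspace_metric[OF Metric_space_cayley[OF assms]]
    Metric_space.mdist_metric[OF Metric_space_cayley[OF assms]]
  unfolding cayley_graph_def by auto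


section \<open>The action on the Morse boundary\<close>

(* The affine extension of left multiplication on the vertices. *)
definition cayley_act :: "('a, 'b) monoid_scheme \<Rightarrow> 'a \<Rightarrow> ('a \<Rightarrow> real) \<Rightarrow> 'a \<Rightarrow> real" where
  "cayley_act G g x = (\<lambda>h. if h \<in> carrier G then x (inv\<^bsub>G\<^esub> g \<otimes>\<^bsub>G\<^esub> h) else 0)"

lemma cayley_act_vertex:
  assumes "group G" "g \<in> carrier G" "u \<in> carrier G"
  shows "cayley_act G g (cayley_vertex u) = cayley_vertex (g \<otimes>\<^bsub>G\<^esub> u)"
proof -
  interpret group G by fact
  show ?thesis
    unfolding cayley_act_def cayley_vertex_def
    using assms(2,3) by (auto simp: fun_eq_iff inv_solve_left' m_assoc[symmetric])
qed

(* The map induced on classes by gamma |-> g gamma. The classes united here coincide, since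
   the elements of xi are at bounded Hausdorff distance from one another. *)
definition boundary_act ::
  "('a, 'b) monoid_scheme \<Rightarrow> 'a set \<Rightarrow> ('a \<Rightarrow> real) \<Rightarrow> 'a
     \<Rightarrow> (real \<Rightarrow> 'a \<Rightarrow> real) set \<Rightarrow> (real \<Rightarrow> 'a \<Rightarrow> real) set" where
  "boundary_act G S e g \<xi> = (\<Union>\<gamma>\<in>\<xi>. ray_class (cayley_graph G S) e (cayley_act G g \<circ> \<gamma>))"

definition boundary_orbit ::
  "('a, 'b) monoid_scheme \<Rightarrow> 'a set \<Rightarrow> ('a \<Rightarrow> real)
     \<Rightarrow> (real \<Rightarrow> 'a \<Rightarrow> real) set set \<Rightarrow> (real \<Rightarrow> 'a \<Rightarrow> real) set set set" where
  "boundary_orbit G S e C = {boundary_act G S e g ` C |g. g \<in> carrier G}"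

definition boundary_stabiliser ::
  "('a, 'b) monoid_scheme \<Rightarrow> 'a set \<Rightarrow> ('a \<Rightarrow> real)
     \<Rightarrow> (real \<Rightarrow> 'a \<Rightarrow> real) set set \<Rightarrow> 'a set" where
  "boundary_stabiliser G S e C = {g \<in> carrier G. boundary_act G S e g ` C = C}"


section \<open>Point-convergence\<close>

definition point_limit :: "'p topology \<Rightarrow> (nat \<Rightarrow> 'p set) \<Rightarrow> 'p set" where
  "point_limit T A = {x. \<exists>\<sigma>. (\<forall>n. \<sigma> n \<in> A n) \<and> limitin T \<sigma> x sequentially}"

definition point_convergent :: "'p topology \<Rightarrow> 'p set set \<Rightarrow> bool" where
  "point_convergent T \<F> \<longleftrightarrow>
     (\<forall>A :: nat \<Rightarrow> 'p set. range A \<subseteq> \<F> \<and> inj A \<longrightarrow> (\<exists>x. point_limit T A \<subseteq> {x}))"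

end

theory Submission
  imports Defs
begin

text \<open>
  Choose distinct points \<open>\<xi>, \<eta>\<close> of \<open>C\<close>.

  If a ray towards \<open>\<xi>\<close> left every neighbourhood of the stabiliser \<open>H\<close>, it would pass near elements
  \<open>g\<^sub>n\<close> whose distance to \<open>H\<close> tends to infinity, so that the translates \<open>g\<^sub>n\<inverse> C\<close> are distinct after
  passing to a subsequence. Seen from \<open>g\<^sub>n\<close>, the points \<open>\<xi>\<close> and \<open>\<eta>\<close> lie in opposite directions,
  so \<open>g\<^sub>n\<inverse> \<xi>\<close> and \<open>g\<^sub>n\<inverse> \<eta>\<close> subconverge to two different points, against point-convergence.

  Conversely, let a Morse ray \<open>\<gamma>\<close> stay near elements \<open>h\<^sub>n\<close> of \<open>H\<close>. Both \<open>h\<^sub>n \<xi>\<close> and \<open>h\<^sub>n \<eta>\<close> belong to \<open>C\<close>,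
  and the ray from the base point to at least one of them passes near \<open>h\<^sub>n\<close>; these points converge to
  \<open>\<gamma>\<^sup>+\<close>, which lies in \<open>C\<close> because components are closed.

  All convergence takes place inside a single stratum: gauges are only ever bounded from above, and a
  gauge may be enlarged so that \<open>\<delta>\<^sub>N\<close> exceeds any given constant.
\<close>

section \<open>Geodesic segments, quasi-geodesics and Morse sets\<close>

text \<open>No hyperbolicity is available: a geodesic triangle is known to be thin only when two of
  its sides are Morse. The third side is then Morse too, with a gauge depending on the given gauges
  alone. This uniformity replaces hyperbolicity: gauges are unchanged by translation and survive
  limits in the proper space up to constants, so a single gauge serves a whole sequence of rays.

  Opposite directions at g_n come from an ideal triangle. The rays from the base point to \<xi> and
  \<eta> diverge, so from a point far out on the ray to \<xi> the way to \<eta> first leads back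
  towards the base point, while the way to \<xi> leads on. After time \<tau> the two are about 2
  \<tau> apart, up to a constant independent of n, which prevents the limits from coinciding.

  The same divergence explains the choice in the converse. A segment from h_n back to the base point
  can follow at most one of the rays from h_n to h_n \<xi> and h_n \<eta> for long; continued by the
  other one it is coarsely straight, and the ray from the base point in that direction has to pass
  near h_n.\<close>

definition isometric_on :: "'p metric \<Rightarrow> real set \<Rightarrow> (real \<Rightarrow> 'p) \<Rightarrow> bool" where
  "isometric_on X I p \<longleftrightarrow> p ` I \<subseteq> mspace X \<and> (\<forall>s\<in>I. \<forall>t\<in>I. mdist X (p s) (p t) = \<bar>s - t\<bar>)"

definition geodesic_segment :: "'p metric \<Rightarrow> 'p set \<Rightarrow> 'p \<Rightarrow> 'p \<Rightarrow> bool" where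
  "geodesic_segment X A x y \<longleftrightarrow>
     (\<exists>p l. 0 \<le> l \<and> isometric_on X {0..l} p \<and> p 0 = x \<and> p l = y \<and> A = p ` {0..l})"

text \<open>Metric betweenness: on a geodesic this is the stretch between two of its points,
  whichever of them comes first, and no parametrisation has to be carried along.\<close>

definition subsegment :: "'p metric \<Rightarrow> 'p set \<Rightarrow> 'p \<Rightarrow> 'p \<Rightarrow> 'p set" where
  "subsegment X A u v = {w \<in> A. mdist X u w + mdist X w v = mdist X u v}"

text \<open>A one-sided neighbourhood relation with an actual witness, where
  \<open>closed_nbhd\<close> has an infimum that need not be attained. Passing from
  \<open>closed_nbhd\<close> to this relation costs a positive constant, taken to be 1.\<close>

definition coarse_in :: "'p metric \<Rightarrow> real \<Rightarrow> 'p set \<Rightarrow> 'p set \<Rightarrow> bool" where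
  "coarse_in X r A B \<longleftrightarrow> (\<forall>x\<in>A. \<exists>y\<in>B. mdist X x y \<le> r)"

(* Unlike morse_on, this does not refer to a parametrisation, so that the sides of a
   triangle need no orientation. *)
definition morse_set :: "'p metric \<Rightarrow> (real \<Rightarrow> real \<Rightarrow> real) \<Rightarrow> 'p set \<Rightarrow> bool" where
  "morse_set X N A \<longleftrightarrow> A \<subseteq> mspace X \<and>
     (\<forall>u\<in>A. \<forall>v\<in>A. \<forall>q\<ge>1. \<forall>Q\<ge>0. \<forall>a b \<eta>.
        a \<le> b \<and> quasi_geodesic X q Q {a..b} \<eta> \<and> \<eta> a = u \<and> \<eta> b = v \<longrightarrow>
        coarse_in X (N q Q) (\<eta> ` {a..b}) (subsegment X A u v))"

lemma isometric_onD:
  "isometric_on X I p \<Longrightarrow> s \<in> I \<Longrightarrow> p s \<in> mspace X"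
  "isometric_on X I p \<Longrightarrow> s \<in> I \<Longrightarrow> t \<in> I \<Longrightarrow> mdist X (p s) (p t) = \<bar>s - t\<bar>"
  by (auto simp: isometric_on_def)

lemma isometric_on_subset: "isometric_on X I p \<Longrightarrow> J \<subseteq> I \<Longrightarrow> isometric_on X J p"
  by (auto simp: isometric_on_def subset_iff)

lemma geodesic_ray_iff: "geodesic_ray X a \<longleftrightarrow> isometric_on X {0..} a"
  by (auto simp: geodesic_ray_def isometric_on_def)

lemma coarse_inD: "coarse_in X r A B \<Longrightarrow> x \<in> A \<Longrightarrow> \<exists>y\<in>B. mdist X x y \<le> r"
  by (auto simp: coarse_in_def)

lemma coarse_in_mono: "coarse_in X r A B \<Longrightarrow> r \<le> r' \<Longrightarrow> A' \<subseteq> A \<Longrightarrow> B \<subseteq> B' \<Longrightarrow> coarse_in X r' A' B'"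
  unfolding coarse_in_def by (meson order_trans subsetD)

lemma coarse_in_trans:
  assumes "coarse_in X r A B" "coarse_in X r' B C" "A \<subseteq> mspace X" "B \<subseteq> mspace X" "C \<subseteq> mspace X"
  shows "coarse_in X (r + r') A C"
  unfolding coarse_in_def
proof
  fix x assume x: "x \<in> A"
  then obtain y where y: "y \<in> B" "mdist X x y \<le> r" using assms(1) coarse_inD by metis
  then obtain z where z: "z \<in> C" "mdist X y z \<le> r'" using assms(2) coarse_inD by metis
  have "mdist X x z \<le> mdist X x y + mdist X y z"
    using x y z assms by (intro mdist_triangle) auto
  then show "\<exists>z\<in>C. mdist X x z \<le> r + r'" using y z by force
qed

lemma mdist_self [simp]: "x \<in> mspace X \<Longrightarrow> mdist X x x = 0"
  by simp

lemma isometric_on_segment: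
  assumes "isometric_on X {s..t} p" "s \<le> t"
  shows "geodesic_segment X (p ` {s..t}) (p s) (p t)"
proof -
  have img: "p ` {s..t} = (\<lambda>\<tau>. p (s + \<tau>)) ` {0..t - s}"
    using image_add_atLeastAtMost[of s 0 "t - s"] by (simp add: image_image[symmetric])
  show ?thesis unfolding geodesic_segment_def
    by (rule exI[of _ "\<lambda>\<tau>. p (s + \<tau>)"], rule exI[of _ "t - s"])
      (use assms in \<open>auto simp: img isometric_on_def\<close>)
qed

lemma geodesic_segment_sym:
  assumes "geodesic_segment X A x y" shows "geodesic_segment X A y x"
proof -
  obtain p l where p: "0 \<le> l" "isometric_on X {0..l} p" "p 0 = x" "p l = y" "A = p ` {0..l}"
    using assms unfolding geodesic_segment_def by blast
  have img: "A = (\<lambda>\<tau>. p (l - \<tau>)) ` {0..l}"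
    using p image_image[of p "\<lambda>\<tau>. l - \<tau>" "{0..l}"] by simp
  show ?thesis unfolding geodesic_segment_def
    by (rule exI[of _ "\<lambda>\<tau>. p (l - \<tau>)"], rule exI[of _ l])
      (use p in \<open>auto simp: img isometric_on_def\<close>)
qed

lemma geodesic_segmentD:
  assumes "geodesic_segment X A x y"
  shows "A \<subseteq> mspace X" "x \<in> A" "y \<in> A" "x \<in> mspace X" "y \<in> mspace X"
  using assms unfolding geodesic_segment_def isometric_on_def by (force)+

lemma geodesic_segment_param:
  assumes "geodesic_segment X A x y"
  obtains p where "isometric_on X {0..mdist X x y} p" "p 0 = x" "p (mdist X x y) = y"
    "A = p ` {0..mdist X x y}"
proof -
  obtain p l where p: "0 \<le> l" "isometric_on X {0..l} p" "p 0 = x" "p l = y" "A = p ` {0..l}"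
    using assms unfolding geodesic_segment_def by blast
  then have "mdist X x y = l" using isometric_onD(2)[OF p(2), of 0 l] by auto
  with p that show thesis by auto
qed

lemma subsegment_isometric:
  assumes "isometric_on X I p" "s \<in> I" "t \<in> I" "{min s t..max s t} \<subseteq> I"
  shows "subsegment X (p ` I) (p s) (p t) = p ` {min s t..max s t}"
proof (intro equalityI subsetI)
  fix w assume "w \<in> subsegment X (p ` I) (p s) (p t)"
  then obtain r where r: "r \<in> I" "w = p r" "mdist X (p s) (p r) + mdist X (p r) (p t) = mdist X (p s) (p t)"
    by (auto simp: subsegment_def)
  then have "\<bar>s - r\<bar> + \<bar>r - t\<bar> = \<bar>s - t\<bar>" using assms isometric_onD(2)[OF assms(1)] by auto
  then have "r \<in> {min s t..max s t}" by auto
  then show "w \<in> p ` {min s t..max s t}" using r by blast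
next
  fix w assume "w \<in> p ` {min s t..max s t}"
  then obtain r where r: "r \<in> {min s t..max s t}" "w = p r" by blast
  have "r \<in> I" using r assms by blast
  then show "w \<in> subsegment X (p ` I) (p s) (p t)"
    using r assms isometric_onD(2)[OF assms(1)] by (auto simp: subsegment_def)
qed

lemma subsegment_isometric_le:
  assumes "isometric_on X I p" "s \<in> I" "t \<in> I" "s \<le> t" "{s..t} \<subseteq> I"
  shows "subsegment X (p ` I) (p s) (p t) = p ` {s..t}"
  using subsegment_isometric[OF assms(1-3)] assms(4,5) by (simp only: min_absorb1 max_absorb2)

lemma subsegment_sym: "subsegment X A u v = subsegment X A v u"
  unfolding subsegment_def by (auto simp: mdist_commute add.commute)

lemma subsegment_subset: "subsegment X A u v \<subseteq> A"
  by (auto simp: subsegment_def)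

lemma segment_subsegment:
  assumes "geodesic_segment X A x y" "u \<in> A" "v \<in> A"
  shows "geodesic_segment X (subsegment X A u v) u v"
proof -
  obtain p l where p: "0 \<le> l" "isometric_on X {0..l} p" "p 0 = x" "p l = y" "A = p ` {0..l}"
    using assms unfolding geodesic_segment_def by blast
  have *: "geodesic_segment X (subsegment X A (p s) (p t)) (p s) (p t)"
    if "s \<in> {0..l}" "t \<in> {0..l}" "s \<le> t" for s t
    using that p subsegment_isometric[OF p(2), of s t]
    by (auto intro!: isometric_on_segment isometric_on_subset[OF p(2)] simp: min_absorb1 max_absorb2)
  obtain s t where st: "s \<in> {0..l}" "t \<in> {0..l}" "u = p s" "v = p t" using assms p by blast
  show ?thesis
  proof (cases "s \<le> t")
    case True then show ?thesis using * st by auto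
  next
    case False
    then have "geodesic_segment X (subsegment X A v u) v u" using * st by auto
    then show ?thesis using geodesic_segment_sym subsegment_sym by metis
  qed
qed

lemma segment_split:
  assumes "geodesic_segment X A x y" "p \<in> A" "w \<in> A"
  shows "w \<in> subsegment X A x p \<or> w \<in> subsegment X A p y"
proof -
  obtain c l where c: "0 \<le> l" "isometric_on X {0..l} c" "c 0 = x" "c l = y" "A = c ` {0..l}"
    using assms unfolding geodesic_segment_def by blast
  obtain s t where st: "s \<in> {0..l}" "t \<in> {0..l}" "p = c s" "w = c t" using assms c by blast
  have "0 \<in> {0..l}" "l \<in> {0..l}" using c by auto
  then show ?thesis
    using st c assms isometric_onD(2)[OF c(2)] unfolding subsegment_def
    by (auto simp: c(3)[symmetric] c(4)[symmetric])
qed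

lemma subsegment_join:
  assumes "geodesic_segment X A x y" "p \<in> A" "u \<in> subsegment X A x p" "v \<in> subsegment X A p y"
  shows "subsegment X A u p \<subseteq> subsegment X A u v" "subsegment X A p v \<subseteq> subsegment X A u v"
proof -
  obtain c l where c: "0 \<le> l" "isometric_on X {0..l} c" "c 0 = x" "c l = y" "A = c ` {0..l}"
    using assms unfolding geodesic_segment_def by blast
  obtain s where s: "s \<in> {0..l}" "p = c s" using assms c by blast
  have 0: "0 \<in> {0..l}" "l \<in> {0..l}" using c by auto
  have 1: "subsegment X A x p = c ` {0..s}" "subsegment X A p y = c ` {s..l}"
    using subsegment_isometric_le[OF c(2) 0(1) s(1)] subsegment_isometric_le[OF c(2) s(1) 0(2)] s
    by (simp_all flip: c(3,4) add: c(5))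
  obtain a b where ab: "a \<in> {0..s}" "b \<in> {s..l}" "u = c a" "v = c b" using assms 1 by auto
  have *: "subsegment X A (c i) (c j) = c ` {i..j}" if "0 \<le> i" "i \<le> j" "j \<le> l" for i j
    using subsegment_isometric[OF c(2), of i j] c that by (auto simp: min_absorb1 max_absorb2)
  show "subsegment X A u p \<subseteq> subsegment X A u v" "subsegment X A p v \<subseteq> subsegment X A u v"
    using *[of a s] *[of s b] *[of a b] ab s by auto
qed

section \<open>Morse sets under restriction and small perturbations\<close>

lemma morse_setD:
  assumes "morse_set X N A" "1 \<le> q" "0 \<le> Q" "a \<le> b" "quasi_geodesic X q Q {a..b} \<eta>"
    "\<eta> a \<in> A" "\<eta> b \<in> A"
  shows "coarse_in X (N q Q) (\<eta> ` {a..b}) (subsegment X A (\<eta> a) (\<eta> b))"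
  using assms unfolding morse_set_def by blast

lemma morse_set_mspace: "morse_set X N A \<Longrightarrow> A \<subseteq> mspace X"
  by (simp add: morse_set_def)

lemma morse_set_mono:
  assumes "morse_set X N A" "\<And>q Q. q \<ge> 1 \<Longrightarrow> Q \<ge> 0 \<Longrightarrow> N q Q \<le> N' q Q"
  shows "morse_set X N' A"
  using assms unfolding morse_set_def by (meson order_refl coarse_in_mono)

text \<open>Betweenness refers to the metric alone, so a subset closed under it has the same
  subsegments as the ambient set. Initial stretches and tails of a Morse ray are of this
  kind.\<close>

lemma morse_set_convex_subset:
  assumes "morse_set X N A" "B \<subseteq> A"
    and "\<And>u v. u \<in> B \<Longrightarrow> v \<in> B \<Longrightarrow> subsegment X A u v \<subseteq> B"
  shows "morse_set X N B"
proof -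
  have "subsegment X A u v = subsegment X B u v" if "u \<in> B" "v \<in> B" for u v
    using assms that unfolding subsegment_def by blast
  then show ?thesis
    using assms(1,2) morse_set_mspace[OF assms(1)] unfolding morse_set_def[of X N B]
    by (auto dest: morse_setD[OF assms(1)])
qed

lemma quasi_geodesicD:
  assumes "quasi_geodesic X q Q I \<eta>" "s \<in> I" "t \<in> I"
  shows "\<eta> s \<in> mspace X" "\<bar>s - t\<bar> / q - Q \<le> mdist X (\<eta> s) (\<eta> t)"
    "mdist X (\<eta> s) (\<eta> t) \<le> q * \<bar>s - t\<bar> + Q"
  using assms unfolding quasi_geodesic_def by auto

lemma quasi_geodesic_uminus:
  assumes "quasi_geodesic X q Q {a..b} \<eta>"
  shows "quasi_geodesic X q Q {-b..-a} (\<lambda>t. \<eta> (- t))"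
  unfolding quasi_geodesic_def
proof (intro conjI ballI subsetI)
  fix s t assume st: "s \<in> {-b..-a}" "t \<in> {-b..-a}"
  show "\<bar>s - t\<bar> / q - Q \<le> mdist X (\<eta> (- s)) (\<eta> (- t))"
    "mdist X (\<eta> (- s)) (\<eta> (- t)) \<le> q * \<bar>s - t\<bar> + Q"
    using quasi_geodesicD(2,3)[OF assms, of "-s" "-t"] st by (auto simp: abs_minus_commute)
qed (use assms in \<open>auto simp: quasi_geodesic_def\<close>)

lemma isometric_quasi_geodesic:
  assumes "isometric_on X I p" "0 \<le> Q" shows "quasi_geodesic X 1 Q I p"
  using assms unfolding isometric_on_def quasi_geodesic_def by auto

lemma mdist_quadrilateral:
  assumes "u \<in> mspace X" "v \<in> mspace X" "u' \<in> mspace X" "v' \<in> mspace X"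
    "mdist X u u' \<le> r" "mdist X v v' \<le> r'"
  shows "\<bar>mdist X u v - mdist X u' v'\<bar> \<le> r + r'"
proof -
  have "mdist X u v \<le> mdist X u u' + mdist X u' v" "mdist X u' v \<le> mdist X u' v' + mdist X v' v"
    "mdist X u' v' \<le> mdist X u' u + mdist X u v'" "mdist X u v' \<le> mdist X u v + mdist X v v'"
    using assms by (auto intro!: mdist_triangle)
  then show ?thesis using assms mdist_commute[of X u u'] mdist_commute[of X v v'] by linarith
qed

text \<open>The prescribed ends are attached by jumps, which a quasi-geodesic may have:
  \<open>\<zeta>\<close> rests at \<open>u\<close> for one unit of time before \<open>a\<close> and
  at \<open>v\<close> for one unit after \<open>b\<close>. Comparison with the clamped time
  \<open>c t\<close> costs at most 2 in the parameter and \<open>K\<close> at each of the two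
  points, hence \<open>Q + 2 * K + 2\<close>.\<close>

lemma quasi_geodesic_perturb:
  assumes q: "1 \<le> q" and qg: "quasi_geodesic X q Q {a..b} \<eta>" and "a \<le> b"
    and ends: "u \<in> mspace X" "v \<in> mspace X" "mdist X (\<eta> a) u \<le> K" "mdist X (\<eta> b) v \<le> K"
  defines "\<zeta> \<equiv> \<lambda>t. if t < a then u else if t > b then v else \<eta> t"
  shows "quasi_geodesic X q (Q + 2 * K + 2) {a - 1..b + 1} \<zeta>"
proof -
  have K: "0 \<le> K" by (rule order_trans[OF mdist_nonneg ends(3)])
  define c where "c \<equiv> \<lambda>t. max a (min b t)"
  have c: "c t \<in> {a..b}" for t using \<open>a \<le> b\<close> by (auto simp: c_def)
  have M: "\<eta> (c t) \<in> mspace X" for t using quasi_geodesicD(1)[OF qg c c] .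
  have Z: "\<zeta> t \<in> mspace X" "mdist X (\<zeta> t) (\<eta> (c t)) \<le> K" for t
    using ends M[of t] K \<open>a \<le> b\<close> M[of a] M[of b] 
    by (auto simp: \<zeta>_def c_def mdist_commute min_def max_def split: if_splits)
  show ?thesis unfolding quasi_geodesic_def
  proof (intro conjI ballI subsetI)
    fix s t assume st: "s \<in> {a - 1..b + 1}" "t \<in> {a - 1..b + 1}"
    have cc: "\<bar>s - t\<bar> - 2 \<le> \<bar>c s - c t\<bar>" "\<bar>c s - c t\<bar> \<le> \<bar>s - t\<bar>"
      using st \<open>a \<le> b\<close> by (auto simp: c_def)
    have 1: "\<bar>mdist X (\<zeta> s) (\<zeta> t) - mdist X (\<eta> (c s)) (\<eta> (c t))\<bar> \<le> K + K"
      using Z M by (intro mdist_quadrilateral) auto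
    have "(\<bar>s - t\<bar> - 2) / q \<le> \<bar>c s - c t\<bar> / q" using cc q by (intro divide_right_mono) auto
    moreover have "2 / q \<le> 2" using q by (simp add: field_simps)
    ultimately have "\<bar>s - t\<bar> / q \<le> \<bar>c s - c t\<bar> / q + 2" by (simp add: diff_divide_distrib)
    then show "\<bar>s - t\<bar> / q - (Q + 2 * K + 2) \<le> mdist X (\<zeta> s) (\<zeta> t)"
      using 1 quasi_geodesicD(2)[OF qg c[of s] c[of t]] by linarith
    have "q * \<bar>c s - c t\<bar> \<le> q * \<bar>s - t\<bar>" using cc q by (intro mult_left_mono) auto
    then show "mdist X (\<zeta> s) (\<zeta> t) \<le> q * \<bar>s - t\<bar> + (Q + 2 * K + 2)"
      using 1 quasi_geodesicD(3)[OF qg c[of s] c[of t]] by linarith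
  qed (use Z in auto)
qed

text \<open>Quasi-geodesics that merely start and end near a Morse set come under its control in
  this way; the displacement \<open>K\<close> of the ends enters only the second argument of the
  gauge.\<close>

lemma morse_set_perturb:
  assumes A: "morse_set X N A" and "1 \<le> q" "0 \<le> Q" "a \<le> b" "quasi_geodesic X q Q {a..b} \<eta>"
    and "u \<in> A" "v \<in> A" "mdist X (\<eta> a) u \<le> K" "mdist X (\<eta> b) v \<le> K"
  shows "coarse_in X (N q (Q + 2 * K + 2)) (\<eta> ` {a..b}) (subsegment X A u v)"
proof -
  have K: "0 \<le> K" by (rule order_trans[OF mdist_nonneg assms(8)])
  define \<zeta> where "\<zeta> \<equiv> \<lambda>t. if t < a then u else if t > b then v else \<eta> t"
  have "quasi_geodesic X q (Q + 2 * K + 2) {a - 1..b + 1} \<zeta>"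
    unfolding \<zeta>_def using assms morse_set_mspace[OF A] by (intro quasi_geodesic_perturb) auto
  moreover have e: "\<zeta> (a - 1) = u" "\<zeta> (b + 1) = v" using \<open>a \<le> b\<close> by (auto simp: \<zeta>_def)
  ultimately have "coarse_in X (N q (Q + 2 * K + 2)) (\<zeta> ` {a - 1..b + 1}) (subsegment X A u v)"
    using assms K morse_setD[OF A, of q "Q + 2 * K + 2" "a - 1" "b + 1" \<zeta>] by auto
  moreover have "\<eta> ` {a..b} \<subseteq> \<zeta> ` {a - 1..b + 1}"
    by (auto simp: \<zeta>_def image_iff intro!: bexI)
  ultimately show ?thesis using coarse_in_mono by blast
qed

text \<open>The lower bound in the definition of a quasi-geodesic makes the parameter interval no
  longer than \<open>q * (K + Q)\<close>; the upper bound then keeps the whole path near its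
  starting point. Short segments can thus serve as sides of Morse triangles with a gauge known in
  advance.\<close>

lemma morse_set_bounded:
  assumes A: "A \<subseteq> mspace X" and "\<And>u v. u \<in> A \<Longrightarrow> v \<in> A \<Longrightarrow> mdist X u v \<le> K"
  shows "morse_set X (\<lambda>q Q. q * (q * (K + Q)) + Q) A"
  unfolding morse_set_def coarse_in_def
proof (intro conjI ballI allI impI A)
  fix u v q Q a b \<eta> x
  assume h: "u \<in> A" "v \<in> A" "1 \<le> q" "0 \<le> Q"
    "a \<le> b \<and> quasi_geodesic X q Q {a..b} \<eta> \<and> \<eta> a = u \<and> \<eta> b = v" "x \<in> \<eta> ` {a..b}"
  obtain c where c: "c \<in> {a..b}" "x = \<eta> c" using h by blast
  have "(b - a) / q \<le> K + Q"
    using quasi_geodesicD(2)[of X q Q "{a..b}" \<eta> a b] h assms(2)[of u v] by auto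
  then have "b - a \<le> q * (K + Q)" using h by (simp add: field_simps)
  then have "q * (c - a) \<le> q * (q * (K + Q))" using h c by (intro mult_left_mono) auto
  moreover have "mdist X x u \<le> q * \<bar>c - a\<bar> + Q" "\<bar>c - a\<bar> = c - a"
    using quasi_geodesicD(3)[of X q Q "{a..b}" \<eta> c a] h c by auto
  ultimately have "mdist X x u \<le> q * (q * (K + Q)) + Q" by simp
  moreover have "u \<in> subsegment X A u v" using h A by (auto simp: subsegment_def)
  ultimately show "\<exists>y\<in>subsegment X A u v. mdist X x y \<le> q * (q * (K + Q)) + Q" by blast
qed

text \<open>The function may jump, but by at most \<open>D\<close> within unit time. With
  \<open>m\<close> the supremum of the times at which \<open>f\<close> is at most \<open>y\<close>,
  there is such a time in the last half unit before \<open>m\<close>, and \<open>f\<close> is at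
  least \<open>y\<close> at time \<open>min b (m + 1/2)\<close>.\<close>

lemma coarse_ivt:
  fixes f :: "real \<Rightarrow> real"
  assumes "a \<le> b" "f a \<le> y" "y \<le> f b"
    and f: "\<And>s t. s \<in> {a..b} \<Longrightarrow> t \<in> {a..b} \<Longrightarrow> \<bar>s - t\<bar> \<le> 1 \<Longrightarrow> \<bar>f s - f t\<bar> \<le> D"
  shows "\<exists>c\<in>{a..b}. \<bar>f c - y\<bar> \<le> D"
proof -
  define S where "S = {\<tau> \<in> {a..b}. f \<tau> \<le> y}"
  have S: "a \<in> S" "bdd_above S" using assms by (auto simp: S_def intro!: bdd_aboveI[of _ b])
  define m where "m = Sup S"
  obtain c where c: "c \<in> S" "m - 1/2 < c" using less_cSupD[of S "m - 1/2"] S m_def by force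
  have "c \<le> m" using cSup_upper[OF c(1) S(2)] m_def by simp
  have cab: "c \<in> {a..b}" "f c \<le> y" using c by (auto simp: S_def)
  define c' where "c' = min b (m + 1/2)"
  have "m \<le> b" unfolding m_def using S by (intro cSup_least) (auto simp: S_def)
  then have c'ab: "c' \<in> {a..b}" using cab \<open>c \<le> m\<close> by (auto simp: c'_def)
  have "y \<le> f c'"
  proof (cases "c' = b")
    case False
    then have "m < c'" by (auto simp: c'_def)
    then have "c' \<notin> S" using cSup_upper[OF _ S(2), of c'] m_def by force
    then show ?thesis using c'ab by (auto simp: S_def)
  qed (use assms in simp)
  moreover have "\<bar>f c - f c'\<bar> \<le> D"
    using f[OF cab(1) c'ab] c \<open>c \<le> m\<close> \<open>m \<le> b\<close> by (auto simp: c'_def)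
  ultimately show ?thesis using cab by (intro bexI[of _ c]) auto
qed

lemma coarse_ivt':
  fixes f :: "real \<Rightarrow> real"
  assumes "a \<le> b" "min (f a) (f b) \<le> y" "y \<le> max (f a) (f b)"
    and f: "\<And>s t. s \<in> {a..b} \<Longrightarrow> t \<in> {a..b} \<Longrightarrow> \<bar>s - t\<bar> \<le> 1 \<Longrightarrow> \<bar>f s - f t\<bar> \<le> D"
  shows "\<exists>c\<in>{a..b}. \<bar>f c - y\<bar> \<le> D"
proof (cases "f a \<le> f b")
  case True
  then show ?thesis using assms coarse_ivt[of a b f y D] by auto
next
  case False
  have "\<exists>c\<in>{a..b}. \<bar>- f c - (- y)\<bar> \<le> D"
  proof (rule coarse_ivt[of a b "\<lambda>t. - f t" "-y" D])
    show "\<bar>- f s - - f t\<bar> \<le> D" if "s \<in> {a..b}" "t \<in> {a..b}" "\<bar>s - t\<bar> \<le> 1" for s t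
      using f[OF that] by linarith
  qed (use assms False in auto)
  then show ?thesis by (force simp: abs_minus_commute)
qed

text \<open>Sending each time on \<open>C\<close> to the time of a nearby point of \<open>A\<close>
  gives a function that jumps by at most \<open>1 + 2 * \<delta>\<close> in unit time. By the coarse
  intermediate value theorem it comes that close to every time between those of \<open>u'\<close>
  and \<open>v'\<close>; a last step of \<open>\<delta>\<close> leads back to
  \<open>C\<close>.\<close>

lemma subsegment_within_segment:
  assumes C: "geodesic_segment X C u v" and A: "geodesic_segment X A x y"
    and near: "coarse_in X \<delta> C A" and uv: "u' \<in> A" "v' \<in> A" "mdist X u u' \<le> \<delta>" "mdist X v v' \<le> \<delta>"
  shows "coarse_in X (3 * \<delta> + 1) (subsegment X A u' v') C"
  unfolding coarse_in_def
proof
  fix z assume z: "z \<in> subsegment X A u' v'"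
  obtain p l where p: "0 \<le> l" "isometric_on X {0..l} p" "A = p ` {0..l}"
    using A unfolding geodesic_segment_def by blast
  obtain c m where c: "0 \<le> m" "isometric_on X {0..m} c" "C = c ` {0..m}" "c 0 = u" "c m = v"
    using C unfolding geodesic_segment_def by blast
  obtain a b where ab: "a \<in> {0..l}" "b \<in> {0..l}" "u' = p a" "v' = p b" using p uv by blast
  have "\<exists>r. r \<in> {0..l} \<and> mdist X (c t) (p r) \<le> \<delta>" if "t \<in> {0..m}" for t
    using coarse_inD[OF near, of "c t"] c(3) p(3) that by auto
  then obtain g where g: "\<And>t. t \<in> {0..m} \<Longrightarrow> g t \<in> {0..l} \<and> mdist X (c t) (p (g t)) \<le> \<delta>" by metis
  \<comment> \<open>The choice is forced at both ends, so that the values of \<open>f\<close> there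
    are the times of \<open>u'\<close> and \<open>v'\<close> themselves. If \<open>C\<close> is a
    single point the two requirements clash, which is the reason for the case \<open>m = 0\<close>
    below.\<close>
  define f where "f \<equiv> \<lambda>t. if t = 0 then a else if t = m then b else g t"
  define bb where "bb = f m"
  have bb: "bb \<in> {0..l}" "p bb \<in> {u', v'}" using ab by (auto simp: bb_def f_def)
  have "subsegment X A u' v' = p ` {min a b..max a b}"
    using subsegment_isometric[OF p(2), of a b] ab p by auto
  then obtain r where r: "r \<in> {min a b..max a b}" "z = p r" using z by blast
  then have rl: "r \<in> {0..l}" using ab by auto
  have M: "\<And>t. t \<in> {0..m} \<Longrightarrow> c t \<in> mspace X" "\<And>t. t \<in> {0..l} \<Longrightarrow> p t \<in> mspace X"
    using c p isometric_onD by metis+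
  have \<delta>: "0 \<le> \<delta>" by (rule order_trans[OF mdist_nonneg uv(3)])
  have f: "f t \<in> {0..l}" "mdist X (c t) (p (f t)) \<le> \<delta>" if "t \<in> {0..m}" for t
    using g[OF that] ab uv c by (auto simp: f_def)
  have lip: "\<bar>f s - f t\<bar> \<le> 1 + 2 * \<delta>" if "s \<in> {0..m}" "t \<in> {0..m}" "\<bar>s - t\<bar> \<le> 1" for s t
  proof -
    have "\<bar>mdist X (c s) (c t) - mdist X (p (f s)) (p (f t))\<bar> \<le> \<delta> + \<delta>"
      using that f M by (intro mdist_quadrilateral) auto
    then show ?thesis
      using that f[OF that(1)] f[OF that(2)] isometric_onD(2)[OF c(2), of s t]
        isometric_onD(2)[OF p(2), of "f s" "f t"] by auto
  qed
  show "\<exists>w\<in>C. mdist X z w \<le> 3 * \<delta> + 1"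
  proof (cases "m = 0")
    case True
    then have "\<bar>mdist X u v - mdist X u' v'\<bar> \<le> \<delta> + \<delta>"
      using uv M ab c by (intro mdist_quadrilateral) auto
    moreover have "u = v" using True c by simp
    ultimately have "mdist X u' v' \<le> 2 * \<delta>" using M(1)[of 0] c by auto
    then have "\<bar>a - b\<bar> \<le> 2 * \<delta>" using isometric_onD(2)[OF p(2) ab(1,2)] ab by auto
    then have "mdist X z u' \<le> 2 * \<delta>" using isometric_onD(2)[OF p(2) rl ab(1)] ab r by auto
    moreover have "mdist X z u \<le> mdist X z u' + mdist X u' u"
      using ab r M(1)[of 0] M(2)[OF rl] M(2)[OF ab(1)] c by (intro mdist_triangle) auto
    moreover have "u \<in> C" using c by auto
    ultimately show ?thesis using uv \<delta> by (intro bexI[of _ u]) (auto simp: mdist_commute)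
  next
    case False
    then have "f 0 = a" "f m = b" using c by (auto simp: f_def)
    then obtain t where t: "t \<in> {0..m}" "\<bar>f t - r\<bar> \<le> 1 + 2 * \<delta>"
      using coarse_ivt'[of 0 m f r "1 + 2 * \<delta>"] lip r c by auto
    have "mdist X z (c t) \<le> mdist X z (p (f t)) + mdist X (p (f t)) (c t)"
      using t f rl r M by (intro mdist_triangle) auto
    moreover have "mdist X z (p (f t)) \<le> 1 + 2 * \<delta>"
      using isometric_onD(2)[OF p(2) rl, of "f t"] t f[OF t(1)] r by auto
    ultimately show ?thesis using f[OF t(1)] t c by (intro bexI[of _ "c t"]) (auto simp: mdist_commute)
  qed
qed

section \<open>Morse triangles\<close>

locale geodesic_space =
  fixes X :: "'p metric"
  assumes geodesic: "x \<in> mspace X \<Longrightarrow> y \<in> mspace X \<Longrightarrow> \<exists>A. geodesic_segment X A x y"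
begin

(* Quasi-geodesics are not continuous, so a nearest point need not exist; nearest up to an
   additive error of 1 is good enough. *)
lemma quasi_geodesic_nearest_point:
  assumes q: "1 \<le> q" and qg: "quasi_geodesic X q Q {a..b} \<eta>" and Q: "0 \<le> Q"
    and p: "p \<in> mspace X" and c: "c \<in> {a..b}"
    and near: "\<And>t. t \<in> {a..b} \<Longrightarrow> mdist X p (\<eta> c) \<le> mdist X p (\<eta> t) + 1"
  obtains \<zeta> b' where "a \<le> b'" "quasi_geodesic X (3 * q) (Q + 2) {a..b'} \<zeta>"
    "\<zeta> a = \<eta> a" "\<zeta> b' = p" "\<eta> ` {a..c} \<subseteq> \<zeta> ` {a..b'}"
proof -
  define r where "r = mdist X (\<eta> c) p"
  have Mc: "\<eta> c \<in> mspace X" using quasi_geodesicD[OF qg c c] by simp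
  obtain A where "geodesic_segment X A (\<eta> c) p" using geodesic[OF Mc p] by blast
  then obtain g where g: "isometric_on X {0..r} g" "g 0 = \<eta> c" "g r = p"
    using geodesic_segment_param r_def by metis
  have r: "0 \<le> r" by (simp add: r_def)
  define \<zeta> where "\<zeta> \<equiv> \<lambda>t. if t \<le> c then \<eta> t else g (t - c)"
  have gz: "\<zeta> t = g (t - c)" if "t \<ge> c" for t using that g by (auto simp: \<zeta>_def)
  have M: "\<zeta> t \<in> mspace X" if "t \<in> {a..c + r}" for t
    using that c quasi_geodesicD(1)[OF qg, of t] isometric_onD(1)[OF g(1), of "t - c"]
    by (auto simp: \<zeta>_def)
  have le: "x / (3 * q) \<le> x / q" "x / (3 * q) \<le> x" "x \<le> 3 * q * x" "q * x \<le> 3 * q * x"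
    if "0 \<le> x" for x
  proof -
    have "x * 1 \<le> x * (3 * q)" "x * 1 \<le> x * q" using q that mult_left_mono[of 1 "3 * q" x] mult_left_mono[of 1 q x] by simp_all
    then show "x / (3 * q) \<le> x / q" "x / (3 * q) \<le> x" "x \<le> 3 * q * x" "q * x \<le> 3 * q * x"
      using q that by (auto simp: field_simps)
  qed
  \<comment> \<open>One time lies on each side of the switch from \<open>\<eta>\<close> to
    \<open>g\<close>. Since \<open>\<eta> c\<close> is nearly closest to \<open>p\<close>, the point
    \<open>g \<tau>\<close> is at least \<open>\<tau> - 1\<close> away from \<open>\<eta> s\<close>.
    So \<open>D\<close> bounds \<open>\<tau>\<close>, and \<open>2 * D\<close> bounds the distance
    from \<open>\<eta> s\<close> to \<open>\<eta> c\<close>, both up to 1; together this makes the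
    factor 3.\<close>
  have mixed: "\<bar>s - t\<bar> / (3 * q) - (Q + 2) \<le> mdist X (\<zeta> s) (\<zeta> t) \<and>
      mdist X (\<zeta> s) (\<zeta> t) \<le> 3 * q * \<bar>s - t\<bar> + (Q + 2)"
    if st: "s \<in> {a..c}" "t \<in> {c..c + r}" for s t
  proof -
    define \<tau> where "\<tau> = t - c"
    have s: "s \<in> {a..b}" and \<tau>: "0 \<le> \<tau>" "\<tau> \<le> r" using st c by (auto simp: \<tau>_def)
    have z: "\<zeta> s = \<eta> s" "\<zeta> t = g \<tau>" using st gz[of t] by (auto simp: \<zeta>_def \<tau>_def)
    have Ms: "\<eta> s \<in> mspace X" "g \<tau> \<in> mspace X"
      using quasi_geodesicD(1)[OF qg s s] isometric_onD(1)[OF g(1)] \<tau> by auto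
    have gd: "mdist X (\<eta> c) (g \<tau>) = \<tau>" "mdist X p (g \<tau>) = r - \<tau>"
      using isometric_onD(2)[OF g(1), of 0 \<tau>] isometric_onD(2)[OF g(1), of r \<tau>] g \<tau> by auto
    define D where "D = mdist X (\<eta> s) (g \<tau>)"
    have "mdist X p (\<eta> s) \<le> mdist X p (g \<tau>) + mdist X (g \<tau>) (\<eta> s)"
      using p Ms by (rule_tac mdist_triangle) auto
    then have 1: "\<tau> \<le> D + 1" using near[OF s] gd by (simp add: r_def D_def mdist_commute)
    have "mdist X (\<eta> s) (\<eta> c) \<le> D + mdist X (g \<tau>) (\<eta> c)"
      unfolding D_def using Ms Mc by (rule_tac mdist_triangle) auto
    then have 2: "mdist X (\<eta> s) (\<eta> c) \<le> 2 * D + 1" using 1 gd by (simp add: mdist_commute)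
    have 3: "(c - s) / q \<le> 2 * D + 1 + Q" using 2 quasi_geodesicD(2)[OF qg s c] st by auto
    have "D \<le> mdist X (\<eta> s) (\<eta> c) + mdist X (\<eta> c) (g \<tau>)"
      unfolding D_def using Ms Mc by (rule_tac mdist_triangle) auto
    then have 4: "D \<le> q * (c - s) + Q + \<tau>" using quasi_geodesicD(3)[OF qg s c] gd st by auto
    have abs: "\<bar>s - t\<bar> = (c - s) + \<tau>" using st by (auto simp: \<tau>_def)
    have 5: "\<bar>s - t\<bar> / (3 * q) = ((c - s) / q) / 3 + (\<tau> / q) / 3" unfolding abs by (simp add: add_divide_distrib)
    have "\<tau> / q \<le> \<tau>" using q \<tau> divide_left_mono[of 1 q \<tau>] by simp
    moreover have "x / 3 + y / 3 - (Q + 2) \<le> D" if "x \<le> 2 * D + 1 + Q" "y \<le> D + 1" for x y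
      using that Q by (simp add: field_simps)
    ultimately have "\<bar>s - t\<bar> / (3 * q) - (Q + 2) \<le> D" using 1 3 order_trans unfolding 5 by blast
    moreover have "3 * q * \<bar>s - t\<bar> = 3 * q * (c - s) + 3 * q * \<tau>" unfolding abs by (simp add: algebra_simps)
    then have "D \<le> 3 * q * \<bar>s - t\<bar> + (Q + 2)" using 4 le(4)[of "c - s"] le(3)[of \<tau>] st \<tau> Q by auto
    ultimately show ?thesis unfolding z D_def by simp
  qed
  have "quasi_geodesic X (3 * q) (Q + 2) {a..c + r} \<zeta>"
    unfolding quasi_geodesic_def
  proof (intro conjI ballI subsetI)
    fix s t assume st: "s \<in> {a..c + r}" "t \<in> {a..c + r}"
    have "\<bar>s - t\<bar> / (3 * q) - (Q + 2) \<le> mdist X (\<zeta> s) (\<zeta> t) \<and>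
      mdist X (\<zeta> s) (\<zeta> t) \<le> 3 * q * \<bar>s - t\<bar> + (Q + 2)"
    proof (cases "s \<le> c"; cases "t \<le> c")
      assume *: "s \<le> c" "t \<le> c"
      then have "s \<in> {a..b}" "t \<in> {a..b}" using st c by auto
      then show ?thesis
        using quasi_geodesicD(2,3)[OF qg, of s t] le(1)[of "\<bar>s - t\<bar>"] le(4)[of "\<bar>s - t\<bar>"] *
        by (simp add: \<zeta>_def)
    next
      assume *: "\<not> s \<le> c" "\<not> t \<le> c"
      then have "mdist X (\<zeta> s) (\<zeta> t) = \<bar>s - t\<bar>"
        using isometric_onD(2)[OF g(1), of "s - c" "t - c"] st by (auto simp: \<zeta>_def)
      then show ?thesis using le(2)[of "\<bar>s - t\<bar>"] le(3)[of "\<bar>s - t\<bar>"] Q by simp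
    next
      assume "s \<le> c" "\<not> t \<le> c"
      then show ?thesis using mixed[of s t] st by simp
    next
      assume "\<not> s \<le> c" "t \<le> c"
      then show ?thesis
        using mixed[of t s] st by (simp add: mdist_commute abs_minus_commute)
    qed
    then show "\<bar>s - t\<bar> / (3 * q) - (Q + 2) \<le> mdist X (\<zeta> s) (\<zeta> t)"
      "mdist X (\<zeta> s) (\<zeta> t) \<le> 3 * q * \<bar>s - t\<bar> + (Q + 2)" by auto
  qed (use M in auto)
  moreover have "\<zeta> a = \<eta> a" using c by (auto simp: \<zeta>_def)
  moreover have "\<zeta> (c + r) = p" using gz[of "c + r"] r g by auto
  moreover have "\<eta> ` {a..c} = \<zeta> ` {a..c}" by (intro image_cong) (auto simp: \<zeta>_def)
  then have "\<eta> ` {a..c} \<subseteq> \<zeta> ` {a..c + r}" using r by auto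
  ultimately show thesis using that[of "c + r" \<zeta>] c r by auto
qed

text \<open>Cut at a point nearly nearest to \<open>p\<close> and continued straight to
  \<open>p\<close>, each half of the path is a quasi-geodesic with both ends in \<open>A\<close>,
  provided its own outer end is there. The halves have separate conclusions because in a triangle
  their outer ends lie on different sides.\<close>

lemma morse_set_nearest_point:
  assumes A: "morse_set X N A" and q: "1 \<le> q" and Q: "0 \<le> Q"
    and qg: "quasi_geodesic X q Q {a..b} \<eta>" and c: "c \<in> {a..b}" and p: "p \<in> A"
    and near: "\<And>t. t \<in> {a..b} \<Longrightarrow> mdist X p (\<eta> c) \<le> mdist X p (\<eta> t) + 1"
  shows "\<eta> a \<in> A \<Longrightarrow> coarse_in X (N (3 * q) (Q + 2)) (\<eta> ` {a..c}) (subsegment X A (\<eta> a) p)"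
    and "\<eta> b \<in> A \<Longrightarrow> coarse_in X (N (3 * q) (Q + 2)) (\<eta> ` {c..b}) (subsegment X A p (\<eta> b))"
proof -
  have main: "coarse_in X (N (3 * q) (Q + 2)) (\<xi> ` {i..k}) (subsegment X A (\<xi> i) p)"
    if \<xi>: "quasi_geodesic X q Q {i..j} \<xi>" "k \<in> {i..j}" "\<xi> i \<in> A"
      "\<And>t. t \<in> {i..j} \<Longrightarrow> mdist X p (\<xi> k) \<le> mdist X p (\<xi> t) + 1" for i j k \<xi>
  proof -
    have pM: "p \<in> mspace X" using p morse_set_mspace[OF A] by blast
    obtain \<zeta> b' where z: "i \<le> b'" "quasi_geodesic X (3 * q) (Q + 2) {i..b'} \<zeta>"
      "\<zeta> i = \<xi> i" "\<zeta> b' = p" "\<xi> ` {i..k} \<subseteq> \<zeta> ` {i..b'}"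
      by (rule quasi_geodesic_nearest_point[OF q \<xi>(1) Q pM \<xi>(2) \<xi>(4)])
    have "coarse_in X (N (3 * q) (Q + 2)) (\<zeta> ` {i..b'}) (subsegment X A (\<zeta> i) (\<zeta> b'))"
      using z \<xi> p q Q by (intro morse_setD[OF A]) auto
    then show ?thesis using coarse_in_mono[OF _ order_refl z(5) subset_refl] z by simp
  qed
  show "\<eta> a \<in> A \<Longrightarrow> coarse_in X (N (3 * q) (Q + 2)) (\<eta> ` {a..c}) (subsegment X A (\<eta> a) p)"
    using main[OF qg c] near by blast
  assume "\<eta> b \<in> A"
  then have "coarse_in X (N (3 * q) (Q + 2)) ((\<lambda>t. \<eta> (- t)) ` {- b..- c}) (subsegment X A (\<eta> (- (- b))) p)"
    using c near by (intro main[OF quasi_geodesic_uminus[OF qg]]) auto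
  moreover have "(\<lambda>t. \<eta> (- t)) ` {- b..- c} = \<eta> ` {c..b}"
    using image_image[of \<eta> uminus "{- b..- c}"] by simp
  ultimately show "coarse_in X (N (3 * q) (Q + 2)) (\<eta> ` {c..b}) (subsegment X A p (\<eta> b))"
    by (simp add: subsegment_sym)
qed

lemma nearest_point:
  assumes "I \<noteq> {}" obtains c where "c \<in> I" "\<And>t. t \<in> I \<Longrightarrow> mdist X p (\<eta> c) \<le> mdist X p (\<eta> t) + 1"
proof -
  let ?S = "(\<lambda>t. mdist X p (\<eta> t)) ` I"
  have bdd: "bdd_below ?S" by (auto intro!: bdd_belowI[of _ 0])
  obtain c where "c \<in> I" "mdist X p (\<eta> c) < Inf ?S + 1"
    using cInf_lessD[of ?S "Inf ?S + 1"] assms by auto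
  moreover have "Inf ?S \<le> mdist X p (\<eta> t)" if "t \<in> I" for t
    using that bdd by (intro cInf_lower) auto
  ultimately show thesis using that by force
qed

text \<open>Cut the third side at a point nearly nearest to the opposite vertex \<open>x\<close>.
  Each half followed by a geodesic to \<open>x\<close> is a (3,2)-quasi-geodesic with both ends on a
  Morse side: the nearest-point construction with \<open>q = 1\<close> and
  \<open>Q = 0\<close>.\<close>

lemma triangle_split:
  assumes A: "geodesic_segment X A x y" "morse_set X N A"
    and B: "geodesic_segment X B x z" "morse_set X N B"
    and C: "geodesic_segment X C y z"
  obtains p where "p \<in> C" "coarse_in X (N 3 2) (subsegment X C y p) A"
    "coarse_in X (N 3 2) (subsegment X C p z) B"
proof -
  obtain c where c: "isometric_on X {0..mdist X y z} c" "c 0 = y" "c (mdist X y z) = z"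
      "C = c ` {0..mdist X y z}"
    using geodesic_segment_param[OF C] by metis
  define l where "l = mdist X y z"
  have l: "0 \<le> l" by (simp add: l_def)
  note c = c[folded l_def]
  obtain \<tau> where \<tau>: "\<tau> \<in> {0..l}" "\<And>t. t \<in> {0..l} \<Longrightarrow> mdist X x (c \<tau>) \<le> mdist X x (c t) + 1"
    using nearest_point[of "{0..l}" x c] l by auto
  have 0: "0 \<in> {0..l}" "l \<in> {0..l}" using l by auto
  have sub: "subsegment X C y (c \<tau>) = c ` {0..\<tau>}" "subsegment X C (c \<tau>) z = c ` {\<tau>..l}"
    using subsegment_isometric_le[OF c(1) 0(1) \<tau>(1)] subsegment_isometric_le[OF c(1) \<tau>(1) 0(2)] \<tau>
    by (simp_all flip: c(2,3) add: c(4))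
  have qg: "quasi_geodesic X 1 0 {0..l} c" by (rule isometric_quasi_geodesic[OF c(1)]) simp
  have "coarse_in X (N (3 * 1) (0 + 2)) (c ` {0..\<tau>}) (subsegment X A (c 0) x)"
    using geodesic_segmentD[OF A(1)] c
    by (intro morse_set_nearest_point(1)[OF A(2) _ _ qg \<tau>(1) _ \<tau>(2)]) auto
  then have "coarse_in X (N 3 2) (subsegment X C y (c \<tau>)) A"
    unfolding sub using coarse_in_mono[OF _ order_refl subset_refl subsegment_subset] by auto
  moreover
  have "coarse_in X (N (3 * 1) (0 + 2)) (c ` {\<tau>..l}) (subsegment X B x (c l))"
    using geodesic_segmentD[OF B(1)] c
    by (intro morse_set_nearest_point(2)[OF B(2) _ _ qg \<tau>(1) _ \<tau>(2)]) auto
  then have "coarse_in X (N 3 2) (subsegment X C (c \<tau>) z) B"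
    unfolding sub using coarse_in_mono[OF _ order_refl subset_refl subsegment_subset] by auto
  moreover have "c \<tau> \<in> C" using \<tau> c by auto
  ultimately show thesis using that by blast
qed

lemma triangle_thin:
  assumes A: "geodesic_segment X A x y" "morse_set X N A"
    and B: "geodesic_segment X B x z" "morse_set X N B"
    and C: "geodesic_segment X C y z"
  shows "coarse_in X (N 3 2) C (A \<union> B)"
proof -
  obtain p where p: "p \<in> C" "coarse_in X (N 3 2) (subsegment X C y p) A"
    "coarse_in X (N 3 2) (subsegment X C p z) B"
    using triangle_split[OF assms] .
  show ?thesis unfolding coarse_in_def
  proof
    fix w assume "w \<in> C"
    then have "w \<in> subsegment X C y p \<or> w \<in> subsegment X C p z" using segment_split[OF C p(1)] by blast
    then show "\<exists>y\<in>A \<union> B. mdist X w y \<le> N 3 2" using coarse_inD[OF p(2)] coarse_inD[OF p(3)] by blast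
  qed
qed

text \<open>A quasi-geodesic with ends on \<open>D\<close> has ends within \<open>\<delta>\<close>
  of \<open>A\<close>, so it stays near a stretch of \<open>A\<close>, and that stretch is near
  \<open>D\<close> by \<open>subsegment_within_segment\<close>. The two summands of the new gauge
  are the prices of going to \<open>A\<close> and of coming back.\<close>

lemma morse_set_near:
  assumes A: "geodesic_segment X A x y" "morse_set X N A" and D: "geodesic_segment X D x' y'"
    and near: "coarse_in X \<delta> D A"
  shows "morse_set X (\<lambda>q Q. N q (Q + 2 * \<delta> + 2) + (3 * \<delta> + 1)) D"
proof -
  have M: "A \<subseteq> mspace X" "D \<subseteq> mspace X" using geodesic_segmentD(1)[OF A(1)] geodesic_segmentD(1)[OF D] by auto
  have "coarse_in X (N q (Q + 2 * \<delta> + 2) + (3 * \<delta> + 1)) (\<eta> ` {a..b}) (subsegment X D (\<eta> a) (\<eta> b))"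
    if h: "\<eta> a \<in> D" "\<eta> b \<in> D" "1 \<le> q" "0 \<le> Q" "a \<le> b" "quasi_geodesic X q Q {a..b} \<eta>" for q Q a b \<eta>
  proof -
    obtain u v where uv: "u \<in> A" "mdist X (\<eta> a) u \<le> \<delta>" "v \<in> A" "mdist X (\<eta> b) v \<le> \<delta>"
      using coarse_inD[OF near h(1)] coarse_inD[OF near h(2)] by blast
    have 1: "coarse_in X (N q (Q + 2 * \<delta> + 2)) (\<eta> ` {a..b}) (subsegment X A u v)"
      using h uv by (intro morse_set_perturb[OF A(2)]) auto
    have "coarse_in X \<delta> (subsegment X D (\<eta> a) (\<eta> b)) A"
      by (rule coarse_in_mono[OF near order_refl subsegment_subset subset_refl])
    then have 2: "coarse_in X (3 * \<delta> + 1) (subsegment X A u v) (subsegment X D (\<eta> a) (\<eta> b))"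
      using h uv by (intro subsegment_within_segment[OF segment_subsegment[OF D] A(1)]) auto
    show ?thesis
      using quasi_geodesicD(1)[OF h(6)] M subsegment_subset[of X] by (intro coarse_in_trans[OF 1 2]) blast+
  qed
  then show ?thesis unfolding morse_set_def using M by blast
qed

text \<open>Only a quasi-geodesic from one half to the other is at issue. Cut at a point nearly
  nearest to \<open>p\<close>, each part followed by a geodesic to \<open>p\<close> has both ends in
  the same half, with constants \<open>3 * q\<close> and \<open>Q + 2\<close>.\<close>

lemma morse_set_join:
  assumes C: "geodesic_segment X C y z" "p \<in> C"
    and L: "morse_set X N (subsegment X C y p)" and R: "morse_set X N (subsegment X C p z)"
  shows "morse_set X (\<lambda>q Q. max (N q Q) (N (3 * q) (Q + 2))) C"
proof -
  let ?N = "\<lambda>q Q. max (N q Q) (N (3 * q) (Q + 2))"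
  have yz: "y \<in> C" "z \<in> C" and CM: "C \<subseteq> mspace X" using geodesic_segmentD[OF C(1)] by auto
  have pp: "p \<in> subsegment X C y p" "p \<in> subsegment X C p z"
    using C yz CM by (auto simp: subsegment_def)
  have sub: "subsegment X (subsegment X C i j) u v \<subseteq> subsegment X C u v" for i j u v
    by (auto simp: subsegment_def)
  have rv: "quasi_geodesic X q Q {-b..-a} (\<lambda>t. \<eta> (- t))" "(\<lambda>t. \<eta> (- t)) ` {-b..-a} = \<eta> ` {a..b}"
    if "quasi_geodesic X q Q {a..b} \<eta>" for a b q Q \<eta>
    using quasi_geodesic_uminus[OF that] image_image[of \<eta> uminus "{-b..-a}"] by simp_all
  have mixed: "coarse_in X (?N q Q) (\<eta> ` {a..b}) (subsegment X C (\<eta> a) (\<eta> b))"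
    if h: "\<eta> a \<in> subsegment X C y p" "\<eta> b \<in> subsegment X C p z" "1 \<le> q" "0 \<le> Q" "a \<le> b"
      "quasi_geodesic X q Q {a..b} \<eta>" for q Q a b \<eta>
  proof -
    obtain c where c: "c \<in> {a..b}" "\<And>t. t \<in> {a..b} \<Longrightarrow> mdist X p (\<eta> c) \<le> mdist X p (\<eta> t) + 1"
      using nearest_point[of "{a..b}" p \<eta>] h by auto
    have 1: "coarse_in X (N (3 * q) (Q + 2)) (\<eta> ` {a..c}) (subsegment X (subsegment X C y p) (\<eta> a) p)"
      using morse_set_nearest_point(1)[OF L h(3,4,6) c(1) pp(1) c(2) h(1)] .
    have 2: "coarse_in X (N (3 * q) (Q + 2)) (\<eta> ` {c..b}) (subsegment X (subsegment X C p z) p (\<eta> b))"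
      using morse_set_nearest_point(2)[OF R h(3,4,6) c(1) pp(2) c(2) h(2)] .
    have 3: "subsegment X (subsegment X C y p) (\<eta> a) p \<subseteq> subsegment X C (\<eta> a) (\<eta> b)"
      "subsegment X (subsegment X C p z) p (\<eta> b) \<subseteq> subsegment X C (\<eta> a) (\<eta> b)"
      using subsegment_join[OF C h(1,2)] sub by blast+
    have "\<eta> ` {a..b} = \<eta> ` {a..c} \<union> \<eta> ` {c..b}"
      using c(1) by (simp add: ivl_disj_un_two_touch(4) flip: image_Un)
    then show ?thesis
      using coarse_in_mono[OF 1 max.cobounded2 subset_refl 3(1), of "N q Q"]
        coarse_in_mono[OF 2 max.cobounded2 subset_refl 3(2), of "N q Q"]
      unfolding coarse_in_def by blast
  qed
  have "coarse_in X (?N q Q) (\<eta> ` {a..b}) (subsegment X C (\<eta> a) (\<eta> b))"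
    if h: "\<eta> a \<in> C" "\<eta> b \<in> C" "1 \<le> q" "0 \<le> Q" "a \<le> b" "quasi_geodesic X q Q {a..b} \<eta>" for q Q a b \<eta>
  proof -
    consider "\<eta> a \<in> subsegment X C y p" "\<eta> b \<in> subsegment X C y p"
      | "\<eta> a \<in> subsegment X C p z" "\<eta> b \<in> subsegment X C p z"
      | "\<eta> a \<in> subsegment X C y p" "\<eta> b \<in> subsegment X C p z"
      | "\<eta> a \<in> subsegment X C p z" "\<eta> b \<in> subsegment X C y p"
      using segment_split[OF C] h by blast
    then show ?thesis
    proof cases
      case 1
      then show ?thesis
        using coarse_in_mono[OF morse_setD[OF L h(3-6)] max.cobounded1 subset_refl sub] by blast
    next
      case 2
      then show ?thesis
        using coarse_in_mono[OF morse_setD[OF R h(3-6)] max.cobounded1 subset_refl sub] by blast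
    next
      case 3 then show ?thesis using mixed h by blast
    next
      case 4
      then show ?thesis
        using mixed[of "\<lambda>t. \<eta> (- t)" "-b" "-a" q Q] rv[OF h(6)] h by (simp add: subsegment_sym)
    qed
  qed
  then show ?thesis unfolding morse_set_def using CM by blast
qed

text \<open>The two pieces from \<open>triangle_split\<close> are near Morse sides, hence Morse, and
  so is their union. The gauge \<open>N'\<close> is chosen before the triangle, so that one gauge
  serves infinitely many triangles at once.\<close>

lemma triangle_morse:
  "\<exists>N'. \<forall>A B C x y z. geodesic_segment X A x y \<and> morse_set X N A \<and> geodesic_segment X B x z \<and>
     morse_set X N B \<and> geodesic_segment X C y z \<longrightarrow> morse_set X N' C"
proof -
  define N1 where "N1 \<equiv> \<lambda>q Q. N q (Q + 2 * N 3 2 + 2) + (3 * N 3 2 + 1)"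
  have "morse_set X (\<lambda>q Q. max (N1 q Q) (N1 (3 * q) (Q + 2))) C"
    if A: "geodesic_segment X A x y" "morse_set X N A" and B: "geodesic_segment X B x z" "morse_set X N B"
      and C: "geodesic_segment X C y z" for A B C x y z
  proof -
    obtain p where p: "p \<in> C" "coarse_in X (N 3 2) (subsegment X C y p) A"
      "coarse_in X (N 3 2) (subsegment X C p z) B"
      using triangle_split[OF A B C] .
    have "morse_set X N1 (subsegment X C y p)" "morse_set X N1 (subsegment X C p z)"
      unfolding N1_def using geodesic_segmentD(2,3)[OF C]
      by (rule_tac morse_set_near[OF A segment_subsegment[OF C _ p(1)] p(2)],
          rule_tac [2] morse_set_near[OF B segment_subsegment[OF C p(1)] p(3)])
    then show ?thesis using morse_set_join[OF C p(1)] by blast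
  qed
  then show ?thesis by blast
qed

end

section \<open>Limits of geodesics in proper spaces\<close>

locale proper_space =
  fixes X :: "'p metric"
  assumes proper: "x \<in> mspace X \<Longrightarrow>
    \<exists>K. compactin (mtopology_of X) K \<and> {y \<in> mspace X. mdist X x y \<le> r} \<subseteq> K"
begin

(* Tychonoff instead of a diagonal argument: the maps lie in a product of compact sets, and a
   cluster point of the sequence is enough. *)
lemma lipschitz_cluster:
  fixes f :: "nat \<Rightarrow> real \<Rightarrow> 'p"
  assumes M: "\<And>n t. 0 \<le> t \<Longrightarrow> f n t \<in> mspace X"
    and lip: "\<And>n s t. 0 \<le> s \<Longrightarrow> 0 \<le> t \<Longrightarrow> mdist X (f n s) (f n t) \<le> \<bar>s - t\<bar>"
    and f0: "\<And>n. f n 0 = x"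
  obtains a where "\<forall>t\<ge>0. a t \<in> mspace X"
    "\<forall>J \<epsilon> n0. finite J \<and> J \<subseteq> {0..} \<and> 0 < \<epsilon> \<longrightarrow> (\<exists>n\<ge>n0. \<forall>j\<in>J. mdist X (f n j) (a j) < \<epsilon>)"
proof -
  interpret M: Metric_space "mspace X" "mdist X" by (rule Metric_space_mspace_mdist)
  have xM: "x \<in> mspace X" using M[of 0 0] f0 by simp
  have "\<forall>r. \<exists>K. compactin (mtopology_of X) K \<and> {y \<in> mspace X. mdist X x y \<le> r} \<subseteq> K"
    using proper[OF xM] by blast
  then obtain K where K: "\<And>r. compactin (mtopology_of X) (K r)"
    "\<And>r. {y \<in> mspace X. mdist X x y \<le> r} \<subseteq> K r" by metis
  define P where "P = product_topology (\<lambda>t::real. mtopology_of X) {0..}"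
  define B where "B = PiE {0..} K"
  have B: "compactin P B" unfolding P_def B_def compactin_PiE using K by blast
  define F where "F \<equiv> \<lambda>n. restrict (f n) {0..}"
  have F: "F n \<in> B" for n
  proof -
    have "f n t \<in> K t" if "0 \<le> t" for t using lip[of 0 t n] M[OF that, of n] K(2)[of t] f0 that by auto
    then show ?thesis by (auto simp: B_def F_def)
  qed
  \<comment> \<open>Compactness of \<open>B\<close>: otherwise finitely many open sets, each of them
    avoided by the sequence from some index on, would cover \<open>B\<close>.\<close>
  have "\<exists>a\<in>B. \<forall>U n0. openin P U \<and> a \<in> U \<longrightarrow> (\<exists>n\<ge>n0. F n \<in> U)"
  proof (rule ccontr)
    assume "\<not> ?thesis"
    then have "\<forall>a\<in>B. \<exists>U. openin P U \<and> a \<in> U \<and> (\<exists>n0. \<forall>n\<ge>n0. F n \<notin> U)" by auto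
    then obtain U where U': "\<forall>a\<in>B. openin P (U a) \<and> a \<in> U a \<and> (\<exists>n0. \<forall>n\<ge>n0. F n \<notin> U a)"
      by (auto dest: bchoice)
    then have "\<forall>a\<in>B. \<exists>n0. \<forall>n\<ge>n0. F n \<notin> U a" by blast
    then obtain n0 where "\<forall>a\<in>B. \<forall>n\<ge>n0 a. F n \<notin> U a" by (auto dest: bchoice)
    with U' have U: "\<And>a. a \<in> B \<Longrightarrow> openin P (U a) \<and> a \<in> U a \<and> (\<forall>n\<ge>n0 a. F n \<notin> U a)" by blast
    then have "\<exists>\<F>. finite \<F> \<and> \<F> \<subseteq> U ` B \<and> B \<subseteq> \<Union>\<F>"
      by (intro compactinD[OF B]) auto
    then obtain A where A: "finite A" "A \<subseteq> B" "B \<subseteq> \<Union>(U ` A)" by (metis finite_subset_image)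
    define n where "n = Max (insert 0 (n0 ` A))"
    obtain a where "a \<in> A" "F n \<in> U a" using F[of n] A by blast
    moreover have "n0 a \<le> n" using A \<open>a \<in> A\<close> by (auto simp: n_def intro!: Max_ge)
    ultimately show False using U A by blast
  qed
  then obtain a where a: "a \<in> B" "\<And>U n0. openin P U \<Longrightarrow> a \<in> U \<Longrightarrow> \<exists>n\<ge>n0. F n \<in> U" by blast
  have "K r \<subseteq> mspace X" for r using compactin_subset_topspace[OF K(1)] by simp
  then have aM: "a t \<in> mspace X" if "0 \<le> t" for t using a(1) that by (auto simp: B_def PiE_iff)
  have "\<exists>n\<ge>n0. \<forall>j\<in>J. mdist X (f n j) (a j) < \<epsilon>"
    if J: "finite J" "J \<subseteq> {0..}" and \<epsilon>: "0 < \<epsilon>" for J \<epsilon> and n0 :: nat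
  proof -
    define V where "V \<equiv> \<lambda>j. if j \<in> J then M.mball (a j) \<epsilon> else mspace X"
    have "openin (mtopology_of X) (V j)" for j
      using M.openin_mball openin_topspace[of "mtopology_of X"] by (auto simp: V_def mtopology_of_def)
    moreover have "{j. V j \<noteq> topspace (mtopology_of X)} \<subseteq> J" by (auto simp: V_def)
    then have "finite {j \<in> {0..}. V j \<noteq> topspace (mtopology_of X)}"
      by (rule_tac finite_subset[OF _ J(1)]) auto
    ultimately have "openin P (PiE {0..} V)" unfolding P_def openin_PiE_gen by blast
    moreover have "a \<in> PiE {0..} V"
      using a(1) aM \<epsilon> J by (auto simp: PiE_iff B_def V_def)
    ultimately obtain n where n: "n \<ge> n0" "F n \<in> PiE {0..} V" using a(2) by blast
    have "mdist X (f n j) (a j) < \<epsilon>" if "j \<in> J" for j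
    proof -
      have "F n j \<in> V j" using n(2) that J by (auto simp: PiE_iff)
      then show ?thesis using that J by (auto simp: F_def V_def mdist_commute)
    qed
    then show ?thesis using n by blast
  qed
  then show thesis using that[of a] aM by blast
qed

text \<open>A cluster point controls finitely many times at once, here the integers up to
  \<open>k\<close> within distance 1. Between integers each of the two paths moves by at most 1,
  which makes 3; a bounded error is harmless for classes of rays.\<close>

lemma ray_limit:
  assumes \<sigma>: "\<And>n. isometric_on X {0..T n} (\<sigma> n)" "\<And>n. \<sigma> n 0 = x" "\<And>n. 0 \<le> T n"
    and T: "\<And>k::real. \<exists>n0. \<forall>n\<ge>n0. k \<le> T n"
  obtains a and r :: "nat \<Rightarrow> nat" where "isometric_on X {0..} a" "a 0 = x" "strict_mono r"
    "\<forall>k. real k \<le> T (r k) \<and> (\<forall>t. 0 \<le> t \<and> t \<le> real k \<longrightarrow> mdist X (\<sigma> (r k) t) (a t) \<le> 3)"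
proof -
  \<comment> \<open>The segments rest at their far ends after time \<open>T n\<close>, which makes
    them maps on the whole half-line as \<open>lipschitz_cluster\<close> demands.\<close>
  define f where "f \<equiv> \<lambda>n t. \<sigma> n (min t (T n))"
  have fM: "f n t \<in> mspace X" if "0 \<le> t" for n t
    using isometric_onD(1)[OF \<sigma>(1)] \<sigma>(3) that by (auto simp: f_def)
  have lip: "mdist X (f n s) (f n t) \<le> \<bar>s - t\<bar>" if "0 \<le> s" "0 \<le> t" for n s t
    using isometric_onD(2)[OF \<sigma>(1), of "min s (T n)" n "min t (T n)"] \<sigma>(3)[of n] that by (auto simp: f_def)
  have f0: "f n 0 = x" for n using \<sigma>(2,3) by (simp add: f_def min_absorb1)
  obtain a where a': "\<forall>t\<ge>0. a t \<in> mspace X"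
    "\<forall>J \<epsilon> n0. finite J \<and> J \<subseteq> {0..} \<and> 0 < \<epsilon> \<longrightarrow> (\<exists>n\<ge>n0. \<forall>j\<in>J. mdist X (f n j) (a j) < \<epsilon>)"
    by (rule lipschitz_cluster[where f = f, OF fM lip f0])
  have aM: "a t \<in> mspace X" if "0 \<le> t" for t using a'(1) that by simp
  have a: "\<exists>n\<ge>n0. \<forall>j\<in>J. mdist X (f n j) (a j) < \<epsilon>" if "finite J" "J \<subseteq> {0..}" "0 < \<epsilon>" for J \<epsilon> n0
    using a'(2) that by simp
  have xM: "x \<in> mspace X" using fM[of 0 0] f0 by simp
  have dist: "mdist X (a s) (a t) = \<bar>s - t\<bar>" if st: "0 \<le> s" "0 \<le> t" for s t
  proof (rule ccontr)
    assume ne: "\<not> ?thesis"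
    define \<epsilon> where "\<epsilon> = \<bar>mdist X (a s) (a t) - \<bar>s - t\<bar>\<bar> / 3"
    have \<epsilon>: "0 < \<epsilon>" using ne by (simp add: \<epsilon>_def)
    obtain n0 where n0: "\<And>n. n \<ge> n0 \<Longrightarrow> max s t \<le> T n" using T by blast
    obtain n where n: "n \<ge> n0" "\<forall>j\<in>{s, t}. mdist X (f n j) (a j) < \<epsilon>"
      using a[of "{s, t}" \<epsilon> n0] st \<epsilon> by auto
    have "mdist X (f n s) (f n t) = \<bar>s - t\<bar>"
      using isometric_onD(2)[OF \<sigma>(1), of s n t] n0[OF n(1)] st by (simp add: f_def min_absorb1)
    moreover have "\<bar>mdist X (f n s) (f n t) - mdist X (a s) (a t)\<bar> \<le> \<epsilon> + \<epsilon>"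
      using n fM aM st by (intro mdist_quadrilateral) (auto intro: less_imp_le)
    ultimately show False using \<epsilon> unfolding \<epsilon>_def by argo
  qed
  have iso: "isometric_on X {0..} a" using aM dist by (auto simp: isometric_on_def)
  have "a 0 = x"
  proof (rule ccontr)
    assume "a 0 \<noteq> x"
    then have "0 < mdist X x (a 0)"
      using xM aM[of 0] mdist_nonneg[of X x "a 0"] by (auto simp: less_le)
    then obtain n where "mdist X (f n 0) (a 0) < mdist X x (a 0)"
      using a[of "{0}" "mdist X x (a 0)" 0] by auto
    then show False using f0 by simp
  qed
  have step: "\<exists>n>m. real k \<le> T n \<and> (\<forall>t. 0 \<le> t \<and> t \<le> real k \<longrightarrow> mdist X (\<sigma> n t) (a t) \<le> 3)" for k m :: nat
  proof -
    obtain n0 where n0: "\<And>n. n \<ge> n0 \<Longrightarrow> real k \<le> T n" using T by blast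
    obtain n where n: "n \<ge> max n0 (Suc m)" "\<forall>j\<in>real ` {..k}. mdist X (f n j) (a j) < 1"
      using a[of "real ` {..k}" 1 "max n0 (Suc m)"] by force
    have "mdist X (\<sigma> n t) (a t) \<le> 3" if t: "0 \<le> t" "t \<le> real k" for t
    proof -
      define j where "j = real (nat \<lfloor>t\<rfloor>)"
      have "nat \<lfloor>t\<rfloor> \<le> k" using t by linarith
      then have j: "0 \<le> j" "\<bar>t - j\<bar> \<le> 1" "j \<in> real ` {..k}"
        unfolding j_def by (simp, use t in linarith, simp)
      have "f n t = \<sigma> n t" using t n0[of n] n by (simp add: f_def min_absorb1)
      moreover have "\<bar>mdist X (f n t) (a t) - mdist X (f n j) (a j)\<bar> \<le> 1 + 1"
        using fM aM t j lip[of t j n] dist[of t j] by (intro mdist_quadrilateral) auto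
      moreover have "mdist X (f n j) (a j) < 1" using n(2) j(3) by blast
      ultimately show ?thesis by simp
    qed
    then show ?thesis using n n0[of n] by (intro exI[of _ n]) auto
  qed
  have "\<exists>r. \<forall>k. (real k \<le> T (r k) \<and> (\<forall>t. 0 \<le> t \<and> t \<le> real k \<longrightarrow> mdist X (\<sigma> (r k) t) (a t) \<le> 3))
      \<and> r k < r (Suc k)"
    by (rule dependent_nat_choice) (use step[where k = 0 and m = 0] step in blast)+
  then obtain r where r: "\<And>k. real k \<le> T (r k)" "\<And>k t. 0 \<le> t \<Longrightarrow> t \<le> real k \<Longrightarrow> mdist X (\<sigma> (r k) t) (a t) \<le> 3"
    "\<And>k. r k < r (Suc k)" by metis
  have "strict_mono r" using r(3) by (simp add: strict_mono_Suc_iff)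
  then show thesis using that[of a r] iso \<open>a 0 = x\<close> r by blast
qed

text \<open>Almost shortest paths cluster at a path of length \<open>L\<close> that does not
  increase distances. Its ends are at distance \<open>L\<close>, so the triangle inequality leaves
  no room for a shorter distance in between. This provides geodesics in a Cayley graph, where the
  distance is an infimum over chains.\<close>

lemma length_space_geodesic:
  assumes xy: "x \<in> mspace X" "y \<in> mspace X"
    and len: "\<And>\<epsilon>. 0 < \<epsilon> \<Longrightarrow> \<exists>p l. 0 \<le> l \<and> l < mdist X x y + \<epsilon> \<and> p 0 = x \<and> p l = y \<and> p ` {0..l} \<subseteq> mspace X \<and>
      (\<forall>s\<in>{0..l}. \<forall>t\<in>{0..l}. mdist X (p s) (p t) \<le> \<bar>s - t\<bar>)"
  shows "\<exists>A. geodesic_segment X A x y"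
proof -
  define L where "L = mdist X x y"
  have L: "0 \<le> L" by (simp add: L_def)
  have "\<forall>n. \<exists>p l. 0 \<le> l \<and> l < L + 1 / real (Suc n) \<and> p 0 = x \<and> p l = y \<and> p ` {0..l} \<subseteq> mspace X \<and>
      (\<forall>s\<in>{0..l}. \<forall>t\<in>{0..l}. mdist X (p s) (p t) \<le> \<bar>s - t\<bar>)"
    unfolding L_def by (intro allI len) simp
  then obtain p l where p: "\<And>n. 0 \<le> l n" "\<And>n. l n < L + 1 / real (Suc n)" "\<And>n. p n 0 = x" "\<And>n. p n (l n) = y"
    "\<And>n. p n ` {0..l n} \<subseteq> mspace X"
    "\<And>n s t. s \<in> {0..l n} \<Longrightarrow> t \<in> {0..l n} \<Longrightarrow> mdist X (p n s) (p n t) \<le> \<bar>s - t\<bar>"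
    by metis
  define f where "f \<equiv> \<lambda>n t. p n (min t (l n))"
  have fM: "f n t \<in> mspace X" if "0 \<le> t" for n t
    using p(5)[of n] p(1)[of n] that by (auto simp: f_def)
  have lip: "mdist X (f n s) (f n t) \<le> \<bar>s - t\<bar>" if "0 \<le> s" "0 \<le> t" for n s t
    using p(6)[of "min s (l n)" n "min t (l n)"] p(1)[of n] that by (auto simp: f_def)
  have f0: "f n 0 = x" for n using p(1,3) by (simp add: f_def min_absorb1)
  obtain a where a': "\<forall>t\<ge>0. a t \<in> mspace X"
    "\<forall>J \<epsilon> n0. finite J \<and> J \<subseteq> {0..} \<and> 0 < \<epsilon> \<longrightarrow> (\<exists>n\<ge>n0. \<forall>j\<in>J. mdist X (f n j) (a j) < \<epsilon>)"
    by (rule lipschitz_cluster[where f = f, OF fM lip f0])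
  have aM: "a t \<in> mspace X" if "0 \<le> t" for t using a'(1) that by simp
  have a: "\<exists>n\<ge>n0. \<forall>j\<in>J. mdist X (f n j) (a j) < \<epsilon>" if "finite J" "J \<subseteq> {0..}" "0 < \<epsilon>" for J \<epsilon> n0
    using a'(2) that by simp
  have eq: "u = v" if uv: "u \<in> mspace X" "v \<in> mspace X" "\<And>\<epsilon>. 0 < \<epsilon> \<Longrightarrow> mdist X u v \<le> \<epsilon>" for u v
  proof -
    have "mdist X u v \<le> 0" by (rule field_le_epsilon) (use uv(3) in simp)
    then have "mdist X u v = 0" using mdist_nonneg[of X u v] by linarith
    then show ?thesis using uv by simp
  qed
  have a0: "a 0 = x"
  proof (rule eq)
    fix \<epsilon> :: real assume "0 < \<epsilon>"
    then obtain n where "mdist X (f n 0) (a 0) < \<epsilon>" using a[of "{0}" \<epsilon> 0] by auto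
    then show "mdist X (a 0) x \<le> \<epsilon>" using f0 by (simp add: mdist_commute)
  qed (use aM xy in auto)
  \<comment> \<open>At time \<open>L\<close> the path \<open>f n\<close> has at most
    \<open>l n - L\<close> still to go, which is less than \<open>1 / real (Suc n)\<close>.\<close>
  have aL: "a L = y"
  proof (rule eq)
    fix \<epsilon> :: real assume \<epsilon>: "0 < \<epsilon>"
    obtain m :: nat where m: "1 / real (Suc m) < \<epsilon> / 2"
      using \<epsilon> nat_approx_posE[of "\<epsilon> / 2"] by auto
    obtain n where n: "n \<ge> m" "mdist X (f n L) (a L) < \<epsilon> / 2" using a[of "{L}" "\<epsilon> / 2" m] \<epsilon> L by auto
    have nm: "1 / real (Suc n) \<le> 1 / real (Suc m)" using n(1) by (intro divide_left_mono) auto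
    have "mdist X (f n L) (f n (l n)) \<le> \<bar>L - l n\<bar>" using p(1) L by (intro lip) auto
    moreover have "f n (l n) = y" using p(4) by (simp add: f_def)
    moreover have "L \<le> l n" using p(6)[of 0 n "l n"] p(1)[of n] p(3,4) by (simp add: L_def)
    ultimately have "mdist X (f n L) y < \<epsilon> / 2" using p(2)[of n] nm m by simp
    moreover have "mdist X (a L) y \<le> mdist X (a L) (f n L) + mdist X (f n L) y"
      using aM fM L xy by (intro mdist_triangle) auto
    ultimately show "mdist X (a L) y \<le> \<epsilon>" using n(2) by (simp add: mdist_commute)
  qed (use aM L xy in auto)
  have alip: "mdist X (a s) (a t) \<le> \<bar>s - t\<bar>" if st: "0 \<le> s" "0 \<le> t" for s t
  proof (rule field_le_epsilon)
    fix \<epsilon> :: real assume \<epsilon>: "0 < \<epsilon>"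
    obtain n where n: "\<forall>j\<in>{s, t}. mdist X (f n j) (a j) < \<epsilon> / 2"
      using a[of "{s, t}" "\<epsilon> / 2" 0] st \<epsilon> by auto
    then have "\<bar>mdist X (f n s) (f n t) - mdist X (a s) (a t)\<bar> \<le> \<epsilon> / 2 + \<epsilon> / 2"
      using fM aM st by (intro mdist_quadrilateral) (auto intro: less_imp_le)
    then show "mdist X (a s) (a t) \<le> \<bar>s - t\<bar> + \<epsilon>" using lip[OF st, of n] by argo
  qed
  have adist: "mdist X (a s) (a t) = \<bar>s - t\<bar>" if st: "s \<in> {0..L}" "t \<in> {0..L}" "s \<le> t" for s t
  proof -
    have "L \<le> mdist X x (a s) + mdist X (a s) y" unfolding L_def using xy aM st by (intro mdist_triangle) auto
    moreover have "mdist X (a s) y \<le> mdist X (a s) (a t) + mdist X (a t) y"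
      using xy aM st by (intro mdist_triangle) auto
    ultimately show ?thesis using alip[of 0 s] alip[of s t] alip[of t L] st unfolding a0 aL by auto
  qed
  have "isometric_on X {0..L} a"
    unfolding isometric_on_def
  proof (intro conjI ballI)
    fix s t assume "s \<in> {0..L}" "t \<in> {0..L}"
    then show "mdist X (a s) (a t) = \<bar>s - t\<bar>"
      using adist[of s t] adist[of t s] by (cases "s \<le> t") (auto simp: mdist_commute abs_minus_commute)
  qed (use aM in auto)
  then have "geodesic_segment X (a ` {0..L}) (a 0) (a L)" using L by (rule isometric_on_segment)
  then show ?thesis using a0 aL by auto
qed

end

section \<open>Finite Hausdorff distance and limits of Morse segments\<close>

definition coarsely_equal :: "'p metric \<Rightarrow> 'p set \<Rightarrow> 'p set \<Rightarrow> bool" where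
  "coarsely_equal X A B \<longleftrightarrow> (\<exists>r. coarse_in X r A B \<and> coarse_in X r B A)"

lemma coarsely_equalI: "coarse_in X r A B \<Longrightarrow> coarse_in X r' B A \<Longrightarrow> coarsely_equal X A B"
  unfolding coarsely_equal_def
  by (meson coarse_in_mono max.cobounded1 max.cobounded2 subset_refl)

lemma coarsely_equal_sym: "coarsely_equal X A B \<Longrightarrow> coarsely_equal X B A"
  by (auto simp: coarsely_equal_def)

lemma coarse_in_subset: "A \<subseteq> mspace X \<Longrightarrow> A \<subseteq> B \<Longrightarrow> 0 \<le> r \<Longrightarrow> coarse_in X r A B"
  by (force simp: coarse_in_def)

lemma coarsely_equal_refl: "A \<subseteq> mspace X \<Longrightarrow> coarsely_equal X A A"
  by (rule coarsely_equalI; rule coarse_in_subset[OF _ subset_refl order_refl])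

lemma coarsely_equal_trans:
  "coarsely_equal X A B \<Longrightarrow> coarsely_equal X B C \<Longrightarrow> A \<subseteq> mspace X \<Longrightarrow> B \<subseteq> mspace X \<Longrightarrow> C \<subseteq> mspace X
    \<Longrightarrow> coarsely_equal X A C"
  unfolding coarsely_equal_def[of X A B] coarsely_equal_def[of X B C]
  by (blast intro: coarsely_equalI coarse_in_trans)

lemma morse_set_subinterval:
  assumes p: "isometric_on X I p" "morse_set X N (p ` I)" "J \<subseteq> I"
    and J: "\<And>s t. s \<in> J \<Longrightarrow> t \<in> J \<Longrightarrow> {s..t} \<subseteq> J"
  shows "morse_set X N (p ` J)"
proof (rule morse_set_convex_subset[OF p(2)])
  fix u v assume "u \<in> p ` J" "v \<in> p ` J"
  then obtain s t where st: "s \<in> J" "t \<in> J" "u = p s" "v = p t" by blast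
  have "{min s t..max s t} \<subseteq> J" using J st by (auto simp: min_def max_def)
  then show "subsegment X (p ` I) u v \<subseteq> p ` J"
    using subsegment_isometric[OF p(1), of s t] st p(3) by auto
qed (use p in auto)

text \<open>Given a quasi-geodesic with ends on \<open>a\<close>, take an approximating segment that
  follows \<open>a\<close> past both ends, move the ends to it, apply its gauge and return to
  \<open>a\<close>. The move costs \<open>2 * K + 2\<close> in the argument of the gauge, the return
  costs \<open>K\<close>.\<close>

lemma morse_set_limit:
  assumes a: "isometric_on X {0..} a" and K: "0 \<le> K"
    and lim: "\<And>k::nat. \<exists>\<sigma> T. real k \<le> T \<and> isometric_on X {0..T} \<sigma> \<and> morse_set X N (\<sigma> ` {0..T}) \<and>
      (\<forall>t. 0 \<le> t \<and> t \<le> real k \<longrightarrow> mdist X (\<sigma> t) (a t) \<le> K)"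
  shows "morse_set X (\<lambda>q Q. N q (Q + 2 * K + 2) + K) (a ` {0..})"
proof -
  have aM: "a t \<in> mspace X" if "0 \<le> t" for t using isometric_onD(1)[OF a] that by auto
  have "coarse_in X (N q (Q + 2 * K + 2) + K) (\<eta> ` {i..j}) (subsegment X (a ` {0..}) (\<eta> i) (\<eta> j))"
    if h: "\<eta> i \<in> a ` {0..}" "\<eta> j \<in> a ` {0..}" "1 \<le> q" "0 \<le> Q" "i \<le> j"
      "quasi_geodesic X q Q {i..j} \<eta>" for q Q i j \<eta>
  proof -
    obtain s t where st: "0 \<le> s" "0 \<le> t" "\<eta> i = a s" "\<eta> j = a t" using h by auto
    define k where "k = nat \<lceil>max s t\<rceil>"
    have k: "s \<le> real k" "t \<le> real k" using st by (auto simp: k_def) linarith+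
    obtain \<sigma> T where \<sigma>: "real k \<le> T" "isometric_on X {0..T} \<sigma>" "morse_set X N (\<sigma> ` {0..T})"
      "\<And>t. 0 \<le> t \<Longrightarrow> t \<le> real k \<Longrightarrow> mdist X (\<sigma> t) (a t) \<le> K" using lim by blast
    have "coarse_in X (N q (Q + 2 * K + 2)) (\<eta> ` {i..j}) (subsegment X (\<sigma> ` {0..T}) (\<sigma> s) (\<sigma> t))"
      using h st k \<sigma> by (intro morse_set_perturb[OF \<sigma>(3)]) (auto simp: mdist_commute)
    moreover have "subsegment X (\<sigma> ` {0..T}) (\<sigma> s) (\<sigma> t) = \<sigma> ` {min s t..max s t}"
      using \<sigma> st k by (intro subsegment_isometric) auto
    moreover have "coarse_in X K (\<sigma> ` {min s t..max s t}) (a ` {min s t..max s t})"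
      using \<sigma>(4) st k unfolding coarse_in_def by (auto intro!: bexI)
    moreover have "subsegment X (a ` {0..}) (a s) (a t) = a ` {min s t..max s t}"
      using st by (intro subsegment_isometric[OF a]) auto
    moreover have "\<sigma> ` {min s t..max s t} \<subseteq> mspace X"
      using st k \<sigma>(1) by (auto intro!: isometric_onD(1)[OF \<sigma>(2)])
    moreover have "a ` {min s t..max s t} \<subseteq> mspace X" using aM st by auto
    ultimately show ?thesis
      using st quasi_geodesicD(1)[OF h(6)] by (auto intro!: coarse_in_trans)
  qed
  moreover have "a ` {0..} \<subseteq> mspace X" using aM by auto
  ultimately show ?thesis unfolding morse_set_def by blast
qed

section \<open>Change of base point\<close>

lemma geodesic_segment_within:
  assumes "geodesic_segment X A x y"
  shows "\<And>w. w \<in> A \<Longrightarrow> mdist X x w \<le> mdist X x y" "\<And>u v. u \<in> A \<Longrightarrow> v \<in> A \<Longrightarrow> mdist X u v \<le> mdist X x y"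
proof -
  obtain p where p: "isometric_on X {0..mdist X x y} p" "p 0 = x" "A = p ` {0..mdist X x y}"
    using geodesic_segment_param[OF assms] by metis
  have *: "mdist X u v \<le> mdist X x y" if "u \<in> A" "v \<in> A" for u v
    using that p isometric_onD(2)[OF p(1)] by auto
  then show "\<And>u v. u \<in> A \<Longrightarrow> v \<in> A \<Longrightarrow> mdist X u v \<le> mdist X x y" .
  show "mdist X x w \<le> mdist X x y" if "w \<in> A" for w
    using *[of x w] that geodesic_segmentD(2)[OF assms] by blast
qed

lemma geodesic_segment_point:
  assumes "geodesic_segment X A x y" "0 \<le> r" "r \<le> mdist X x y"
  obtains w where "w \<in> A" "mdist X x w = r" "mdist X w y = mdist X x y - r"
proof -
  obtain p where p: "isometric_on X {0..mdist X x y} p" "p 0 = x" "p (mdist X x y) = y" "A = p ` {0..mdist X x y}"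
    using geodesic_segment_param[OF assms(1)] by metis
  have "mdist X (p 0) (p r) = r" "mdist X (p r) (p (mdist X x y)) = mdist X x y - r"
    using isometric_onD(2)[OF p(1), of 0 r] isometric_onD(2)[OF p(1), of r "mdist X x y"] assms by auto
  then show thesis using that[of "p r"] p assms by auto
qed

lemma ray_segment:
  assumes "isometric_on X {0..} a" "0 \<le> s" "s \<le> t"
  shows "geodesic_segment X (a ` {s..t}) (a s) (a t)"
  using assms by (intro isometric_on_segment isometric_on_subset[OF assms(1)]) auto

lemma coarse_in_Un:
  "coarse_in X r A (B \<union> C) \<Longrightarrow> x \<in> A \<Longrightarrow> (\<exists>y\<in>B. mdist X x y \<le> r) \<or> (\<exists>y\<in>C. mdist X x y \<le> r)"
  by (auto simp: coarse_in_def)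

lemma ray_shift:
  assumes "isometric_on X {0..} a" "0 \<le> s"
  shows "isometric_on X {0..} (\<lambda>t. a (s + t))" "(\<lambda>t. a (s + t)) ` {0..} = a ` {s..}"
proof -
  show "isometric_on X {0..} (\<lambda>t. a (s + t))" using assms by (auto simp: isometric_on_def)
  have "(\<lambda>t. s + t) ` {0..} = {s..}" using image_add_atLeast[of s 0] by simp
  then show "(\<lambda>t. a (s + t)) ` {0..} = a ` {s..}" using image_image[of a "\<lambda>t. s + t" "{0..}"] by simp
qed

locale proper_geodesic_space = geodesic_space X + proper_space X for X :: "'p metric"
begin

text \<open>The new ray is a limit of geodesics from \<open>x\<close> to points far out on
  \<open>\<beta>\<close>, each the third side of a triangle with Morse sides. The last two
  conclusions express thinness of the ideal triangle with sides \<open>A\<close>, \<open>a\<close>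
  and \<open>\<beta>\<close>: there \<open>\<delta>\<close> depends on \<open>N\<close> alone,
  whereas the bound hidden in \<open>coarsely_equal\<close> may grow with the length of
  \<open>A\<close>.\<close>

lemma change_base:
  obtains N' \<delta> where
    "\<And>\<beta> A x. isometric_on X {0..} \<beta> \<Longrightarrow> morse_set X N (\<beta> ` {0..}) \<Longrightarrow> geodesic_segment X A (\<beta> 0) x \<Longrightarrow>
       morse_set X N A \<Longrightarrow> \<exists>a. isometric_on X {0..} a \<and> a 0 = x \<and> morse_set X N' (a ` {0..}) \<and>
         coarsely_equal X (a ` {0..}) (\<beta> ` {0..}) \<and>
         coarse_in X \<delta> (a ` {0..}) (A \<union> \<beta> ` {0..}) \<and> coarse_in X \<delta> A (a ` {0..} \<union> \<beta> ` {0..})"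
proof -
  obtain N1 where N1: "\<And>A B C x y z. geodesic_segment X A x y \<Longrightarrow> morse_set X N A \<Longrightarrow> geodesic_segment X B x z \<Longrightarrow>
     morse_set X N B \<Longrightarrow> geodesic_segment X C y z \<Longrightarrow> morse_set X N1 C"
    using triangle_morse[of N] by blast
  \<comment> \<open>A gauge for all three sides, so that each of them may be the third side in
    \<open>triangle_thin\<close>.\<close>
  define N2 where "N2 \<equiv> \<lambda>q Q. max (N q Q) (N1 q Q)"
  define \<delta> where "\<delta> = max 0 (N2 3 2)"
  show thesis
  proof (rule that[of "\<lambda>q Q. N1 q (Q + 2 * 3 + 2) + 3" "\<delta> + 3"])
    fix \<beta> A x
    assume \<beta>: "isometric_on X {0..} \<beta>" "morse_set X N (\<beta> ` {0..})"
      and A: "geodesic_segment X A (\<beta> 0) x" "morse_set X N A"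
    have \<beta>M: "\<beta> t \<in> mspace X" if "0 \<le> t" for t using isometric_onD(1)[OF \<beta>(1)] that by auto
    have AM: "A \<subseteq> mspace X" "x \<in> mspace X" "\<beta> 0 \<in> A" using geodesic_segmentD[OF A(1)] by auto
    define T where "T \<equiv> \<lambda>n::nat. mdist X x (\<beta> (real n))"
    have "\<exists>C. geodesic_segment X C x (\<beta> (real n))" for n :: nat using AM \<beta>M by (intro geodesic) auto
    then obtain C where C: "\<And>n::nat. geodesic_segment X (C n) x (\<beta> (real n))" by metis
    have "\<exists>p. isometric_on X {0..T n} p \<and> p 0 = x \<and> C n = p ` {0..T n}" for n
      unfolding T_def by (rule geodesic_segment_param[OF C]) auto
    then obtain \<sigma> where \<sigma>: "\<And>n. isometric_on X {0..T n} (\<sigma> n)" "\<And>n. \<sigma> n 0 = x" "\<And>n. C n = \<sigma> n ` {0..T n}"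
      by metis
    define B where "B \<equiv> \<lambda>n::nat. \<beta> ` {0..real n}"
    have B: "geodesic_segment X (B n) (\<beta> 0) (\<beta> (real n))" "morse_set X N (B n)" "B n \<subseteq> \<beta> ` {0..}" for n
      unfolding B_def by (intro ray_segment[OF \<beta>(1)] morse_set_subinterval[OF \<beta>] image_mono; auto)+
    have CM: "morse_set X N1 (C n)" for n using N1[OF A B(1,2) C] .
    have up: "morse_set X N2 (B n)" "morse_set X N2 A" "morse_set X N2 (C n)" for n
      using morse_set_mono[OF B(2)] morse_set_mono[OF A(2)] morse_set_mono[OF CM] by (auto simp: N2_def)
    have thin: "coarse_in X \<delta> (C n) (A \<union> B n)" "coarse_in X \<delta> A (B n \<union> C n)" "coarse_in X \<delta> (B n) (A \<union> C n)" for n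
    proof -
      note s = geodesic_segment_sym
      have "coarse_in X (N2 3 2) (C n) (A \<union> B n)" by (rule triangle_thin[OF A(1) up(2) B(1) up(1) C])
      then show "coarse_in X \<delta> (C n) (A \<union> B n)" by (rule coarse_in_mono) (auto simp: \<delta>_def)
      have "coarse_in X (N2 3 2) A (B n \<union> C n)" by (rule triangle_thin[OF s[OF B(1)] up(1) s[OF C] up(3) A(1)])
      then show "coarse_in X \<delta> A (B n \<union> C n)" by (rule coarse_in_mono) (auto simp: \<delta>_def)
      have "coarse_in X (N2 3 2) (B n) (A \<union> C n)" by (rule triangle_thin[OF s[OF A(1)] up(2) C up(3) B(1)])
      then show "coarse_in X \<delta> (B n) (A \<union> C n)" by (rule coarse_in_mono) (auto simp: \<delta>_def)
    qed
    define l where "l = mdist X (\<beta> 0) x"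
    have l: "mdist X x w \<le> l" "mdist X w (\<beta> 0) \<le> l" if "w \<in> A" for w
      using geodesic_segment_within(2)[OF A(1)] that geodesic_segmentD[OF A(1)] by (auto simp: l_def)
    have T: "real n - l \<le> T n" for n
    proof -
      have "mdist X (\<beta> 0) (\<beta> (real n)) \<le> l + T n" unfolding l_def T_def using AM \<beta>M by (intro mdist_triangle) auto
      then show ?thesis using isometric_onD(2)[OF \<beta>(1), of 0 "real n"] by simp
    qed
    have Tlim: "\<exists>n0. \<forall>n\<ge>n0. k \<le> T n" for k
    proof (intro exI allI impI)
      fix n assume "nat \<lceil>k + l\<rceil> \<le> n"
      then have "k + l \<le> real n" by linarith
      then show "k \<le> T n" using T[of n] by linarith
    qed
    have T0: "0 \<le> T n" for n by (simp add: T_def)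
    obtain a r where ar: "isometric_on X {0..} a" "a 0 = x" "strict_mono r"
      "\<forall>k. real k \<le> T (r k) \<and> (\<forall>t. 0 \<le> t \<and> t \<le> real k \<longrightarrow> mdist X (\<sigma> (r k) t) (a t) \<le> 3)"
      by (rule ray_limit[where \<sigma> = \<sigma>, OF \<sigma>(1,2) T0 Tlim])
    then have a: "isometric_on X {0..} a" "a 0 = x" "strict_mono r"
      "\<And>k. real k \<le> T (r k)" "\<And>k t. 0 \<le> t \<Longrightarrow> t \<le> real k \<Longrightarrow> mdist X (\<sigma> (r k) t) (a t) \<le> 3"
      by simp_all
    have aM: "a t \<in> mspace X" if "0 \<le> t" for t using isometric_onD(1)[OF a(1)] that by auto
    have a_morse: "morse_set X (\<lambda>q Q. N1 q (Q + 2 * 3 + 2) + 3) (a ` {0..})"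
    proof (rule morse_set_limit[OF a(1)])
      fix k :: nat
      show "\<exists>\<sigma> T. real k \<le> T \<and> isometric_on X {0..T} \<sigma> \<and> morse_set X N1 (\<sigma> ` {0..T}) \<and>
         (\<forall>t. 0 \<le> t \<and> t \<le> real k \<longrightarrow> mdist X (\<sigma> t) (a t) \<le> 3)"
        using a(4,5) \<sigma>(1) CM[of "r k"] \<sigma>(3)[of "r k"]
        by (intro exI[of _ "\<sigma> (r k)"] exI[of _ "T (r k)"]) auto
    qed simp
    \<comment> \<open>A point of \<open>C (r k)\<close> near \<open>v\<close> has parameter at most
      \<open>mdist X x v + \<delta>\<close>. Taking \<open>k\<close> above this number puts the
      point in the range where \<open>\<sigma> (r k)\<close> follows \<open>a\<close>.\<close>
    have near_C: "\<exists>w\<in>a ` {0..}. mdist X v w \<le> \<delta> + 3"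
      if v: "v \<in> mspace X" "mdist X x v + \<delta> \<le> real k" "u \<in> C (r k)" "mdist X v u \<le> \<delta>" for u v k
    proof -
      obtain \<tau> where \<tau>: "0 \<le> \<tau>" "\<tau> \<le> T (r k)" "u = \<sigma> (r k) \<tau>" using v(3) \<sigma>(3) by auto
      have uM: "u \<in> mspace X" using \<tau> isometric_onD(1)[OF \<sigma>(1)] by auto
      have "mdist X x u = \<tau>" using \<tau> isometric_onD(2)[OF \<sigma>(1), of 0 "r k" \<tau>] \<sigma>(2)[of "r k"] by simp
      then have "\<tau> \<le> real k" using mdist_triangle[of x X v u] v uM AM by auto
      then have "mdist X u (a \<tau>) \<le> 3" using a(5) \<tau> by simp
      then have "mdist X v (a \<tau>) \<le> \<delta> + 3" using mdist_triangle[of v X u "a \<tau>"] v uM aM \<tau> by auto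
      then show ?thesis using \<tau> by auto
    qed
    have near_a: "coarse_in X (\<delta> + 3) (a ` {0..}) (A \<union> \<beta> ` {0..})"
      unfolding coarse_in_def
    proof
      fix v assume "v \<in> a ` {0..}"
      then obtain t where t: "0 \<le> t" "v = a t" by auto
      define k where "k = nat \<lceil>t\<rceil>"
      have k: "t \<le> real k" by (simp add: k_def) linarith
      let ?u = "\<sigma> (r k) t"
      have u: "?u \<in> C (r k)" "?u \<in> mspace X"
        using \<sigma>(3)[of "r k"] t k a(4)[of k] isometric_onD(1)[OF \<sigma>(1), of t "r k"] by auto
      obtain w where w: "w \<in> A \<union> B (r k)" "mdist X ?u w \<le> \<delta>" using coarse_inD[OF thin(1) u(1)] by blast
      then have w': "w \<in> A \<union> \<beta> ` {0..}" "w \<in> mspace X" using B(3) AM \<beta>M by auto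
      then have "mdist X v w \<le> \<delta> + 3"
        using mdist_triangle[of v X ?u w] a(5)[OF t(1) k] w u t aM by (auto simp: mdist_commute)
      then show "\<exists>y\<in>A \<union> \<beta> ` {0..}. mdist X v y \<le> \<delta> + 3" using w' by blast
    qed
    have near_A: "coarse_in X (\<delta> + 3) A (a ` {0..} \<union> \<beta> ` {0..})"
      unfolding coarse_in_def
    proof
      fix v assume v: "v \<in> A"
      define k where "k = nat \<lceil>l + \<delta>\<rceil>"
      have k: "l + \<delta> \<le> real k" by (simp add: k_def) linarith
      consider u where "u \<in> B (r k)" "mdist X v u \<le> \<delta>" | u where "u \<in> C (r k)" "mdist X v u \<le> \<delta>"
        using coarse_in_Un[OF thin(2) v] by blast
      then show "\<exists>y\<in>a ` {0..} \<union> \<beta> ` {0..}. mdist X v y \<le> \<delta> + 3"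
      proof cases
        case 1 then show ?thesis using B(3)[of "r k"] by force
      next
        case 2 then show ?thesis using near_C[of v k u] v AM l(1)[OF v] k by auto
      qed
    qed
    have near_b: "coarse_in X (\<delta> + 3) (\<beta> ` {0..}) (A \<union> a ` {0..})"
      unfolding coarse_in_def
    proof
      fix v assume v: "v \<in> \<beta> ` {0..}"
      then obtain t where t: "0 \<le> t" "v = \<beta> t" by auto
      define k where "k = nat \<lceil>max t (mdist X x v + \<delta>)\<rceil>"
      have k: "t \<le> real k" "mdist X x v + \<delta> \<le> real k" by (simp_all add: k_def) linarith+
      have "k \<le> r k" using a(3) by (rule strict_mono_imp_increasing)
      then have "v \<in> B (r k)" using t k by (auto simp: B_def)
      then consider u where "u \<in> A" "mdist X v u \<le> \<delta>" | u where "u \<in> C (r k)" "mdist X v u \<le> \<delta>"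
        using coarse_in_Un[OF thin(3)] by blast
      then show "\<exists>y\<in>A \<union> a ` {0..}. mdist X v y \<le> \<delta> + 3"
      proof cases
        case 1 then show ?thesis by force
      next
        case 2 then show ?thesis using near_C[of v k u] t \<beta>M k by auto
      qed
    qed
    have Aa: "coarse_in X l A (a ` {0..})" "coarse_in X l A (\<beta> ` {0..})"
      unfolding coarse_in_def using l a(2) by (force simp: mdist_commute)+
    have self: "coarse_in X l (\<beta> ` {0..}) (\<beta> ` {0..})" "coarse_in X l (a ` {0..}) (a ` {0..})"
      using aM \<beta>M by (auto intro!: coarse_in_subset simp: l_def)
    have sets: "A \<union> \<beta> ` {0..} \<subseteq> mspace X" "A \<union> a ` {0..} \<subseteq> mspace X" using AM \<beta>M aM by auto
    have "coarse_in X l (A \<union> \<beta> ` {0..}) (\<beta> ` {0..})" "coarse_in X l (A \<union> a ` {0..}) (a ` {0..})"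
      using Aa self by (auto simp: coarse_in_def)
    then have "coarsely_equal X (a ` {0..}) (\<beta> ` {0..})"
      using coarse_in_trans[OF near_a] coarse_in_trans[OF near_b] sets by (blast intro: coarsely_equalI)
    then show "\<exists>a. isometric_on X {0..} a \<and> a 0 = x \<and> morse_set X (\<lambda>q Q. N1 q (Q + 2 * 3 + 2) + 3) (a ` {0..}) \<and>
         coarsely_equal X (a ` {0..}) (\<beta> ` {0..}) \<and>
         coarse_in X (\<delta> + 3) (a ` {0..}) (A \<union> \<beta> ` {0..}) \<and> coarse_in X (\<delta> + 3) A (a ` {0..} \<union> \<beta> ` {0..})"
      using a a_morse near_a near_A by blast
  qed
qed

text \<open>A triangle with one short side: its other given side is the stretch of
  \<open>\<gamma>\<close> up to \<open>t0\<close>, and the short side is Morse by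
  \<open>morse_set_bounded\<close>. Points near the short side are moved on to
  \<open>\<gamma> t0\<close>.\<close>

lemma segment_to_near_ray:
  obtains N' \<delta> where "0 \<le> \<delta>"
    "\<And>\<gamma> t0 p A. isometric_on X {0..} \<gamma> \<Longrightarrow> morse_set X N (\<gamma> ` {0..}) \<Longrightarrow> 0 \<le> t0 \<Longrightarrow>
       mdist X p (\<gamma> t0) \<le> \<kappa> \<Longrightarrow> geodesic_segment X A (\<gamma> 0) p \<Longrightarrow>
       morse_set X N' A \<and> coarse_in X \<delta> A (\<gamma> ` {0..t0})"
proof -
  define N2 where "N2 \<equiv> \<lambda>q Q. max (N q Q) (q * (q * (\<kappa> + Q)) + Q)"
  obtain N' where N': "\<And>A B C x y z. geodesic_segment X A x y \<Longrightarrow> morse_set X N2 A \<Longrightarrow> geodesic_segment X B x z \<Longrightarrow>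
     morse_set X N2 B \<Longrightarrow> geodesic_segment X C y z \<Longrightarrow> morse_set X N' C"
    using triangle_morse[of N2] by blast
  show thesis
  proof (rule that[of "max 0 (N2 3 2) + max 0 \<kappa>" N'])
    fix \<gamma> t0 p A
    assume \<gamma>: "isometric_on X {0..} \<gamma>" "morse_set X N (\<gamma> ` {0..})" and t0: "0 \<le> t0"
      and p: "mdist X p (\<gamma> t0) \<le> \<kappa>" and A: "geodesic_segment X A (\<gamma> 0) p"
    have B: "geodesic_segment X (\<gamma> ` {0..t0}) (\<gamma> 0) (\<gamma> t0)" using t0 by (intro ray_segment[OF \<gamma>(1)]) auto
    have "morse_set X N (\<gamma> ` {0..t0})" by (intro morse_set_subinterval[OF \<gamma>]) auto
    then have BN: "morse_set X N2 (\<gamma> ` {0..t0})" by (rule morse_set_mono) (simp add: N2_def)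
    have M: "\<gamma> t0 \<in> mspace X" "p \<in> mspace X" using geodesic_segmentD[OF A] geodesic_segmentD[OF B] by auto
    then obtain S where S: "geodesic_segment X S (\<gamma> t0) p" using geodesic by blast
    have Sd: "mdist X u v \<le> \<kappa>" if "u \<in> S" "v \<in> S" for u v
      using geodesic_segment_within(2)[OF S that] p by (simp add: mdist_commute)
    have "morse_set X (\<lambda>q Q. q * (q * (\<kappa> + Q)) + Q) S"
      using geodesic_segmentD(1)[OF S] Sd by (rule morse_set_bounded)
    then have SN: "morse_set X N2 S" by (rule morse_set_mono) (simp add: N2_def)
    have "morse_set X N' A" by (rule N'[OF geodesic_segment_sym[OF B] BN S SN A])
    moreover have thin: "coarse_in X (N2 3 2) A (\<gamma> ` {0..t0} \<union> S)"
      by (rule triangle_thin[OF geodesic_segment_sym[OF B] BN S SN A])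
    moreover have "coarse_in X (max 0 \<kappa>) (\<gamma> ` {0..t0} \<union> S) (\<gamma> ` {0..t0})"
      unfolding coarse_in_def
    proof
      fix w assume "w \<in> \<gamma> ` {0..t0} \<union> S"
      then show "\<exists>y\<in>\<gamma> ` {0..t0}. mdist X w y \<le> max 0 \<kappa>"
      proof
        assume "w \<in> \<gamma> ` {0..t0}"
        then show ?thesis using geodesic_segmentD(1)[OF B] by (intro bexI[of _ w]) auto
      next
        assume "w \<in> S"
        then have "mdist X w (\<gamma> t0) \<le> \<kappa>" using Sd geodesic_segmentD[OF S] by blast
        then show ?thesis using t0 by (intro bexI[of _ "\<gamma> t0"]) auto
      qed
    qed
    then have "coarse_in X (N2 3 2 + max 0 \<kappa>) A (\<gamma> ` {0..t0})"
      using coarse_in_trans[OF thin] geodesic_segmentD(1)[OF A] geodesic_segmentD(1)[OF B] geodesic_segmentD(1)[OF S]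
      by blast
    then have "coarse_in X (max 0 (N2 3 2) + max 0 \<kappa>) A (\<gamma> ` {0..t0})"
      by (rule coarse_in_mono) auto
    ultimately show "morse_set X N' A \<and> coarse_in X (max 0 (N2 3 2) + max 0 \<kappa>) A (\<gamma> ` {0..t0})" by blast
  qed simp
qed

end

section \<open>Divergence and fellow-travelling of rays from a common point\<close>

lemma ray_dist:
  assumes "isometric_on X {0..} a" "isometric_on X {0..} b" "a 0 = b 0" "0 \<le> s" "0 \<le> t"
  shows "\<bar>s - t\<bar> \<le> mdist X (a s) (b t)"
proof -
  have "\<bar>mdist X (a 0) (a s) - mdist X (b 0) (b t)\<bar> \<le> 0 + mdist X (a s) (b t)"
    using assms isometric_onD(1)[OF assms(1)] isometric_onD(1)[OF assms(2)]
    by (intro mdist_quadrilateral) auto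
  moreover have "mdist X (a 0) (a s) = s" "mdist X (b 0) (b t) = t"
    using isometric_onD(2)[OF assms(1), of 0 s] isometric_onD(2)[OF assms(2), of 0 t] assms by auto
  ultimately show ?thesis by linarith
qed

text \<open>Up to time \<open>s\<close>, \<open>a\<close> is a quasi-geodesic from
  \<open>b 0\<close> to a point within \<open>K\<close> of \<open>b\<close>;
  \<open>morse_set_perturb\<close> with \<open>q = 1\<close> and \<open>Q = 0\<close> gives the
  constant.\<close>

lemma ray_near_ray:
  assumes a: "isometric_on X {0..} a" and b: "isometric_on X {0..} b" "morse_set X N (b ` {0..})"
    and "a 0 = b 0" "0 \<le> s" "0 \<le> s'" "mdist X (a s) (b s') \<le> K" "0 \<le> t" "t \<le> s"
  shows "\<exists>t'\<ge>0. mdist X (a t) (b t') \<le> N 1 (2 * K + 2)"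
proof -
  have "quasi_geodesic X 1 0 {0..s} a"
    using isometric_on_subset[OF a] by (intro isometric_quasi_geodesic) auto
  moreover have "b 0 \<in> mspace X" using isometric_onD(1)[OF b(1)] by auto
  ultimately have "coarse_in X (N 1 (0 + 2 * K + 2)) (a ` {0..s}) (subsegment X (b ` {0..}) (b 0) (b s'))"
    using assms mdist_nonneg[of X "a s" "b s'"] order_trans[OF mdist_nonneg assms(7)]
    by (intro morse_set_perturb[OF b(2)]) auto
  then show ?thesis using assms unfolding coarse_in_def subsegment_def by force
qed

text \<open>Two rays that come within \<open>K\<close> of each other at arbitrarily late times are
  close all the way by \<open>ray_near_ray\<close>, and then their Hausdorff distance is
  finite.\<close>

lemma rays_diverge:
  assumes a: "isometric_on X {0..} a" "morse_set X N (a ` {0..})"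
    and b: "isometric_on X {0..} b" "morse_set X N (b ` {0..})"
    and ab: "a 0 = b 0" "\<not> coarsely_equal X (a ` {0..}) (b ` {0..})"
  shows "\<exists>T\<ge>0. \<forall>s\<ge>T. \<forall>s'\<ge>0. K < mdist X (a s) (b s')"
proof (rule ccontr)
  assume "\<not> ?thesis"
  then have *: "\<exists>s\<ge>T. \<exists>s'\<ge>0. mdist X (a s) (b s') \<le> K" if "T \<ge> 0" for T using that by (meson not_le)
  have "coarse_in X (N 1 (2 * K + 2)) (a ` {0..}) (b ` {0..})"
    unfolding coarse_in_def
  proof
    fix x assume "x \<in> a ` {0..}"
    then obtain t where t: "0 \<le> t" "x = a t" by auto
    obtain s s' where s: "s \<ge> t" "s' \<ge> 0" "mdist X (a s) (b s') \<le> K" using * t by blast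
    have "\<exists>t'\<ge>0. mdist X (a t) (b t') \<le> N 1 (2 * K + 2)"
      by (rule ray_near_ray[OF a(1) b ab(1) _ s(2,3) t(1) s(1)]) (use s t in simp)
    then show "\<exists>y\<in>b ` {0..}. mdist X x y \<le> N 1 (2 * K + 2)" using t by auto
  qed
  moreover have "coarse_in X (N 1 (2 * K + 2)) (b ` {0..}) (a ` {0..})"
    unfolding coarse_in_def
  proof
    fix x assume "x \<in> b ` {0..}"
    then obtain t where t: "0 \<le> t" "x = b t" by auto
    \<comment> \<open>The margin \<open>max 0 K\<close> makes up for the possible difference of
      \<open>s\<close> and \<open>s'\<close>, so that \<open>s'\<close> too is at least
      \<open>t\<close>.\<close>
    obtain s s' where s: "s \<ge> t + max 0 K" "s' \<ge> 0" "mdist X (a s) (b s') \<le> K" using *[of "t + max 0 K"] t by auto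
    have "0 \<le> s" using s(1) t(1) by linarith
    then have "\<bar>s - s'\<bar> \<le> K" using ray_dist[OF a(1) b(1) ab(1), of s s'] s by auto
    then have "t \<le> s'" using s by auto
    have "\<exists>t'\<ge>0. mdist X (b t) (a t') \<le> N 1 (2 * K + 2)"
      by (rule ray_near_ray[OF b(1) a ab(1)[symmetric] s(2) _ _ t(1) \<open>t \<le> s'\<close>])
        (use s t in \<open>auto simp: mdist_commute\<close>)
    then show "\<exists>y\<in>a ` {0..}. mdist X x y \<le> N 1 (2 * K + 2)" using t by auto
  qed
  ultimately show False using ab(2) coarsely_equalI by blast
qed

text \<open>By \<open>ray_dist\<close> the times of nearby points differ by no more than their
  distance, whence the factor 2 when equal times are compared. The range extends up to
  \<open>s'\<close>, which may exceed \<open>s\<close> by \<open>K\<close>; the second entry of the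
  maximum covers that gap.\<close>

lemma rays_fellow_travel:
  assumes a: "isometric_on X {0..} a" and b: "isometric_on X {0..} b" "morse_set X N (b ` {0..})"
    and ab: "a 0 = b 0" "0 \<le> s" "0 \<le> s'" "mdist X (a s) (b s') \<le> K" and t: "0 \<le> t" "t \<le> s'"
  shows "mdist X (a t) (b t) \<le> max (2 * N 1 (2 * K + 2)) (2 * K)"
proof (cases "t \<le> s")
  case True
  then obtain t' where t': "0 \<le> t'" "mdist X (a t) (b t') \<le> N 1 (2 * K + 2)"
    using ray_near_ray[OF a b ab t(1)] by blast
  have "\<bar>t - t'\<bar> \<le> N 1 (2 * K + 2)" using ray_dist[OF a b(1) ab(1) t(1) t'(1)] t' by simp
  moreover have "mdist X (a t) (b t) \<le> mdist X (a t) (b t') + mdist X (b t') (b t)"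
    using isometric_onD(1)[OF a] isometric_onD(1)[OF b(1)] t t' by (intro mdist_triangle) auto
  moreover have "mdist X (b t') (b t) = \<bar>t' - t\<bar>" using isometric_onD(2)[OF b(1), of t' t] t t' by auto
  ultimately show ?thesis using t' by (simp add: abs_minus_commute)
next
  case False
  have M: "a t \<in> mspace X" "a s \<in> mspace X" "b s' \<in> mspace X" "b t \<in> mspace X"
    using isometric_onD(1)[OF a] isometric_onD(1)[OF b(1)] t ab by auto
  have "mdist X (a t) (b t) \<le> mdist X (a t) (a s) + mdist X (a s) (b t)"
    "mdist X (a s) (b t) \<le> mdist X (a s) (b s') + mdist X (b s') (b t)"
    using M by (auto intro!: mdist_triangle)
  moreover have "mdist X (a t) (a s) = t - s" "mdist X (b s') (b t) = s' - t"
    using isometric_onD(2)[OF a, of t s] isometric_onD(2)[OF b(1), of s' t] t ab False by auto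
  moreover have "\<bar>s - s'\<bar> \<le> K" using ray_dist[OF a b(1) ab(1-3)] ab by simp
  ultimately show ?thesis using ab by linarith
qed

section \<open>Ideal triangles and diverging rays\<close>

context proper_geodesic_space
begin

text \<open>From a point \<open>x\<close> far out on \<open>\<alpha>\<close>, the ray
  \<open>a\<close> follows \<open>\<alpha>\<close> onwards and \<open>b\<close> follows it
  backwards. For the latter: the triangle with sides \<open>A\<close>, \<open>b\<close> and
  \<open>\<beta>\<close> is thin, so a point \<open>w\<close> on the segment \<open>A\<close> back
  to \<open>\<alpha> 0\<close> is near \<open>b\<close> or near \<open>\<beta>\<close>, and
  divergence excludes \<open>\<beta>\<close> as long as \<open>w\<close> is near
  \<open>\<alpha>\<close> beyond time \<open>T\<close>. The constants are fixed before
  \<open>t0\<close> and \<open>x\<close>.\<close>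

lemma two_rays:
  assumes \<alpha>: "isometric_on X {0..} \<alpha>" "morse_set X N (\<alpha> ` {0..})"
    and \<beta>: "isometric_on X {0..} \<beta>" "morse_set X N (\<beta> ` {0..})"
    and ab: "\<alpha> 0 = \<beta> 0" "\<not> coarsely_equal X (\<alpha> ` {0..}) (\<beta> ` {0..})"
  obtains N' D T0 where
    "\<And>t0 x. 0 \<le> t0 \<Longrightarrow> x \<in> mspace X \<Longrightarrow> mdist X x (\<alpha> t0) \<le> \<kappa> \<Longrightarrow>
       \<exists>a b. isometric_on X {0..} a \<and> a 0 = x \<and> morse_set X N' (a ` {0..}) \<and> coarsely_equal X (a ` {0..}) (\<alpha> ` {0..}) \<and>
         isometric_on X {0..} b \<and> b 0 = x \<and> morse_set X N' (b ` {0..}) \<and> coarsely_equal X (b ` {0..}) (\<beta> ` {0..}) \<and>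
         (\<forall>\<tau>. 0 \<le> \<tau> \<and> \<tau> + T0 \<le> t0 \<longrightarrow> 2 * \<tau> - D \<le> mdist X (a \<tau>) (b \<tau>))"
proof -
  obtain N1 \<delta>1 where \<delta>1: "0 \<le> \<delta>1" and N1: "\<And>\<gamma> t0 p A. isometric_on X {0..} \<gamma> \<Longrightarrow> morse_set X N (\<gamma> ` {0..}) \<Longrightarrow> 0 \<le> t0 \<Longrightarrow>
       mdist X p (\<gamma> t0) \<le> \<kappa> \<Longrightarrow> geodesic_segment X A (\<gamma> 0) p \<Longrightarrow>
       morse_set X N1 A \<and> coarse_in X \<delta>1 A (\<gamma> ` {0..t0})"
    by (rule segment_to_near_ray[of N \<kappa>]) blast
  define N2 where "N2 \<equiv> \<lambda>q Q. max (N q Q) (max (N1 q Q) (q * (q * (\<kappa> + Q)) + Q))"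
  obtain N' \<delta> where cb: "\<And>\<beta> A x. isometric_on X {0..} \<beta> \<Longrightarrow> morse_set X N2 (\<beta> ` {0..}) \<Longrightarrow> geodesic_segment X A (\<beta> 0) x \<Longrightarrow>
       morse_set X N2 A \<Longrightarrow> \<exists>a. isometric_on X {0..} a \<and> a 0 = x \<and> morse_set X N' (a ` {0..}) \<and>
         coarsely_equal X (a ` {0..}) (\<beta> ` {0..}) \<and>
         coarse_in X \<delta> (a ` {0..}) (A \<union> \<beta> ` {0..}) \<and> coarse_in X \<delta> A (a ` {0..} \<union> \<beta> ` {0..})"
    by (rule change_base[of N2]) blast
  \<comment> \<open>How close \<open>\<alpha> (t0 - \<tau>)\<close> would be to
    \<open>\<beta>\<close> if \<open>w\<close> were within \<open>\<delta>\<close> of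
    \<open>\<beta>\<close>: \<open>2 * \<delta>1 + \<kappa>\<close> leads to \<open>w\<close>, and
    \<open>\<delta>\<close> from there to \<open>\<beta>\<close>.\<close>
  define K1 where "K1 = 2 * \<delta>1 + \<kappa> + \<delta>"
  obtain T where T: "0 \<le> T" "\<And>s s'. T \<le> s \<Longrightarrow> 0 \<le> s' \<Longrightarrow> K1 < mdist X (\<alpha> s) (\<beta> s')"
    using rays_diverge[OF \<alpha> \<beta> ab, of K1] by blast
  show thesis
  \<comment> \<open>\<open>T\<close> keeps \<open>t0 - \<tau>\<close> in the range of divergence,
    and \<open>\<kappa>\<close> makes \<open>A\<close> long enough to have a point at distance
    \<open>\<tau>\<close> from \<open>x\<close>. The last constant adds
    \<open>2 * \<delta> + 3 * \<kappa>\<close> for \<open>a\<close>,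
    \<open>2 * \<delta>1 + \<kappa>\<close> for \<open>w\<close> and \<open>2 * \<delta>\<close> for
    \<open>b\<close>.\<close>
  proof (rule that[of N' "max T \<kappa>" "4 * \<delta> + 4 * \<kappa> + 2 * \<delta>1"])
    fix t0 x assume t0: "0 \<le> t0" and x: "x \<in> mspace X" "mdist X x (\<alpha> t0) \<le> \<kappa>"
    have \<alpha>M: "\<alpha> t \<in> mspace X" if "0 \<le> t" for t using isometric_onD(1)[OF \<alpha>(1)] that by auto
    have \<beta>M: "\<beta> t \<in> mspace X" if "0 \<le> t" for t using isometric_onD(1)[OF \<beta>(1)] that by auto
    have \<kappa>: "0 \<le> \<kappa>" using order_trans[OF mdist_nonneg x(2)] .
    obtain A where A: "geodesic_segment X A (\<alpha> 0) x" using geodesic \<alpha>M x by blast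
    have AN: "morse_set X N1 A" "coarse_in X \<delta>1 A (\<alpha> ` {0..t0})" using N1[OF \<alpha> t0 x(2) A] by auto
    obtain S where S: "geodesic_segment X S (\<alpha> t0) x" using geodesic \<alpha>M x t0 by blast
    have Sd: "mdist X u v \<le> \<kappa>" if "u \<in> S" "v \<in> S" for u v
      using geodesic_segment_within(2)[OF S that] x by (simp add: mdist_commute)
    have "morse_set X (\<lambda>q Q. q * (q * (\<kappa> + Q)) + Q) S"
      using geodesic_segmentD(1)[OF S] Sd by (rule morse_set_bounded)
    then have SN: "morse_set X N2 S" by (rule morse_set_mono) (simp add: N2_def)
    \<comment> \<open>Only the tail from \<open>t0\<close> on is used: the finite side of the
      triangle for \<open>a\<close> is then the short segment \<open>S\<close>, so \<open>a\<close>
      can follow nothing but the tail.\<close>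
    define \<alpha>' where "\<alpha>' \<equiv> \<lambda>t. \<alpha> (t0 + t)"
    have \<alpha>': "isometric_on X {0..} \<alpha>'" "\<alpha>' ` {0..} = \<alpha> ` {t0..}" "\<alpha>' 0 = \<alpha> t0"
      unfolding \<alpha>'_def using ray_shift[OF \<alpha>(1) t0] by simp_all
    have "morse_set X N (\<alpha> ` {t0..})" using t0 by (intro morse_set_subinterval[OF \<alpha>]) auto
    then have \<alpha>'N: "morse_set X N2 (\<alpha>' ` {0..})" unfolding \<alpha>'(2) by (rule morse_set_mono) (simp add: N2_def)
    have AN2: "morse_set X N2 A" using AN(1) by (rule morse_set_mono) (simp add: N2_def)
    have \<beta>N2: "morse_set X N2 (\<beta> ` {0..})" using \<beta>(2) by (rule morse_set_mono) (simp add: N2_def)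
    obtain a where a: "isometric_on X {0..} a" "a 0 = x" "morse_set X N' (a ` {0..})"
      "coarsely_equal X (a ` {0..}) (\<alpha>' ` {0..})" "coarse_in X \<delta> (a ` {0..}) (S \<union> \<alpha>' ` {0..})"
      using cb[OF \<alpha>'(1) \<alpha>'N _ SN] S \<alpha>'(3) by metis
    obtain b where b: "isometric_on X {0..} b" "b 0 = x" "morse_set X N' (b ` {0..})"
      "coarsely_equal X (b ` {0..}) (\<beta> ` {0..})" "coarse_in X \<delta> A (b ` {0..} \<union> \<beta> ` {0..})"
      using cb[OF \<beta>(1) \<beta>N2 _ AN2] A ab(1) by metis
    have aM: "a t \<in> mspace X" if "0 \<le> t" for t using isometric_onD(1)[OF a(1)] that by auto
    have bM: "b t \<in> mspace X" if "0 \<le> t" for t using isometric_onD(1)[OF b(1)] that by auto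
    have "coarse_in X t0 (\<alpha> ` {0..}) (\<alpha> ` {t0..})"
      unfolding coarse_in_def
    proof
      fix y assume "y \<in> \<alpha> ` {0..}"
      then obtain s where s: "0 \<le> s" "y = \<alpha> s" by auto
      have "mdist X (\<alpha> s) (\<alpha> (max s t0)) \<le> t0" using isometric_onD(2)[OF \<alpha>(1), of s "max s t0"] s t0 by auto
      then show "\<exists>z\<in>\<alpha> ` {t0..}. mdist X y z \<le> t0" using s by auto
    qed
    moreover have "coarse_in X 0 (\<alpha> ` {t0..}) (\<alpha> ` {0..})"
      using \<alpha>M t0 by (intro coarse_in_subset) auto
    ultimately have "coarsely_equal X (\<alpha> ` {t0..}) (\<alpha> ` {0..})" by (blast intro: coarsely_equalI)
    then have a\<alpha>: "coarsely_equal X (a ` {0..}) (\<alpha> ` {0..})"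
      using coarsely_equal_trans[OF a(4)] aM \<alpha>M t0 unfolding \<alpha>'(2) by (auto simp: image_subset_iff)
    have near_a: "mdist X (a \<tau>) (\<alpha> (t0 + \<tau>)) \<le> 2 * \<delta> + 3 * \<kappa>" if \<tau>: "0 \<le> \<tau>" for \<tau>
    proof -
      have "\<exists>s\<ge>0. mdist X (a \<tau>) (\<alpha> (t0 + s)) \<le> \<delta> + \<kappa>"
      proof -
        have "a \<tau> \<in> a ` {0..}" using \<tau> by auto
        then consider y where "y \<in> S" "mdist X (a \<tau>) y \<le> \<delta>" | y where "y \<in> \<alpha>' ` {0..}" "mdist X (a \<tau>) y \<le> \<delta>"
          using coarse_in_Un[OF a(5)] by blast
        then show ?thesis
        proof cases
          case 1
          have "mdist X (a \<tau>) (\<alpha> t0) \<le> mdist X (a \<tau>) y + mdist X y (\<alpha> t0)"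
            using 1 aM \<tau> \<alpha>M t0 geodesic_segmentD(1)[OF S] by (intro mdist_triangle) auto
          then have "mdist X (a \<tau>) (\<alpha> (t0 + 0)) \<le> \<delta> + \<kappa>" using 1 Sd[of y "\<alpha> t0"] geodesic_segmentD[OF S] by simp
          then show ?thesis by blast
        next
          case 2
          then show ?thesis using \<kappa> by (force simp: \<alpha>'_def)
        qed
      qed
      then obtain s where s: "0 \<le> s" "mdist X (a \<tau>) (\<alpha> (t0 + s)) \<le> \<delta> + \<kappa>" by blast
      have "\<bar>mdist X x (a \<tau>) - mdist X (\<alpha> t0) (\<alpha> (t0 + s))\<bar> \<le> \<kappa> + (\<delta> + \<kappa>)"
        using x s aM \<alpha>M \<tau> t0 by (intro mdist_quadrilateral) auto
      moreover have "mdist X x (a \<tau>) = \<tau>" using isometric_onD(2)[OF a(1), of 0 \<tau>] a(2) \<tau> by simp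
      moreover have "mdist X (\<alpha> t0) (\<alpha> (t0 + s)) = s" "mdist X (\<alpha> (t0 + s)) (\<alpha> (t0 + \<tau>)) = \<bar>s - \<tau>\<bar>"
        using isometric_onD(2)[OF \<alpha>(1)] s t0 \<tau> by auto
      moreover have "mdist X (a \<tau>) (\<alpha> (t0 + \<tau>)) \<le> mdist X (a \<tau>) (\<alpha> (t0 + s)) + mdist X (\<alpha> (t0 + s)) (\<alpha> (t0 + \<tau>))"
        using aM \<alpha>M \<tau> s t0 by (intro mdist_triangle) auto
      ultimately show ?thesis using s by linarith
    qed
    have "2 * \<tau> - (4 * \<delta> + 4 * \<kappa> + 2 * \<delta>1) \<le> mdist X (a \<tau>) (b \<tau>)" if \<tau>: "0 \<le> \<tau>" "\<tau> + max T \<kappa> \<le> t0" for \<tau>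
    proof -
      have "mdist X (\<alpha> 0) (\<alpha> t0) \<le> mdist X (\<alpha> 0) x + mdist X x (\<alpha> t0)" using \<alpha>M x t0 by (intro mdist_triangle) auto
      then have "\<tau> \<le> mdist X x (\<alpha> 0)"
        using isometric_onD(2)[OF \<alpha>(1), of 0 t0] t0 \<tau> x by (simp add: mdist_commute)
      then obtain w where w: "w \<in> A" "mdist X x w = \<tau>"
        using geodesic_segment_point[OF geodesic_segment_sym[OF A] \<tau>(1)] by blast
      have wM: "w \<in> mspace X" using w geodesic_segmentD[OF A] by blast
      obtain s where s: "s \<in> {0..t0}" "mdist X w (\<alpha> s) \<le> \<delta>1" using coarse_inD[OF AN(2) w(1)] by auto
      have "\<bar>mdist X x w - mdist X (\<alpha> t0) (\<alpha> s)\<bar> \<le> \<kappa> + \<delta>1"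
        using x wM \<alpha>M s t0 by (intro mdist_quadrilateral) auto
      moreover have "mdist X (\<alpha> t0) (\<alpha> s) = t0 - s" "mdist X (\<alpha> s) (\<alpha> (t0 - \<tau>)) = \<bar>s - (t0 - \<tau>)\<bar>"
        using isometric_onD(2)[OF \<alpha>(1)] s t0 \<tau> T(1) by auto
      moreover have "mdist X w (\<alpha> (t0 - \<tau>)) \<le> mdist X w (\<alpha> s) + mdist X (\<alpha> s) (\<alpha> (t0 - \<tau>))"
        using wM \<alpha>M s t0 \<tau> T(1) by (intro mdist_triangle) auto
      ultimately have w\<alpha>: "mdist X w (\<alpha> (t0 - \<tau>)) \<le> 2 * \<delta>1 + \<kappa>" using s w by linarith
      have "\<not> (\<exists>y\<in>\<beta> ` {0..}. mdist X w y \<le> \<delta>)"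
      proof
        assume "\<exists>y\<in>\<beta> ` {0..}. mdist X w y \<le> \<delta>"
        then obtain s' where s': "0 \<le> s'" "mdist X w (\<beta> s') \<le> \<delta>" by auto
        have "mdist X (\<alpha> (t0 - \<tau>)) (\<beta> s') \<le> mdist X (\<alpha> (t0 - \<tau>)) w + mdist X w (\<beta> s')"
          using wM \<alpha>M \<beta>M s' \<tau> T(1) by (intro mdist_triangle) auto
        then have "mdist X (\<alpha> (t0 - \<tau>)) (\<beta> s') \<le> K1" using w\<alpha> s' by (simp add: K1_def mdist_commute)
        moreover have "T \<le> t0 - \<tau>" using \<tau> by linarith
        ultimately show False using T(2)[of "t0 - \<tau>" s'] s' by simp
      qed
      then obtain s' where s': "0 \<le> s'" "mdist X w (b s') \<le> \<delta>" using coarse_in_Un[OF b(5) w(1)] by auto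
      have "\<bar>mdist X x w - mdist X x (b s')\<bar> \<le> 0 + \<delta>"
        using x wM bM s' by (intro mdist_quadrilateral) auto
      moreover have "mdist X x (b s') = s'" "mdist X (b s') (b \<tau>) = \<bar>s' - \<tau>\<bar>"
        using isometric_onD(2)[OF b(1), of 0 s'] isometric_onD(2)[OF b(1), of s' \<tau>] b(2) s' \<tau> by auto
      moreover have "mdist X w (b \<tau>) \<le> mdist X w (b s') + mdist X (b s') (b \<tau>)"
        using wM bM s' \<tau> by (intro mdist_triangle) auto
      ultimately have wb: "mdist X w (b \<tau>) \<le> 2 * \<delta>" using w s' by linarith
      have M: "\<alpha> (t0 + \<tau>) \<in> mspace X" "\<alpha> (t0 - \<tau>) \<in> mspace X" "a \<tau> \<in> mspace X" "b \<tau> \<in> mspace X"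
        using \<alpha>M aM bM \<tau> t0 T(1) by auto
      have "mdist X (\<alpha> (t0 + \<tau>)) (\<alpha> (t0 - \<tau>)) = 2 * \<tau>"
        using isometric_onD(2)[OF \<alpha>(1), of "t0 + \<tau>" "t0 - \<tau>"] \<tau> t0 T(1) by simp
      moreover have "\<bar>mdist X (\<alpha> (t0 + \<tau>)) (\<alpha> (t0 - \<tau>)) - mdist X (a \<tau>) w\<bar> \<le> (2 * \<delta> + 3 * \<kappa>) + (2 * \<delta>1 + \<kappa>)"
        using M wM near_a[OF \<tau>(1)] w\<alpha> by (intro mdist_quadrilateral) (auto simp: mdist_commute)
      moreover have "mdist X (a \<tau>) w \<le> mdist X (a \<tau>) (b \<tau>) + mdist X (b \<tau>) w" using M wM by (intro mdist_triangle) auto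
      ultimately show ?thesis using wb mdist_commute[of X "b \<tau>" w] by linarith
    qed
    then show "\<exists>a b. isometric_on X {0..} a \<and> a 0 = x \<and> morse_set X N' (a ` {0..}) \<and> coarsely_equal X (a ` {0..}) (\<alpha> ` {0..}) \<and>
         isometric_on X {0..} b \<and> b 0 = x \<and> morse_set X N' (b ` {0..}) \<and> coarsely_equal X (b ` {0..}) (\<beta> ` {0..}) \<and>
         (\<forall>\<tau>. 0 \<le> \<tau> \<and> \<tau> + max T \<kappa> \<le> t0 \<longrightarrow> 2 * \<tau> - (4 * \<delta> + 4 * \<kappa> + 2 * \<delta>1) \<le> mdist X (a \<tau>) (b \<tau>))"
      using a b a\<alpha> by blast
  qed
qed

text \<open>Let \<open>w\<close> be the point at distance \<open>r\<close> from \<open>p\<close> on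
  the segment from \<open>p\<close> back to \<open>\<gamma> 0\<close>. In the ideal triangles for
  \<open>\<alpha>\<close> and for \<open>\<beta>\<close> it is near the new ray or near the old one,
  and it cannot be near both old rays, which have diverged by then. So one of the new rays comes
  near \<open>p\<close> and follows \<open>\<gamma>\<close> up to time \<open>t0\<close>. The
  constant \<open>K\<close> precedes \<open>T\<close> because a time of divergence can be named only
  once \<open>K\<close> is known.\<close>

lemma ray_through:
  obtains N' K and D :: "real \<Rightarrow> real" where
    "\<And>T \<gamma> t0 p \<alpha> \<beta>. isometric_on X {0..} \<gamma> \<Longrightarrow> morse_set X N (\<gamma> ` {0..}) \<Longrightarrow> 0 \<le> t0 \<Longrightarrow> mdist X p (\<gamma> t0) \<le> \<kappa> \<Longrightarrow>
       isometric_on X {0..} \<alpha> \<Longrightarrow> morse_set X N (\<alpha> ` {0..}) \<Longrightarrow> \<alpha> 0 = p \<Longrightarrow>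
       isometric_on X {0..} \<beta> \<Longrightarrow> morse_set X N (\<beta> ` {0..}) \<Longrightarrow> \<beta> 0 = p \<Longrightarrow>
       (\<forall>s\<ge>T. \<forall>s'\<ge>0. K < mdist X (\<alpha> s) (\<beta> s')) \<Longrightarrow>
       \<exists>a. isometric_on X {0..} a \<and> a 0 = \<gamma> 0 \<and> morse_set X N' (a ` {0..}) \<and>
         (coarsely_equal X (a ` {0..}) (\<alpha> ` {0..}) \<or> coarsely_equal X (a ` {0..}) (\<beta> ` {0..})) \<and>
         (\<forall>t. 0 \<le> t \<and> t \<le> t0 \<longrightarrow> mdist X (a t) (\<gamma> t) \<le> D T)"
proof -
  obtain N1 \<delta>1 where \<delta>1: "0 \<le> \<delta>1" and N1: "\<And>\<gamma> t0 p A. isometric_on X {0..} \<gamma> \<Longrightarrow> morse_set X N (\<gamma> ` {0..}) \<Longrightarrow> 0 \<le> t0 \<Longrightarrow>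
       mdist X p (\<gamma> t0) \<le> \<kappa> \<Longrightarrow> geodesic_segment X A (\<gamma> 0) p \<Longrightarrow>
       morse_set X N1 A \<and> coarse_in X \<delta>1 A (\<gamma> ` {0..t0})"
    by (rule segment_to_near_ray[of N \<kappa>]) blast
  define N2 where "N2 \<equiv> \<lambda>q Q. max (N q Q) (N1 q Q)"
  obtain N' \<delta> where cb: "\<And>\<beta> A x. isometric_on X {0..} \<beta> \<Longrightarrow> morse_set X N2 (\<beta> ` {0..}) \<Longrightarrow> geodesic_segment X A (\<beta> 0) x \<Longrightarrow>
       morse_set X N2 A \<Longrightarrow> \<exists>a. isometric_on X {0..} a \<and> a 0 = x \<and> morse_set X N' (a ` {0..}) \<and>
         coarsely_equal X (a ` {0..}) (\<beta> ` {0..}) \<and>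
         coarse_in X \<delta> (a ` {0..}) (A \<union> \<beta> ` {0..}) \<and> coarse_in X \<delta> A (a ` {0..} \<union> \<beta> ` {0..})"
    by (rule change_base[of N2]) blast
  define K where "K \<equiv> \<lambda>T. max T 0 + \<delta> + \<delta> + \<kappa>"
  show thesis
  proof (rule that[where N' = N' and K = "2 * \<delta>" and D = "\<lambda>T. max (2 * N 1 (2 * K T + 2)) (2 * K T)"])
    fix T t0 p \<gamma> \<alpha> \<beta>
    assume \<gamma>: "isometric_on X {0..} \<gamma>" "morse_set X N (\<gamma> ` {0..})" and t0: "0 \<le> t0" and p: "mdist X p (\<gamma> t0) \<le> \<kappa>"
       and \<alpha>: "isometric_on X {0..} \<alpha>" "morse_set X N (\<alpha> ` {0..})" "\<alpha> 0 = p"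
       and \<beta>: "isometric_on X {0..} \<beta>" "morse_set X N (\<beta> ` {0..})" "\<beta> 0 = p"
       and far: "\<forall>s\<ge>T. \<forall>s'\<ge>0. 2 * \<delta> < mdist X (\<alpha> s) (\<beta> s')"
    \<comment> \<open>A point of \<open>\<alpha>\<close> or \<open>\<beta>\<close> within
      \<open>\<delta>\<close> of \<open>w\<close> has time at least \<open>r - \<delta>\<close>,
      hence at least \<open>T\<close>. If the segment is shorter than \<open>r\<close>, then
      \<open>\<gamma> 0\<close> itself is close enough to \<open>p\<close>.\<close>
    define r where "r = max T 0 + \<delta>"
    show "\<exists>a. isometric_on X {0..} a \<and> a 0 = \<gamma> 0 \<and> morse_set X N' (a ` {0..}) \<and>
         (coarsely_equal X (a ` {0..}) (\<alpha> ` {0..}) \<or> coarsely_equal X (a ` {0..}) (\<beta> ` {0..})) \<and>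
         (\<forall>t. 0 \<le> t \<and> t \<le> t0 \<longrightarrow> mdist X (a t) (\<gamma> t) \<le> max (2 * N 1 (2 * K T + 2)) (2 * K T))"
    proof -
      have \<gamma>M: "\<gamma> t \<in> mspace X" if "0 \<le> t" for t using isometric_onD(1)[OF \<gamma>(1)] that by auto
      have \<alpha>M: "\<alpha> t \<in> mspace X" if "0 \<le> t" for t using isometric_onD(1)[OF \<alpha>(1)] that by auto
      have \<beta>M: "\<beta> t \<in> mspace X" if "0 \<le> t" for t using isometric_onD(1)[OF \<beta>(1)] that by auto
      have pM: "p \<in> mspace X" using \<alpha>M[of 0] \<alpha>(3) by simp
      obtain A where A: "geodesic_segment X A (\<gamma> 0) p" using geodesic \<gamma>M pM by blast
      note As = geodesic_segment_sym[OF A]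
      have "morse_set X N1 A" using N1[OF \<gamma> t0 p A] by blast
      then have AN: "morse_set X N2 A" by (rule morse_set_mono) (simp add: N2_def)
      have up: "morse_set X N2 (\<alpha> ` {0..})" "morse_set X N2 (\<beta> ` {0..})"
        using morse_set_mono[OF \<alpha>(2)] morse_set_mono[OF \<beta>(2)] by (auto simp: N2_def)
      obtain a where a: "isometric_on X {0..} a" "a 0 = \<gamma> 0" "morse_set X N' (a ` {0..})"
        "coarsely_equal X (a ` {0..}) (\<alpha> ` {0..})" "coarse_in X \<delta> A (a ` {0..} \<union> \<alpha> ` {0..})"
        using cb[OF \<alpha>(1) up(1) _ AN] As \<alpha>(3) by metis
      obtain b where b: "isometric_on X {0..} b" "b 0 = \<gamma> 0" "morse_set X N' (b ` {0..})"
        "coarsely_equal X (b ` {0..}) (\<beta> ` {0..})" "coarse_in X \<delta> A (b ` {0..} \<union> \<beta> ` {0..})"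
        using cb[OF \<beta>(1) up(2) _ AN] As \<beta>(3) by metis
      have aM: "a t \<in> mspace X" if "0 \<le> t" for t using isometric_onD(1)[OF a(1)] that by auto
      have bM: "b t \<in> mspace X" if "0 \<le> t" for t using isometric_onD(1)[OF b(1)] that by auto
      have "p \<in> A" using geodesic_segmentD(3)[OF A] .
      then obtain y where "mdist X p y \<le> \<delta>" using coarse_inD[OF a(5)] by blast
      then have \<delta>: "0 \<le> \<delta>" by (rule order_trans[OF mdist_nonneg])
      have "(\<exists>s\<ge>0. mdist X (a s) p \<le> r + \<delta>) \<or> (\<exists>s\<ge>0. mdist X (b s) p \<le> r + \<delta>)"
      proof (cases "r \<le> mdist X p (\<gamma> 0)")
        case False
        then have "mdist X (a 0) p \<le> r + \<delta>" using a(2) \<delta> by (simp add: mdist_commute)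
        then show ?thesis by blast
      next
        case True
        have "0 \<le> r" using \<delta> by (simp add: r_def)
        then obtain w where w: "w \<in> A" "mdist X p w = r"
          using geodesic_segment_point[OF As _ True] by blast
        have wM: "w \<in> mspace X" using w geodesic_segmentD[OF A] by blast
        have conv: "mdist X z p \<le> r + \<delta>" if "z \<in> mspace X" "mdist X w z \<le> \<delta>" for z
          using mdist_triangle[of z X w p] that w wM pM by (simp add: mdist_commute)
        have conv': "T \<le> s" if "0 \<le> s" "mdist X w z \<le> \<delta>" "z \<in> mspace X" "mdist X p z = s" for s z
          using mdist_triangle[of p X z w] that w wM pM by (simp add: mdist_commute r_def)
        have "\<not> ((\<exists>y\<in>\<alpha> ` {0..}. mdist X w y \<le> \<delta>) \<and> (\<exists>y\<in>\<beta> ` {0..}. mdist X w y \<le> \<delta>))"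
        proof
          assume "(\<exists>y\<in>\<alpha> ` {0..}. mdist X w y \<le> \<delta>) \<and> (\<exists>y\<in>\<beta> ` {0..}. mdist X w y \<le> \<delta>)"
          then obtain s s' where s: "0 \<le> s" "mdist X w (\<alpha> s) \<le> \<delta>" "0 \<le> s'" "mdist X w (\<beta> s') \<le> \<delta>" by auto
          have "mdist X p (\<alpha> s) = s" using isometric_onD(2)[OF \<alpha>(1), of 0 s] \<alpha>(3) s by simp
          then have "T \<le> s" using conv'[of s "\<alpha> s"] s \<alpha>M by auto
          moreover have "mdist X (\<alpha> s) (\<beta> s') \<le> mdist X (\<alpha> s) w + mdist X w (\<beta> s')"
            using s \<alpha>M \<beta>M wM by (intro mdist_triangle) auto
          ultimately show False using far s by (force simp: mdist_commute)
        qed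
        then show ?thesis
          using coarse_in_Un[OF a(5) w(1)] coarse_in_Un[OF b(5) w(1)] conv aM bM by auto
      qed
      then obtain c where c: "c = a \<or> c = b" "\<exists>s\<ge>0. mdist X (c s) p \<le> r + \<delta>" by blast
      then have cc: "isometric_on X {0..} c" "c 0 = \<gamma> 0" "morse_set X N' (c ` {0..})"
        "coarsely_equal X (c ` {0..}) (\<alpha> ` {0..}) \<or> coarsely_equal X (c ` {0..}) (\<beta> ` {0..})"
        using a b by auto
      obtain s where s: "0 \<le> s" "mdist X (c s) p \<le> r + \<delta>" using c by blast
      have "mdist X (c s) (\<gamma> t0) \<le> mdist X (c s) p + mdist X p (\<gamma> t0)"
        using isometric_onD(1)[OF cc(1)] s pM \<gamma>M t0 by (intro mdist_triangle) auto
      then have "mdist X (c s) (\<gamma> t0) \<le> K T" using s p by (simp add: K_def r_def)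
      then have "mdist X (c t) (\<gamma> t) \<le> max (2 * N 1 (2 * K T + 2)) (2 * K T)" if "0 \<le> t" "t \<le> t0" for t
        using that by (intro rays_fellow_travel[OF cc(1) \<gamma> cc(2) s(1) t0]) auto
      then show ?thesis using cc by blast
    qed
  qed
qed

end

section \<open>Gauges and the Morse boundary\<close>

lemma closed_nbhdI: "x \<in> mspace X \<Longrightarrow> y \<in> A \<Longrightarrow> mdist X x y \<le> r \<Longrightarrow> x \<in> closed_nbhd X r A"
  unfolding closed_nbhd_def
  by (auto intro!: order_trans[OF cINF_lower[of "mdist X x" A y]] bdd_belowI[of _ 0])

lemma closed_nbhdD:
  assumes "x \<in> closed_nbhd X r A" "r < r'" shows "\<exists>y\<in>A. mdist X x y \<le> r'"
proof -
  have "A \<noteq> {}" "(INF a\<in>A. mdist X x a) < r'" using assms by (auto simp: closed_nbhd_def)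
  then obtain y where "y \<in> A" "mdist X x y < r'" using cInf_lessD[of "mdist X x ` A" r'] by auto
  then show ?thesis by (auto intro: less_imp_le)
qed

lemma subset_closed_nbhd_iff:
  assumes "A \<subseteq> mspace X"
  shows "(\<exists>r. A \<subseteq> closed_nbhd X r B) \<longleftrightarrow> (\<exists>r. coarse_in X r A B)"
proof
  assume "\<exists>r. A \<subseteq> closed_nbhd X r B"
  then obtain r where "A \<subseteq> closed_nbhd X r B" ..
  then have "coarse_in X (r + 1) A B" using closed_nbhdD[of _ X r B "r + 1"] by (force simp: coarse_in_def)
  then show "\<exists>r. coarse_in X r A B" ..
next
  assume "\<exists>r. coarse_in X r A B"
  then obtain r where "coarse_in X r A B" ..
  then have "A \<subseteq> closed_nbhd X r B" using assms closed_nbhdI[of _ X] by (force simp: coarse_in_def)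
  then show "\<exists>r. A \<subseteq> closed_nbhd X r B" ..
qed

lemma finite_Hausdorff_dist_iff:
  assumes "A \<subseteq> mspace X" "B \<subseteq> mspace X"
  shows "finite_Hausdorff_dist X A B \<longleftrightarrow> coarsely_equal X A B"
proof
  assume "finite_Hausdorff_dist X A B"
  then have "\<exists>r. A \<subseteq> closed_nbhd X r B" "\<exists>r. B \<subseteq> closed_nbhd X r A" by (auto simp: finite_Hausdorff_dist_def)
  then show "coarsely_equal X A B"
    using subset_closed_nbhd_iff[OF assms(1)] subset_closed_nbhd_iff[OF assms(2)] by (metis coarsely_equalI)
next
  assume "coarsely_equal X A B"
  then obtain r where r: "coarse_in X r A B" "coarse_in X r B A" by (auto simp: coarsely_equal_def)
  then have "A \<subseteq> closed_nbhd X r B" "B \<subseteq> closed_nbhd X r A"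
    using assms closed_nbhdI[of _ X] by (force simp: coarse_in_def)+
  then show "finite_Hausdorff_dist X A B" by (auto simp: finite_Hausdorff_dist_def)
qed

lemma ray_mspace: "isometric_on X {0..} a \<Longrightarrow> a ` {0..} \<subseteq> mspace X"
  by (simp add: isometric_on_def)

text \<open>The added 1 pays for the infimum in \<open>closed_nbhd\<close>. Since
  \<open>morse_on\<close> takes endpoints in the order of the ray, a path joining them in the other
  order is run backwards.\<close>

lemma morse_set_of_gauge_ray:
  assumes "gauge_morse_ray X N a"
  shows "isometric_on X {0..} a" "morse_set X (\<lambda>q Q. N q Q + 1) (a ` {0..})"
proof -
  show a: "isometric_on X {0..} a" using assms by (simp add: gauge_morse_ray_def geodesic_ray_iff)
  have main: "coarse_in X (N q Q + 1) (\<eta> ` {i..j}) (subsegment X (a ` {0..}) (\<eta> i) (\<eta> j))"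
    if h: "0 \<le> s" "s \<le> t" "\<eta> i = a s" "\<eta> j = a t" "1 \<le> q" "0 \<le> Q" "i \<le> j"
      "quasi_geodesic X q Q {i..j} \<eta>" for q Q i j \<eta> s t
  proof -
    have "\<eta> ` {i..j} \<subseteq> closed_nbhd X (N q Q) (a ` {s..t})"
      using assms h unfolding gauge_morse_ray_def morse_on_def by auto
    then have "coarse_in X (N q Q + 1) (\<eta> ` {i..j}) (a ` {s..t})"
      using closed_nbhdD[of _ X "N q Q" "a ` {s..t}" "N q Q + 1"] unfolding coarse_in_def by (meson less_add_one subsetD)
    then show ?thesis using subsegment_isometric_le[OF a, of s t] h by auto
  qed
  have "coarse_in X (N q Q + 1) (\<eta> ` {i..j}) (subsegment X (a ` {0..}) (\<eta> i) (\<eta> j))"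
    if h: "\<eta> i \<in> a ` {0..}" "\<eta> j \<in> a ` {0..}" "1 \<le> q" "0 \<le> Q" "i \<le> j"
      "quasi_geodesic X q Q {i..j} \<eta>" for q Q i j \<eta>
  proof -
    obtain s t where st: "0 \<le> s" "0 \<le> t" "\<eta> i = a s" "\<eta> j = a t" using h by auto
    show ?thesis
    proof (cases "s \<le> t")
      case True then show ?thesis using main[of s t \<eta> i j q Q] st h by simp
    next
      case False
      have "(\<lambda>t. \<eta> (- t)) ` {-j..-i} = \<eta> ` {i..j}" using image_image[of \<eta> uminus "{-j..-i}"] by simp
      then show ?thesis
        using main[of t s "\<lambda>t. \<eta> (- t)" "-j" "-i" q Q] st h False quasi_geodesic_uminus[OF h(6)]
        by (simp add: subsegment_sym)
    qed
  qed
  then show "morse_set X (\<lambda>q Q. N q Q + 1) (a ` {0..})"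
    unfolding morse_set_def using ray_mspace[OF a] by blast
qed

lemma gauge_morse_rayI:
  assumes a: "isometric_on X {0..} a" and N: "morse_set X N (a ` {0..})"
  shows "gauge_morse_ray X N a"
  unfolding gauge_morse_ray_def geodesic_ray_iff morse_on_def
proof (intro conjI a ballI allI impI subsetI)
  fix s t q Q i j \<eta> x
  assume h: "s \<in> {0..}" "t \<in> {0..}" "s \<le> t" "1 \<le> q" "0 \<le> Q"
    "i \<le> j \<and> quasi_geodesic X q Q {i..j} \<eta> \<and> \<eta> i = a s \<and> \<eta> j = a t" "x \<in> \<eta> ` {i..j}"
  have "coarse_in X (N q Q) (\<eta> ` {i..j}) (subsegment X (a ` {0..}) (\<eta> i) (\<eta> j))"
    using h by (intro morse_setD[OF N]) auto
  moreover have "subsegment X (a ` {0..}) (\<eta> i) (\<eta> j) = a ` {s..t}"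
    using subsegment_isometric_le[OF a, of s t] h by auto
  ultimately obtain y where "y \<in> a ` {s..t}" "mdist X x y \<le> N q Q" using coarse_inD h(7) by metis
  moreover have "x \<in> mspace X" using h by (auto simp: quasi_geodesic_def)
  ultimately show "x \<in> closed_nbhd X (N q Q) (a ` {s..t})" by (intro closed_nbhdI)
qed

(* Any function serves as a gauge once it is replaced by a piecewise linear majorant of its
   values at integers, since a (q,Q)-quasi-geodesic is a (q,n)-quasi-geodesic for n >= Q. *)
lemma ex_morse_gauge:
  fixes N :: "real \<Rightarrow> real \<Rightarrow> real"
  obtains N' where "morse_gauge N'" "D \<le> morse_delta N'"
    "\<And>(X :: 'p metric) A. morse_set X N A \<Longrightarrow> morse_set X N' A"
proof -
  \<comment> \<open>A sum of ramps: the ramp of index \<open>i\<close> rises from 0 at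
    \<open>i\<close> to 1 at \<open>i + 1\<close>, so it is complete between \<open>i + 1\<close>
    and \<open>i + 2\<close>, where \<open>N q (real i + 2)\<close> has to be dominated. The
    constant term takes care of the integers 0 and 1, and its summand \<open>\<bar>D\<bar>\<close>
    makes \<open>morse_delta N'\<close> at least \<open>D\<close> through the term
    \<open>8 * N' 3 0\<close>.\<close>
  define f where "f \<equiv> \<lambda>q m Q. (\<bar>N q 0\<bar> + \<bar>N q 1\<bar> + \<bar>D\<bar>) +
    (\<Sum>i<m. \<bar>N q (real i + 2)\<bar> * max 0 (min 1 (Q - real i)))"
  \<comment> \<open>Ramps that start at or beyond \<open>Q\<close> vanish, so below any integer
    \<open>m\<close> this agrees with the finite sum \<open>f q m\<close>; continuity is inherited
    from there.\<close>
  define N' where "N' \<equiv> \<lambda>q Q. f q (nat \<lceil>Q\<rceil>) Q"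
  have N'_f: "N' q Q = f q m Q" if "Q \<le> real m" for q Q m
  proof -
    have "nat \<lceil>Q\<rceil> \<le> m" using that by linarith
    then show ?thesis unfolding N'_def f_def
    proof (intro arg_cong2[where f = "(+)"] HOL.refl sum.mono_neutral_left ballI)
      fix i assume "i \<in> {..<m} - {..<nat \<lceil>Q\<rceil>}"
      then have "Q \<le> real i" by (auto simp: nat_le_iff ceiling_le_iff)
      then show "\<bar>N q (real i + 2)\<bar> * max 0 (min 1 (Q - real i)) = 0" by simp
    qed auto
  qed
  have f_mono: "f q m Q \<le> f q m Q'" if "Q \<le> Q'" for q m Q Q'
    unfolding f_def using that by (intro add_left_mono sum_mono mult_left_mono) auto
  have f_cont: "continuous_on UNIV (f q m)" for q m unfolding f_def by (intro continuous_intros)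
  have base: "\<bar>N q 0\<bar> + \<bar>N q 1\<bar> + \<bar>D\<bar> \<le> N' q Q" for q Q
    unfolding N'_def f_def by (simp add: sum_nonneg)
  have ub: "Q \<le> real (nat \<lceil>Q\<rceil>)" for Q :: real by linarith
  have mono: "N' q Q \<le> N' q Q'" if "Q \<le> Q'" for q Q Q'
    using N'_f[of Q "nat \<lceil>Q'\<rceil>" q] N'_f[of Q' "nat \<lceil>Q'\<rceil>" q] f_mono[OF that] ub[of Q'] that by auto
  have "continuous_on UNIV (N' q)" for q
  proof -
    have "continuous_on (\<Union>m::nat. {..<real m}) (N' q)"
    proof (rule continuous_on_open_UN)
      fix m :: nat
      have "continuous_on {..<real m} (f q m)" using f_cont continuous_on_subset by blast
      then show "continuous_on {..<real m} (N' q)"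
        by (rule continuous_on_cong[THEN iffD1, OF HOL.refl, rotated]) (simp add: N'_f[of _ m])
    qed auto
    moreover have "(\<Union>m::nat. {..<real m}) = UNIV" using reals_Archimedean2 by auto
    ultimately show ?thesis by simp
  qed
  then have "morse_gauge N'"
    unfolding morse_gauge_def mono_on_def
    using mono base order_trans[OF _ base] continuous_on_subset by (metis UNIV_I abs_ge_zero add_nonneg_nonneg subsetI)
  moreover have "D \<le> morse_delta N'"
    using base[of 3 0] unfolding morse_delta_def by (intro max.coboundedI2) linarith
  moreover have ge: "N q (real k) \<le> N' q Q" if "real k - 1 < Q" "Q \<le> real k" for q k Q
  proof -
    consider "k = 0" | "k = 1" | i where "k = i + 2" by (metis One_nat_def Suc_1 add_2_eq_Suc' not0_implies_Suc)
    then show ?thesis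
    proof cases
      case 3
      have "\<bar>N q (real i + 2)\<bar> * max 0 (min 1 (Q - real i)) \<le> (\<Sum>i<k. \<bar>N q (real i + 2)\<bar> * max 0 (min 1 (Q - real i)))"
        using 3 by (intro member_le_sum) auto
      moreover have "max 0 (min 1 (Q - real i)) = 1" "real k = real i + 2" using that 3 by auto
      ultimately show ?thesis
        using abs_ge_self[of "N q (real k)"] unfolding N'_f[OF that(2)] f_def by simp
    qed (use base[of q Q] in auto)
  qed
  have "morse_set X N' A" if A: "morse_set X N A" for X :: "'p metric" and A
  proof -
    have "coarse_in X (N' q Q) (\<eta> ` {i..j}) (subsegment X A (\<eta> i) (\<eta> j))"
      if h: "\<eta> i \<in> A" "\<eta> j \<in> A" "1 \<le> q" "0 \<le> Q" "i \<le> j" "quasi_geodesic X q Q {i..j} \<eta>" for q Q i j \<eta>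
    proof -
      define k where "k = nat \<lceil>Q\<rceil>"
      have k: "real k - 1 < Q" "Q \<le> real k" using h(4) unfolding k_def by linarith+
      have "quasi_geodesic X q (real k) {i..j} \<eta>"
        using h(6) k unfolding quasi_geodesic_def by (meson add_left_mono diff_left_mono order_trans)
      then have "coarse_in X (N q (real k)) (\<eta> ` {i..j}) (subsegment X A (\<eta> i) (\<eta> j))"
        using h by (intro morse_setD[OF A]) auto
      then show ?thesis by (rule coarse_in_mono) (use ge[OF k] in auto)
    qed
    then show ?thesis unfolding morse_set_def using morse_set_mspace[OF A] by blast
  qed
  ultimately show thesis using that by blast
qed

lemma morse_ray_iff:
  "morse_ray X a \<longleftrightarrow> isometric_on X {0..} a \<and> (\<exists>N. morse_set X N (a ` {0..}))"
proof
  assume "morse_ray X a"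
  then show "isometric_on X {0..} a \<and> (\<exists>N. morse_set X N (a ` {0..}))"
    unfolding morse_ray_def using morse_set_of_gauge_ray by blast
next
  assume a: "isometric_on X {0..} a \<and> (\<exists>N. morse_set X N (a ` {0..}))"
  then obtain N where N: "morse_set X N (a ` {0..})" by blast
  obtain N' where "morse_gauge N'" "morse_set X N' (a ` {0..})"
    using ex_morse_gauge[of 0 N] N by metis
  then show "morse_ray X a" unfolding morse_ray_def using gauge_morse_rayI a by blast
qed

lemma morse_ray_isometric: "morse_ray X a \<Longrightarrow> isometric_on X {0..} a"
  by (simp add: morse_ray_iff)

lemma ray_class_altdef:
  assumes "b ` {0..} \<subseteq> mspace X"
  shows "ray_class X e b = {a. morse_ray X a \<and> a 0 = e \<and> coarsely_equal X (a ` {0..}) (b ` {0..})}"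
  unfolding ray_class_def using finite_Hausdorff_dist_iff[OF ray_mspace assms] morse_ray_isometric by blast

lemma ray_class_self:
  assumes "morse_ray X a" "a 0 = e" shows "a \<in> ray_class X e a"
  using assms ray_mspace[OF morse_ray_isometric[OF assms(1)]] by (simp add: ray_class_altdef coarsely_equal_refl)

lemma ray_class_cong:
  assumes "coarsely_equal X (a ` {0..}) (b ` {0..})" "a ` {0..} \<subseteq> mspace X" "b ` {0..} \<subseteq> mspace X"
  shows "ray_class X e a = ray_class X e b"
  unfolding ray_class_altdef[OF assms(2)] ray_class_altdef[OF assms(3)]
  using assms coarsely_equal_trans[OF _ assms(1)] coarsely_equal_trans[OF _ coarsely_equal_sym[OF assms(1)]]
    ray_mspace[OF morse_ray_isometric] by blast

lemma ray_class_eq_iff: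
  assumes "morse_ray X a" "a 0 = e" "b ` {0..} \<subseteq> mspace X"
  shows "ray_class X e a = ray_class X e b \<longleftrightarrow> coarsely_equal X (a ` {0..}) (b ` {0..})"
  using ray_class_self[OF assms(1,2)] ray_class_altdef[OF assms(3)] ray_mspace[OF morse_ray_isometric[OF assms(1)]]
    ray_class_cong[OF _ _ assms(3)] by auto

lemma morse_boundary_points_eq:
  "morse_boundary_points X e = {ray_class X e a |a. morse_ray X a \<and> a 0 = e}"
  unfolding morse_boundary_points_def morse_stratum_points_def morse_ray_def by auto

lemma limitin_morse_boundary:
  assumes \<gamma>: "isometric_on X {0..} \<gamma>" "morse_set X N (\<gamma> ` {0..})" "\<gamma> 0 = e"
    and a: "\<And>n. isometric_on X {0..} (a n)" "\<And>n. morse_set X N (a n ` {0..})" "\<And>n. a n 0 = e"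
    and near: "\<And>n t. 0 \<le> t \<Longrightarrow> t \<le> real n \<Longrightarrow> mdist X (a n t) (\<gamma> t) \<le> D"
  shows "limitin (morse_boundary X e) (\<lambda>n. ray_class X e (a n)) (ray_class X e \<gamma>) sequentially"
proof -
  obtain N' where N': "morse_gauge N'" "D \<le> morse_delta N'"
    "\<And>(X :: 'a metric) A. morse_set X N A \<Longrightarrow> morse_set X N' A"
    by (rule ex_morse_gauge[of D N]) blast
  have \<gamma>N': "gauge_morse_ray X N' \<gamma>" and aN': "\<And>n. gauge_morse_ray X N' (a n)"
    using gauge_morse_rayI N'(3) \<gamma> a by blast+
  have S: "ray_class X e \<gamma> \<in> morse_stratum_points X e N'" "\<And>n. ray_class X e (a n) \<in> morse_stratum_points X e N'"
    using \<gamma>N' aN' \<gamma>(3) a(3) by (auto simp: morse_stratum_points_def)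
  have "eventually (\<lambda>n. ray_class X e (a n) \<in> U) sequentially"
    if U: "openin (morse_boundary X e) U" "ray_class X e \<gamma> \<in> U" for U
  proof -
    have "openin (morse_stratum X e N') (U \<inter> morse_stratum_points X e N')"
      using U N'(1) by (simp add: openin_morse_boundary)
    then obtain k where k: "morse_stratum_nbhd X e N' k \<gamma> \<subseteq> U"
      using U(2) S(1) \<gamma>N' \<gamma>(3) unfolding openin_morse_stratum by blast
    have "ray_class X e (a n) \<in> morse_stratum_nbhd X e N' k \<gamma>" if "k \<le> n" for n
    proof -
      have "mdist X (\<gamma> t) (a n t) \<le> morse_delta N'" if t: "0 \<le> t" "t \<le> real k" for t
        using near[of t n] t \<open>k \<le> n\<close> N'(2) by (simp add: mdist_commute)
      then show ?thesis unfolding morse_stratum_nbhd_def using aN' a(3) by blast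
    qed
    then show ?thesis using k unfolding eventually_sequentially by blast
  qed
  moreover have "ray_class X e \<gamma> \<in> topspace (morse_boundary X e)"
    using S(1) N'(1) by (auto simp: morse_boundary_points_def)
  ultimately show ?thesis unfolding limitin_def by blast
qed

section \<open>Cayley graphs\<close>

locale finitely_generated_group = group G for G :: "('a, 'b) monoid_scheme" +
  fixes S :: "'a set"
  assumes finite_S: "finite S" and S_carrier: "S \<subseteq> carrier G" and generate_S: "generate G S = carrier G"
begin

abbreviation X where "X \<equiv> cayley_graph G S"
abbreviation act where "act \<equiv> cayley_act G"

lemmas mspace_X = mspace_cayley_graph[OF is_group S_carrier generate_S]
lemmas mdist_X = mdist_cayley_graph[OF is_group S_carrier generate_S]

section \<open>Chains, distances and paths\<close>

lemma chain_dist: "cayley_chain G S x y r \<Longrightarrow> mdist X x y \<le> r"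
  using cayley_chain_points[of G S x y r] cayley_chain_nonneg
  by (auto simp: mdist_X cayley_dist_def intro!: cInf_lower bdd_belowI[of _ 0])

lemma ex_chain:
  assumes "x \<in> mspace X" "y \<in> mspace X" "mdist X x y < r"
  shows "\<exists>r'<r. cayley_chain G S x y r'"
proof -
  have "{r. cayley_chain G S x y r} \<noteq> {}"
    using cayley_chain_exists[OF is_group S_carrier generate_S] assms by (auto simp: mspace_X)
  then show ?thesis
    using cInf_lessD[of "{r. cayley_chain G S x y r}" r] assms
    by (auto simp: mspace_X mdist_X cayley_dist_def)
qed

lemma vertex_points: "g \<in> carrier G \<Longrightarrow> cayley_vertex g \<in> mspace X"
  by (auto simp: mspace_X cayley_points_def)

lemma segment_points: "cayley_adjacent G S u v \<Longrightarrow> x \<in> cayley_segment u v \<Longrightarrow> x \<in> mspace X"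
  by (auto simp: mspace_X cayley_points_def)

lemma segment_dist:
  assumes "cayley_adjacent G S u v" "y \<in> cayley_segment u v" "z \<in> cayley_segment u v"
  shows "mdist X y z \<le> \<bar>y u - z u\<bar>"
  using chain_dist[OF cayley_chain.step[OF cayley_chain.refl assms]] segment_points[OF assms(1,2)]
  by (simp add: mspace_X)

lemma segment_convex:
  assumes "y \<in> cayley_segment u v" "z \<in> cayley_segment u v" "0 \<le> \<tau>" "\<tau> \<le> 1"
  shows "(\<lambda>h. y h + \<tau> * (z h - y h)) \<in> cayley_segment u v"
proof -
  obtain s where s: "y = (\<lambda>h. (1 - s) * cayley_vertex u h + s * cayley_vertex v h)" "0 \<le> s" "s \<le> 1"
    using assms(1) unfolding cayley_segment_def by blast
  obtain t where t: "z = (\<lambda>h. (1 - t) * cayley_vertex u h + t * cayley_vertex v h)" "0 \<le> t" "t \<le> 1"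
    using assms(2) unfolding cayley_segment_def by blast
  define c where "c = (1 - \<tau>) * s + \<tau> * t"
  have "0 \<le> c" using s t assms by (simp add: c_def)
  moreover have "c \<le> 1" unfolding c_def using s t assms by (intro convex_bound_le) auto
  moreover have "(\<lambda>h. y h + \<tau> * (z h - y h)) = (\<lambda>h. (1 - c) * cayley_vertex u h + c * cayley_vertex v h)"
    unfolding s(1) t(1) c_def by (auto simp: fun_eq_iff algebra_simps)
  ultimately show ?thesis unfolding cayley_segment_def by blast
qed

text \<open>The coordinate at \<open>u\<close> measures arc length on an edge, so a step of a chain
  becomes linear interpolation at unit speed. A step of length 0 is set apart because the
  interpolation divides by \<open>l\<close>. These are the paths that
  \<open>length_space_geodesic\<close> asks for.\<close>

lemma chain_path:
  "cayley_chain G S x y r \<Longrightarrow> \<exists>p. p 0 = x \<and> p r = y \<and> p ` {0..r} \<subseteq> mspace X \<and>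
     (\<forall>s\<in>{0..r}. \<forall>t\<in>{0..r}. mdist X (p s) (p t) \<le> \<bar>s - t\<bar>)"
proof (induction rule: cayley_chain.induct)
  case (refl x)
  then show ?case by (intro exI[of _ "\<lambda>_. x"]) (auto simp: mspace_X)
next
  case (step x y r u v z)
  obtain p where "p 0 = x \<and> p r = y \<and> p ` {0..r} \<subseteq> mspace X \<and>
     (\<forall>s\<in>{0..r}. \<forall>t\<in>{0..r}. mdist X (p s) (p t) \<le> \<bar>s - t\<bar>)" using step.IH by blast
  then have p: "p 0 = x" "p r = y" "\<And>t. t \<in> {0..r} \<Longrightarrow> p t \<in> mspace X"
    "\<And>s t. s \<in> {0..r} \<Longrightarrow> t \<in> {0..r} \<Longrightarrow> mdist X (p s) (p t) \<le> \<bar>s - t\<bar>" by auto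
  have r: "0 \<le> r" using cayley_chain_nonneg[OF step.hyps(1)] .
  define l where "l = \<bar>y u - z u\<bar>"
  show ?case
  proof (cases "l = 0")
    case True
    then have "y h = z h" for h using cayley_segment_coordinate_le[OF step.hyps(3,4), of h] by (simp add: l_def)
    then have "y = z" by blast
    then show ?thesis using p True by (intro exI[of _ p]) (auto simp: l_def)
  next
    case False
    then have l: "0 < l" by (simp add: l_def)
    define w where "w \<equiv> \<lambda>t h. y h + ((t - r) / l) * (z h - y h)"
    have w: "w t \<in> cayley_segment u v" if "t \<in> {r..r + l}" for t
      unfolding w_def using that l by (intro segment_convex step.hyps) (auto simp: field_simps)
    have wd: "mdist X (w s) (w t) \<le> \<bar>s - t\<bar>" if "s \<in> {r..r + l}" "t \<in> {r..r + l}" for s t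
    proof -
      have "w s u - w t u = ((s - t) / l) * (z u - y u)" by (simp add: w_def field_simps diff_divide_distrib)
      then have "\<bar>w s u - w t u\<bar> = \<bar>s - t\<bar> / l * l"
        using l by (simp add: abs_mult l_def abs_minus_commute)
      then show ?thesis using segment_dist[OF step.hyps(2) w w] that l by force
    qed
    define p' where "p' \<equiv> \<lambda>t. if t \<le> r then p t else w t"
    have wr: "w r = y" "w (r + l) = z" using l by (auto simp: w_def)
    have p'w: "p' t = w t" if "r \<le> t" for t using that p(2) wr by (auto simp: p'_def)
    have M: "p' t \<in> mspace X" if "t \<in> {0..r + l}" for t
      using p(3) segment_points[OF step.hyps(2) w] that by (auto simp: p'_def)
    have le: "mdist X (p' s) (p' t) \<le> \<bar>s - t\<bar>" if st: "s \<in> {0..r + l}" "t \<in> {0..r + l}" "s \<le> t" for s t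
    proof -
      consider "t \<le> r" | "r \<le> s" | "s \<le> r" "r \<le> t" by linarith
      then show ?thesis
      proof cases
        case 1 then show ?thesis using p(4)[of s t] st by (simp add: p'_def)
      next
        case 2 then show ?thesis using wd[of s t] p'w st by simp
      next
        case 3
        have "mdist X (p' s) (p' t) \<le> mdist X (p' s) (p' r) + mdist X (p' r) (p' t)"
          using M st 3 r l by (intro mdist_triangle) auto
        moreover have "mdist X (p' s) (p' r) \<le> r - s" using p(4)[of s r] 3 st r by (simp add: p'_def)
        moreover have "mdist X (p' r) (p' t) \<le> t - r" using wd[of r t] p'w 3 st by simp
        ultimately show ?thesis using 3 by linarith
      qed
    qed
    have "mdist X (p' s) (p' t) \<le> \<bar>s - t\<bar>" if "s \<in> {0..r + l}" "t \<in> {0..r + l}" for s t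
      using le[of s t] le[of t s] that by (cases "s \<le> t") (auto simp: mdist_commute abs_minus_commute)
    moreover have "p' 0 = x" "p' (r + l) = z" using p r l p'w[of "r + l"] wr by (auto simp: p'_def)
    ultimately show ?thesis using M unfolding l_def[symmetric] by blast
  qed
qed

section \<open>Finite balls of vertices and properness\<close>

primrec reach :: "'a \<Rightarrow> nat \<Rightarrow> 'a set" where
  "reach w 0 = {w}"
| "reach w (Suc n) = reach w n \<union> {v. \<exists>u\<in>reach w n. cayley_adjacent G S u v}"

lemma adjacent_sym: "cayley_adjacent G S u v \<Longrightarrow> cayley_adjacent G S v u"
  by (auto simp: cayley_adjacent_def)

lemma finite_neighbours: "finite {v. cayley_adjacent G S u v}"
proof (rule finite_subset)
  show "{v. cayley_adjacent G S u v} \<subseteq> (\<lambda>s. u \<otimes>\<^bsub>G\<^esub> s) ` S \<union> (\<lambda>s. u \<otimes>\<^bsub>G\<^esub> inv\<^bsub>G\<^esub> s) ` S"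
  proof
    fix v assume "v \<in> {v. cayley_adjacent G S u v}"
    then obtain s where s: "s \<in> S" "u \<in> carrier G" "v \<in> carrier G" "v = u \<otimes>\<^bsub>G\<^esub> s \<or> u = v \<otimes>\<^bsub>G\<^esub> s"
      by (auto simp: cayley_adjacent_def)
    have "s \<in> carrier G" using s S_carrier by blast
    then have "v = u \<otimes>\<^bsub>G\<^esub> s \<or> v = u \<otimes>\<^bsub>G\<^esub> inv\<^bsub>G\<^esub> s" using s by (auto simp: m_assoc)
    then show "v \<in> (\<lambda>s. u \<otimes>\<^bsub>G\<^esub> s) ` S \<union> (\<lambda>s. u \<otimes>\<^bsub>G\<^esub> inv\<^bsub>G\<^esub> s) ` S" using s by blast
  qed
qed (use finite_S in simp)

lemma finite_reach: "finite (reach w n)"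
proof (induction n)
  case (Suc n)
  have "{v. \<exists>u\<in>reach w n. cayley_adjacent G S u v} = (\<Union>u\<in>reach w n. {v. cayley_adjacent G S u v})" by blast
  then show ?case using Suc finite_neighbours by simp
qed simp

lemma reach_mono: "m \<le> n \<Longrightarrow> reach w m \<subseteq> reach w n"
  by (induction n rule: dec_induct) auto

lemma segment_coordinates:
  assumes "y \<in> cayley_segment u v"
  shows "u = v \<Longrightarrow> y = cayley_vertex u" "u \<noteq> v \<Longrightarrow> y v = 1 - y u" "h \<noteq> u \<Longrightarrow> h \<noteq> v \<Longrightarrow> y h = 0"
    "0 \<le> y h" "y h \<le> 1" "y u = 0 \<Longrightarrow> y = cayley_vertex v"
  using assms unfolding cayley_segment_def cayley_vertex_def by (auto simp: fun_eq_iff)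

lemma segment_commute: "cayley_segment u v \<subseteq> cayley_segment v u"
proof
  fix y assume "y \<in> cayley_segment u v"
  then obtain t where "y = (\<lambda>h. (1 - t) * cayley_vertex u h + t * cayley_vertex v h)" "0 \<le> t" "t \<le> 1"
    unfolding cayley_segment_def by blast
  then show "y \<in> cayley_segment v u"
    unfolding cayley_segment_def by (auto intro!: exI[of _ "1 - t"] simp: fun_eq_iff)
qed

(* The left-hand side of the inequality is the length of a path from w to y through the vertex v. *)
lemma chain_reach:
  "cayley_chain G S x y r \<Longrightarrow> x = cayley_vertex w \<Longrightarrow>
    \<exists>v n. v \<in> reach w n \<and> 0 < y v \<and> real n + (1 - y v) \<le> r"
proof (induction rule: cayley_chain.induct)
  case (refl x)
  then show ?case by (intro exI[of _ w] exI[of _ 0]) (auto simp: cayley_vertex_def)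
next
  case (step x y r u u' z)
  \<comment> \<open>As long as \<open>z\<close> has a positive coordinate at \<open>u\<close>, this
    vertex still serves. Otherwise \<open>z\<close> is the other end of the edge, and the length
    \<open>y u\<close> spent on the way completes \<open>1 - y u\<close> to the unit that one more
    step of \<open>reach\<close> costs.\<close>
  have main: "\<exists>v n. v \<in> reach w n \<and> 0 < z v \<and> real n + (1 - z v) \<le> r + \<bar>y u - z u\<bar>"
    if vn: "u \<in> reach w n" "0 < y u" "real n + (1 - y u) \<le> r"
      and adj: "cayley_adjacent G S u u'" and seg: "y \<in> cayley_segment u u'" "z \<in> cayley_segment u u'" for u u' n
  proof (cases "z u = 0")
    case False
    then have "0 < z u" using segment_coordinates(4)[OF seg(2), of u] by linarith
    moreover have "real n + (1 - z u) \<le> r + \<bar>y u - z u\<bar>" using vn by linarith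
    ultimately show ?thesis using vn by blast
  next
    case True
    have "u' \<in> reach w (Suc n)" using vn adj by auto
    moreover have "z u' = 1" using segment_coordinates(6)[OF seg(2) True] by (simp add: cayley_vertex_def)
    ultimately show ?thesis using vn True by (intro exI[of _ u'] exI[of _ "Suc n"]) auto
  qed
  obtain v n where v: "v \<in> reach w n" "0 < y v" "real n + (1 - y v) \<le> r" using step by blast
  then have "v = u \<or> v = u'" using segment_coordinates(3)[OF step.hyps(3), of v] by force
  then show ?case
  proof
    assume "v = u" then show ?thesis using main v step.hyps(2-4) by blast
  next
    assume vu: "v = u'"
    have "\<bar>y u' - z u'\<bar> = \<bar>y u - z u\<bar>"
      using segment_coordinates(2)[OF step.hyps(3)] segment_coordinates(2)[OF step.hyps(4)] by (cases "u = u'") auto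
    then show ?thesis
      using main[of u' n u] v vu adjacent_sym[OF step.hyps(2)] step.hyps(3,4) segment_commute by force
  qed
qed

lemma near_vertex:
  assumes "x \<in> mspace X" obtains g where "g \<in> carrier G" "mdist X x (cayley_vertex g) \<le> 1"
proof -
  consider u where "u \<in> carrier G" "x = cayley_vertex u"
    | u v where "cayley_adjacent G S u v" "x \<in> cayley_segment u v"
    using assms unfolding mspace_X cayley_points_def by blast
  then show thesis
  proof cases
    case 1
    then show thesis using that[of u] assms by simp
  next
    case 2
    have "mdist X x (cayley_vertex u) \<le> \<bar>x u - cayley_vertex u u\<bar>" by (rule segment_dist[OF 2]) simp
    also have "\<dots> \<le> 1" using segment_coordinates(4,5)[OF 2(2), of u] by (auto simp: cayley_vertex_def)
    finally show thesis using that[of u] 2(1) by (auto simp: cayley_adjacent_def)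
  qed
qed

lemma compactin_segment:
  assumes "cayley_adjacent G S u v" shows "compactin (mtopology_of X) (cayley_segment u v)"
proof -
  define f where "f \<equiv> \<lambda>t h. (1 - t) * cayley_vertex u h + t * cayley_vertex v h"
  define I where "I = submetric euclidean_metric {0..1::real}"
  have fseg: "f t \<in> cayley_segment u v" if "t \<in> {0..1}" for t
    unfolding f_def cayley_segment_def using that by auto
  have "mdist X (f s) (f t) \<le> 1 * dist s t" if "s \<in> {0..1}" "t \<in> {0..1}" for s t
  proof -
    have "mdist X (f s) (f t) \<le> \<bar>f s u - f t u\<bar>" by (rule segment_dist[OF assms fseg fseg]) fact+
    also have "\<dots> \<le> \<bar>s - t\<bar>" by (auto simp: f_def cayley_vertex_def)
    finally show ?thesis by (simp add: dist_real_def)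
  qed
  then have "Lipschitz_continuous_map I X f"
    unfolding Lipschitz_continuous_map_def I_def
    using segment_points[OF assms fseg] by (auto intro!: exI[of _ 1])
  then have "continuous_map (mtopology_of I) (mtopology_of X) f" by (rule Lipschitz_continuous_imp_continuous_map)
  moreover have "compactin (mtopology_of I) {0..1}"
    by (simp add: I_def mtopology_of_submetric compactin_subtopology)
  ultimately have "compactin (mtopology_of X) (f ` {0..1})" by (rule image_compactin[rotated])
  moreover have "f ` {0..1} = cayley_segment u v" unfolding f_def cayley_segment_def by auto
  ultimately show ?thesis by simp
qed

sublocale proper_space X
proof
  fix x and r :: real assume x: "x \<in> mspace X"
  obtain w where w: "w \<in> carrier G" "mdist X x (cayley_vertex w) \<le> 1" by (rule near_vertex[OF x])
  \<comment> \<open>One unit is the distance from \<open>x\<close> to the vertex \<open>w\<close>;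
    the other leaves room for a chain longer than the distance it approximates.\<close>
  define n where "n = nat \<lceil>r + 2\<rceil>"
  \<comment> \<open>The singletons cover vertices that lie on no edge, as when \<open>S\<close> is
    empty.\<close>
  define \<F> where "\<F> = (\<lambda>v. {cayley_vertex v}) ` (reach w n \<inter> carrier G) \<union>
    (\<lambda>(u, v). cayley_segment u v) ` (SIGMA u:reach w n. {v. cayley_adjacent G S u v})"
  have "compactin (mtopology_of X) (\<Union>\<F>)"
  proof (rule compactin_Union)
    show "finite \<F>" unfolding \<F>_def
      by (intro finite_UnI finite_imageI finite_SigmaI finite_Int disjI1 finite_reach finite_neighbours)
    show "\<And>K. K \<in> \<F> \<Longrightarrow> compactin (mtopology_of X) K"
      unfolding \<F>_def using compactin_segment vertex_points by auto
  qed
  moreover have "{y \<in> mspace X. mdist X x y \<le> r} \<subseteq> \<Union>\<F>"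
  proof
    fix y assume "y \<in> {y \<in> mspace X. mdist X x y \<le> r}"
    then have y: "y \<in> mspace X" "mdist X x y \<le> r" by auto
    have "mdist X (cayley_vertex w) y \<le> mdist X (cayley_vertex w) x + mdist X x y"
      using x y vertex_points w by (intro mdist_triangle) auto
    then have "mdist X (cayley_vertex w) y < r + 2" using w y by (simp add: mdist_commute)
    then obtain r' where r': "r' < r + 2" "cayley_chain G S (cayley_vertex w) y r'"
      using ex_chain vertex_points[OF w(1)] y by blast
    then obtain v m where v: "v \<in> reach w m" "0 < y v" "real m + (1 - y v) \<le> r'" using chain_reach by blast
    have "y h \<le> 1" for h
      using y(1) segment_coordinates(5) unfolding mspace_X cayley_points_def by (auto simp: cayley_vertex_def)
    from this[of v] have "real m \<le> r + 2" using v(3) r'(1) by linarith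
    then have "m \<le> n" unfolding n_def by linarith
    then have vn: "v \<in> reach w n" using v reach_mono by blast
    consider u where "u \<in> carrier G" "y = cayley_vertex u"
      | u u' where "cayley_adjacent G S u u'" "y \<in> cayley_segment u u'"
      using y unfolding mspace_X cayley_points_def by blast
    then show "y \<in> \<Union>\<F>"
    proof cases
      case 1
      then have "v = u" using v(2) by (auto simp: cayley_vertex_def split: if_splits)
      then show ?thesis using 1 vn by (auto simp: \<F>_def)
    next
      case 2
      then have "v = u \<or> v = u'" using segment_coordinates(3)[OF 2(2), of v] v(2) by force
      then show ?thesis
        using 2 vn adjacent_sym[OF 2(1)] segment_commute[of u u'] by (auto simp: \<F>_def)
    qed
  qed
  ultimately show "\<exists>K. compactin (mtopology_of X) K \<and> {y \<in> mspace X. mdist X x y \<le> r} \<subseteq> K" by blast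
qed

sublocale proper_geodesic_space X
proof
  fix x y assume xy: "x \<in> mspace X" "y \<in> mspace X"
  show "\<exists>A. geodesic_segment X A x y"
  proof (rule length_space_geodesic[OF xy])
    fix \<epsilon> :: real assume "0 < \<epsilon>"
    then obtain r where r: "r < mdist X x y + \<epsilon>" "cayley_chain G S x y r" using ex_chain[OF xy, of "mdist X x y + \<epsilon>"] by auto
    then show "\<exists>p l. 0 \<le> l \<and> l < mdist X x y + \<epsilon> \<and> p 0 = x \<and> p l = y \<and> p ` {0..l} \<subseteq> mspace X \<and>
        (\<forall>s\<in>{0..l}. \<forall>t\<in>{0..l}. mdist X (p s) (p t) \<le> \<bar>s - t\<bar>)"
      using chain_path[OF r(2)] cayley_chain_nonneg[OF r(2)] by blast
  qed
qed

section \<open>Left multiplication as an isometry\<close>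

lemma act_segment:
  assumes g: "g \<in> carrier G" and uv: "u \<in> carrier G" "v \<in> carrier G" and y: "y \<in> cayley_segment u v"
  shows "act g y \<in> cayley_segment (g \<otimes>\<^bsub>G\<^esub> u) (g \<otimes>\<^bsub>G\<^esub> v)"
proof -
  obtain t where t: "y = (\<lambda>h. (1 - t) * cayley_vertex u h + t * cayley_vertex v h)" "0 \<le> t" "t \<le> 1"
    using y unfolding cayley_segment_def by blast
  have "act g y = (\<lambda>h. (1 - t) * act g (cayley_vertex u) h + t * act g (cayley_vertex v) h)"
    unfolding t(1) cayley_act_def by auto
  then have "act g y = (\<lambda>h. (1 - t) * cayley_vertex (g \<otimes>\<^bsub>G\<^esub> u) h + t * cayley_vertex (g \<otimes>\<^bsub>G\<^esub> v) h)"
    using cayley_act_vertex[OF is_group g] uv by simp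
  then show ?thesis unfolding cayley_segment_def using t by blast
qed

lemma act_adjacent:
  "g \<in> carrier G \<Longrightarrow> cayley_adjacent G S u v \<Longrightarrow> cayley_adjacent G S (g \<otimes>\<^bsub>G\<^esub> u) (g \<otimes>\<^bsub>G\<^esub> v)"
  using S_carrier unfolding cayley_adjacent_def by (auto simp: m_assoc subset_iff)

lemma act_mspace:
  assumes g: "g \<in> carrier G" and x: "x \<in> mspace X" shows "act g x \<in> mspace X"
proof -
  consider u where "u \<in> carrier G" "x = cayley_vertex u"
    | u v where "cayley_adjacent G S u v" "x \<in> cayley_segment u v"
    using x unfolding mspace_X cayley_points_def by blast
  then show ?thesis
  proof cases
    case 1
    then show ?thesis using g cayley_act_vertex[OF is_group g] vertex_points by simp
  next
    case 2
    then have "u \<in> carrier G" "v \<in> carrier G" by (auto simp: cayley_adjacent_def)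
    then show ?thesis using segment_points[OF act_adjacent[OF g 2(1)]] act_segment[OF g _ _ 2(2)] by blast
  qed
qed

lemma act_chain:
  assumes g: "g \<in> carrier G"
  shows "cayley_chain G S x y r \<Longrightarrow> cayley_chain G S (act g x) (act g y) r"
proof (induction rule: cayley_chain.induct)
  case (refl x)
  then show ?case using act_mspace[OF g, of x] by (intro cayley_chain.refl) (simp add: mspace_X)
next
  case (step x y r u v z)
  have uv: "u \<in> carrier G" "v \<in> carrier G" using step.hyps(2) by (auto simp: cayley_adjacent_def)
  have "act g w (g \<otimes>\<^bsub>G\<^esub> u) = w u" for w using g uv by (simp add: cayley_act_def m_assoc[symmetric])
  then show ?case
    using cayley_chain.step[OF step.IH act_adjacent[OF g step.hyps(2)] act_segment[OF g uv step.hyps(3)]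
        act_segment[OF g uv step.hyps(4)]] by simp
qed

lemma act_act: "g \<in> carrier G \<Longrightarrow> h \<in> carrier G \<Longrightarrow> act g (act h x) = act (g \<otimes>\<^bsub>G\<^esub> h) x"
  by (auto simp: cayley_act_def fun_eq_iff inv_mult_group m_assoc)

lemma act_one: "x \<in> mspace X \<Longrightarrow> act \<one>\<^bsub>G\<^esub> x = x"
  unfolding mspace_X cayley_points_def cayley_act_def cayley_segment_def cayley_vertex_def cayley_adjacent_def
  by (auto simp: fun_eq_iff)

lemma act_inv:
  assumes "g \<in> carrier G" "x \<in> mspace X"
  shows "act g (act (inv\<^bsub>G\<^esub> g) x) = x" "act (inv\<^bsub>G\<^esub> g) (act g x) = x"
  using assms by (simp_all add: act_act act_one)

text \<open>Chains go to chains of the same length, so no distance increases; applying this to the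
  inverse element as well gives equality.\<close>

lemma act_dist:
  assumes g: "g \<in> carrier G" and xy: "x \<in> mspace X" "y \<in> mspace X"
  shows "mdist X (act g x) (act g y) = mdist X x y"
proof -
  have le: "mdist X (act g x) (act g y) \<le> mdist X x y"
    if g: "g \<in> carrier G" and xy: "x \<in> mspace X" "y \<in> mspace X" for g x y
  proof (rule field_le_epsilon)
    fix \<epsilon> :: real assume "0 < \<epsilon>"
    then obtain r where "r < mdist X x y + \<epsilon>" "cayley_chain G S x y r" using ex_chain[OF xy, of "mdist X x y + \<epsilon>"] by auto
    then show "mdist X (act g x) (act g y) \<le> mdist X x y + \<epsilon>" using chain_dist[OF act_chain[OF g]] by force
  qed
  have "mdist X (act (inv\<^bsub>G\<^esub> g) (act g x)) (act (inv\<^bsub>G\<^esub> g) (act g y)) \<le> mdist X (act g x) (act g y)"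
    using g xy act_mspace by (intro le) auto
  then show ?thesis using le[OF g xy] act_inv[OF g] xy by simp
qed

end

section \<open>The action on the Morse boundary\<close>

context finitely_generated_group
begin

lemma act_isometric: "g \<in> carrier G \<Longrightarrow> isometric_on X I a \<Longrightarrow> isometric_on X I (act g \<circ> a)"
  using act_mspace act_dist unfolding isometric_on_def by (simp add: image_subset_iff)

lemma act_coarse_in:
  assumes "g \<in> carrier G" "A \<subseteq> mspace X" "B \<subseteq> mspace X" "coarse_in X r A B"
  shows "coarse_in X r (act g ` A) (act g ` B)"
  unfolding coarse_in_def
proof
  fix y assume "y \<in> act g ` A"
  then obtain x where x: "x \<in> A" "y = act g x" by blast
  obtain z where z: "z \<in> B" "mdist X x z \<le> r" using coarse_inD[OF assms(4) x(1)] by blast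
  have "mdist X (act g x) (act g z) = mdist X x z"
    using assms(2,3) x z by (intro act_dist[OF assms(1)]) auto
  then show "\<exists>z\<in>act g ` B. mdist X y z \<le> r" using x z by (intro bexI[of _ "act g z"]) auto
qed

lemma act_coarsely_equal:
  "g \<in> carrier G \<Longrightarrow> A \<subseteq> mspace X \<Longrightarrow> B \<subseteq> mspace X \<Longrightarrow> coarsely_equal X A B \<Longrightarrow>
    coarsely_equal X (act g ` A) (act g ` B)"
  using act_coarse_in unfolding coarsely_equal_def by blast

text \<open>A quasi-geodesic is pulled back by the inverse isometry, which keeps its constants. The
  gauge is therefore the same for all translates of a ray.\<close>

lemma act_morse_set:
  assumes g: "g \<in> carrier G" and A: "morse_set X N A"
  shows "morse_set X N (act g ` A)"
proof -
  have AM: "A \<subseteq> mspace X" using morse_set_mspace[OF A] .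
  have gi: "inv\<^bsub>G\<^esub> g \<in> carrier G" using g by simp
  have "coarse_in X (N q Q) (\<eta> ` {i..j}) (subsegment X (act g ` A) (\<eta> i) (\<eta> j))"
    if h: "\<eta> i \<in> act g ` A" "\<eta> j \<in> act g ` A" "1 \<le> q" "0 \<le> Q" "i \<le> j"
      "quasi_geodesic X q Q {i..j} \<eta>" for q Q i j \<eta>
  proof -
    define \<zeta> where "\<zeta> = act (inv\<^bsub>G\<^esub> g) \<circ> \<eta>"
    have \<eta>M: "\<eta> ` {i..j} \<subseteq> mspace X" using h(6) by (simp add: quasi_geodesic_def)
    obtain u v where uv: "u \<in> A" "v \<in> A" "\<eta> i = act g u" "\<eta> j = act g v" using h by blast
    then have e: "\<zeta> i = u" "\<zeta> j = v" using act_inv[OF g] AM by (auto simp: \<zeta>_def)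
    have qg: "quasi_geodesic X q Q {i..j} \<zeta>"
      using h(6) \<eta>M act_mspace[OF gi] act_dist[OF gi] unfolding quasi_geodesic_def \<zeta>_def by (auto simp: image_subset_iff)
    have c: "coarse_in X (N q Q) (\<zeta> ` {i..j}) (subsegment X A u v)"
      using morse_setD[OF A h(3-5) qg] e uv by simp
    have sub: "subsegment X A u v \<subseteq> mspace X" using AM subsegment_subset[of X A u v] by blast
    have "\<zeta> ` {i..j} \<subseteq> mspace X" using qg by (simp add: quasi_geodesic_def)
    then have "coarse_in X (N q Q) (act g ` \<zeta> ` {i..j}) (act g ` subsegment X A u v)"
      using act_coarse_in[OF g _ sub c] by blast
    moreover have "act g ` \<zeta> ` {i..j} = \<eta> ` {i..j}"
      unfolding image_image using act_inv(1)[OF g] \<eta>M by (intro image_cong) (auto simp: \<zeta>_def image_subset_iff)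
    moreover have "act g ` subsegment X A u v \<subseteq> subsegment X (act g ` A) (\<eta> i) (\<eta> j)"
      using uv AM act_dist[OF g] by (auto simp: subsegment_def subset_iff)
    ultimately show ?thesis using coarse_in_mono[OF _ order_refl subset_refl] by metis
  qed
  moreover have "act g ` A \<subseteq> mspace X" using AM act_mspace[OF g] by auto
  ultimately show ?thesis unfolding morse_set_def by blast
qed

lemma act_morse_ray:
  assumes "g \<in> carrier G" "morse_ray X a" shows "morse_ray X (act g \<circ> a)"
  using assms act_isometric act_morse_set[OF assms(1)] unfolding morse_ray_iff image_comp[symmetric] by blast

text \<open>A segment from \<open>a 0\<close> to \<open>e\<close> is bounded, hence Morse by
  \<open>morse_set_bounded\<close>, and \<open>change_base\<close> applies. Translated rays start
  away from \<open>e\<close>; this gives them representatives on which the action can be applied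
  again.\<close>

lemma ray_class_rebase:
  assumes e: "e \<in> mspace X" and a: "morse_ray X a"
  obtains b where "morse_ray X b" "b 0 = e" "coarsely_equal X (b ` {0..}) (a ` {0..})"
    "ray_class X e b = ray_class X e a"
proof -
  have iso: "isometric_on X {0..} a" using a by (rule morse_ray_isometric)
  obtain N where N: "morse_set X N (a ` {0..})" using a morse_ray_iff by blast
  have "a 0 \<in> mspace X" using isometric_onD(1)[OF iso] by simp
  then obtain A where A: "geodesic_segment X A (a 0) e" using geodesic e by blast
  define N2 where "N2 \<equiv> \<lambda>q Q. max (N q Q) (q * (q * (mdist X (a 0) e + Q)) + Q)"
  have "morse_set X (\<lambda>q Q. q * (q * (mdist X (a 0) e + Q)) + Q) A"
    using geodesic_segmentD(1)[OF A] geodesic_segment_within(2)[OF A] by (rule morse_set_bounded)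
  then have AN: "morse_set X N2 A" by (rule morse_set_mono) (simp add: N2_def)
  have "morse_set X N2 (a ` {0..})" using N by (rule morse_set_mono) (simp add: N2_def)
  then obtain N' b where b: "isometric_on X {0..} b" "b 0 = e" "morse_set X N' (b ` {0..})"
    "coarsely_equal X (b ` {0..}) (a ` {0..})"
    using change_base[of N2] iso A AN by metis
  then show thesis
    using that[of b] ray_class_cong[OF b(4)] ray_mspace[OF iso] ray_mspace[OF b(1)] by (auto simp: morse_ray_iff)
qed

section \<open>The action on classes of rays\<close>

context
  fixes e assumes e: "e \<in> mspace X"
begin

abbreviation bact where "bact \<equiv> boundary_act G S e"
abbreviation rc where "rc \<equiv> ray_class X e"

lemma boundary_act_ray_class:
  assumes g: "g \<in> carrier G" and a: "morse_ray X a" "a 0 = e"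
  shows "bact g (rc a) = rc (act g \<circ> a)"
proof -
  have aM: "a ` {0..} \<subseteq> mspace X" using ray_mspace[OF morse_ray_isometric[OF a(1)]] .
  have "rc (act g \<circ> b) = rc (act g \<circ> a)" if "b \<in> rc a" for b
  proof -
    have b: "morse_ray X b" "coarsely_equal X (b ` {0..}) (a ` {0..})" using that ray_class_altdef[OF aM] by auto
    have bM: "b ` {0..} \<subseteq> mspace X" using ray_mspace[OF morse_ray_isometric[OF b(1)]] .
    have "coarsely_equal X ((act g \<circ> b) ` {0..}) ((act g \<circ> a) ` {0..})"
      using act_coarsely_equal[OF g bM aM b(2)] by (simp add: image_comp)
    then show ?thesis
      using ray_class_cong ray_mspace[OF act_isometric[OF g morse_ray_isometric]] a(1) b(1) by metis
  qed
  moreover have "a \<in> rc a" using ray_class_self[OF a] .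
  ultimately show ?thesis unfolding boundary_act_def by blast
qed

text \<open>\<open>boundary_act_ray_class\<close> speaks of rays from \<open>e\<close>, but
  \<open>act h \<circ> a\<close> may start elsewhere; a representative \<open>b\<close> from
  \<open>e\<close> takes its place before \<open>g\<close> is applied.\<close>

lemma boundary_act_act:
  assumes g: "g \<in> carrier G" and h: "h \<in> carrier G" and \<xi>: "\<xi> \<in> morse_boundary_points X e"
  shows "bact g (bact h \<xi>) = bact (g \<otimes>\<^bsub>G\<^esub> h) \<xi>"
proof -
  obtain a where a: "morse_ray X a" "a 0 = e" "\<xi> = rc a" using \<xi> by (auto simp: morse_boundary_points_eq)
  obtain b where b: "morse_ray X b" "b 0 = e" "coarsely_equal X (b ` {0..}) ((act h \<circ> a) ` {0..})"
    "rc b = rc (act h \<circ> a)"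
    using ray_class_rebase[OF e act_morse_ray[OF h a(1)]] by blast
  have M: "b ` {0..} \<subseteq> mspace X" "(act h \<circ> a) ` {0..} \<subseteq> mspace X"
    using ray_mspace[OF morse_ray_isometric] b(1) act_morse_ray[OF h a(1)] by blast+
  have comp: "act g \<circ> (act h \<circ> a) = act (g \<otimes>\<^bsub>G\<^esub> h) \<circ> a" using act_act[OF g h] by auto
  have "coarsely_equal X ((act g \<circ> b) ` {0..}) ((act g \<circ> (act h \<circ> a)) ` {0..})"
    using act_coarsely_equal[OF g M b(3)] by (simp add: image_comp)
  then have "rc (act g \<circ> b) = rc (act g \<circ> (act h \<circ> a))"
    using ray_class_cong ray_mspace[OF act_isometric[OF g morse_ray_isometric]] b(1) act_morse_ray[OF h a(1)] by metis
  then show ?thesis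
    using boundary_act_ray_class[OF h a(1,2)] boundary_act_ray_class[OF g b(1,2)]
      boundary_act_ray_class[OF _ a(1,2), of "g \<otimes>\<^bsub>G\<^esub> h"] g h b(4) a(3) comp by simp
qed

lemma boundary_act_one:
  assumes "\<xi> \<in> morse_boundary_points X e" shows "bact \<one>\<^bsub>G\<^esub> \<xi> = \<xi>"
proof -
  obtain a where a: "morse_ray X a" "a 0 = e" "\<xi> = rc a" using assms by (auto simp: morse_boundary_points_eq)
  have aM: "a ` {0..} \<subseteq> mspace X" using ray_mspace[OF morse_ray_isometric[OF a(1)]] .
  have "(act \<one>\<^bsub>G\<^esub> \<circ> a) ` {0..} = a ` {0..}" using act_one aM by (intro image_cong) auto
  then have "rc (act \<one>\<^bsub>G\<^esub> \<circ> a) = rc a" by (simp add: ray_class_def)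
  then show ?thesis using boundary_act_ray_class[OF one_closed a(1,2)] a(3) by simp
qed

lemma boundary_act_image:
  assumes "C \<subseteq> morse_boundary_points X e"
  shows "g \<in> carrier G \<Longrightarrow> h \<in> carrier G \<Longrightarrow> bact g ` bact h ` C = bact (g \<otimes>\<^bsub>G\<^esub> h) ` C"
    and "bact \<one>\<^bsub>G\<^esub> ` C = C"
proof -
  show "bact g ` bact h ` C = bact (g \<otimes>\<^bsub>G\<^esub> h) ` C" if "g \<in> carrier G" "h \<in> carrier G"
    unfolding image_image using boundary_act_act that assms by (intro image_cong) auto
  have "bact \<one>\<^bsub>G\<^esub> ` C = id ` C" using boundary_act_one assms by (intro image_cong) auto
  then show "bact \<one>\<^bsub>G\<^esub> ` C = C" by simp
qed

lemma act_ray: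
  assumes g: "g \<in> carrier G" and a: "isometric_on X {0..} a" "morse_set X N (a ` {0..})"
  shows "isometric_on X {0..} (act g \<circ> a)" "morse_set X N ((act g \<circ> a) ` {0..})"
  using act_isometric[OF g a(1)] act_morse_set[OF g a(2)] by (simp_all add: image_comp)

section \<open>The two inclusions of the theorem\<close>

lemma two_points:
  assumes C: "C \<subseteq> morse_boundary_points X e" "\<not> is_singleton C" "\<xi> \<in> C"
  obtains a b N where "morse_ray X a" "a 0 = e" "\<xi> = rc a" "morse_set X N (a ` {0..})"
    "morse_ray X b" "b 0 = e" "rc b \<in> C" "morse_set X N (b ` {0..})"
    "\<not> coarsely_equal X (a ` {0..}) (b ` {0..})"
proof -
  obtain \<eta> where \<eta>: "\<eta> \<in> C" "\<eta> \<noteq> \<xi>" using C(2,3) unfolding is_singleton_def by blast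
  obtain a where a: "morse_ray X a" "a 0 = e" "\<xi> = rc a" using C by (auto simp: morse_boundary_points_eq)
  obtain b where b: "morse_ray X b" "b 0 = e" "\<eta> = rc b" using C \<eta> by (auto simp: morse_boundary_points_eq)
  obtain N1 N2 where N: "morse_set X N1 (a ` {0..})" "morse_set X N2 (b ` {0..})" using a b morse_ray_iff by blast
  let ?N = "\<lambda>q Q. max (N1 q Q) (N2 q Q)"
  have "morse_set X ?N (a ` {0..})" "morse_set X ?N (b ` {0..})"
    using morse_set_mono[OF N(1)] morse_set_mono[OF N(2)] by auto
  moreover have "\<not> coarsely_equal X (a ` {0..}) (b ` {0..})"
    using ray_class_eq_iff[OF a(1,2)] ray_mspace[OF morse_ray_isometric[OF b(1)]] a(3) b(3) \<eta>(2) by metis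
  ultimately show thesis using that[of a ?N b] a b \<eta> by blast
qed

lemma relative_boundary_subset:
  assumes C: "C \<subseteq> morse_boundary_points X e" "\<not> is_singleton C" "C \<noteq> {}"
    and closed: "closedin (morse_boundary X e) C"
    and H: "H \<subseteq> carrier G" "\<And>h. h \<in> H \<Longrightarrow> bact h ` C = C"
  shows "relative_morse_boundary X e (cayley_vertex ` H) \<subseteq> C"
proof
  fix \<zeta> assume "\<zeta> \<in> relative_morse_boundary X e (cayley_vertex ` H)"
  then obtain \<gamma>' k where \<gamma>': "morse_ray X \<gamma>'" "\<zeta> = rc \<gamma>'" "\<gamma>' ` {0..} \<subseteq> closed_nbhd X k (cayley_vertex ` H)"
    unfolding relative_morse_boundary_def by blast
  obtain \<gamma> where \<gamma>: "morse_ray X \<gamma>" "\<gamma> 0 = e" "coarsely_equal X (\<gamma> ` {0..}) (\<gamma>' ` {0..})" "\<zeta> = rc \<gamma>"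
    using ray_class_rebase[OF e \<gamma>'(1)] \<gamma>'(2) by metis
  have M: "\<gamma> ` {0..} \<subseteq> mspace X" "\<gamma>' ` {0..} \<subseteq> mspace X" "cayley_vertex ` H \<subseteq> mspace X"
    using ray_mspace[OF morse_ray_isometric] \<gamma>(1) \<gamma>'(1) vertex_points H(1) by blast+
  obtain r where r: "coarse_in X r (\<gamma> ` {0..}) (cayley_vertex ` H)"
  proof -
    obtain r1 where r1: "coarse_in X r1 (\<gamma>' ` {0..}) (cayley_vertex ` H)"
      using subset_closed_nbhd_iff[OF M(2)] \<gamma>'(3) by blast
    obtain r2 where r2: "coarse_in X r2 (\<gamma> ` {0..}) (\<gamma>' ` {0..})" using \<gamma>(3) unfolding coarsely_equal_def by blast
    show thesis using that coarse_in_trans[OF r2 r1 M] .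
  qed
  obtain \<xi> where "\<xi> \<in> C" using C by blast
  obtain \<alpha> \<beta> N1 where \<alpha>: "morse_ray X \<alpha>" "\<alpha> 0 = e" "rc \<alpha> \<in> C" "morse_set X N1 (\<alpha> ` {0..})"
    and \<beta>: "morse_ray X \<beta>" "\<beta> 0 = e" "rc \<beta> \<in> C" "morse_set X N1 (\<beta> ` {0..})"
    and ne: "\<not> coarsely_equal X (\<alpha> ` {0..}) (\<beta> ` {0..})"
    using two_points[OF C(1,2) \<open>\<xi> \<in> C\<close>] \<open>\<xi> \<in> C\<close> by metis
  obtain N0 where N0: "morse_set X N0 (\<gamma> ` {0..})" using \<gamma>(1) morse_ray_iff by blast
  define N where "N \<equiv> \<lambda>q Q. max (N1 q Q) (N0 q Q)"
  have up: "morse_set X N (\<alpha> ` {0..})" "morse_set X N (\<beta> ` {0..})" "morse_set X N (\<gamma> ` {0..})"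
    using morse_set_mono[OF \<alpha>(4)] morse_set_mono[OF \<beta>(4)] morse_set_mono[OF N0] by (auto simp: N_def)
  have iso: "isometric_on X {0..} \<alpha>" "isometric_on X {0..} \<beta>" "isometric_on X {0..} \<gamma>"
    using \<alpha> \<beta> \<gamma> by (auto intro: morse_ray_isometric)
  define o1 where "o1 = cayley_vertex \<one>\<^bsub>G\<^esub>"
  have o1: "o1 \<in> mspace X" unfolding o1_def by (simp add: vertex_points)
  \<comment> \<open>\<open>r\<close> leads from \<open>\<gamma> (real n)\<close> to the vertex
    \<open>h n\<close>; the other summand leads from there to the translate of \<open>e\<close>,
    which may lie inside an edge.\<close>
  define \<kappa> where "\<kappa> = r + mdist X o1 e"
  have "\<exists>h\<in>H. mdist X (\<gamma> (real n)) (cayley_vertex h) \<le> r" for n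
    using coarse_inD[OF r, of "\<gamma> (real n)"] by auto
  then obtain h where h: "\<And>n. h n \<in> H" "\<And>n. mdist X (\<gamma> (real n)) (cayley_vertex (h n)) \<le> r" by metis
  have hG: "h n \<in> carrier G" for n using h(1) H(1) by blast
  have near: "mdist X (act (h n) e) (\<gamma> (real n)) \<le> \<kappa>" for n
  proof -
    have "act (h n) o1 = cayley_vertex (h n)"
      unfolding o1_def using cayley_act_vertex[OF is_group hG one_closed] hG by simp
    then have "mdist X (act (h n) e) (cayley_vertex (h n)) = mdist X o1 e"
      using act_dist[OF hG e o1, of n] by (simp add: mdist_commute)
    moreover have "mdist X (act (h n) e) (\<gamma> (real n)) \<le>
        mdist X (act (h n) e) (cayley_vertex (h n)) + mdist X (cayley_vertex (h n)) (\<gamma> (real n))"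
      using act_mspace[OF hG e] vertex_points[OF hG] isometric_onD(1)[OF iso(3)] by (intro mdist_triangle) auto
    ultimately show ?thesis using h(2)[of n] by (simp add: \<kappa>_def mdist_commute)
  qed
  obtain N' K D where D: "\<And>T \<gamma> t0 p \<alpha> \<beta>. isometric_on X {0..} \<gamma> \<Longrightarrow> morse_set X N (\<gamma> ` {0..}) \<Longrightarrow> 0 \<le> t0 \<Longrightarrow> mdist X p (\<gamma> t0) \<le> \<kappa> \<Longrightarrow>
       isometric_on X {0..} \<alpha> \<Longrightarrow> morse_set X N (\<alpha> ` {0..}) \<Longrightarrow> \<alpha> 0 = p \<Longrightarrow>
       isometric_on X {0..} \<beta> \<Longrightarrow> morse_set X N (\<beta> ` {0..}) \<Longrightarrow> \<beta> 0 = p \<Longrightarrow>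
       (\<forall>s\<ge>T. \<forall>s'\<ge>0. K < mdist X (\<alpha> s) (\<beta> s')) \<Longrightarrow>
       \<exists>a. isometric_on X {0..} a \<and> a 0 = \<gamma> 0 \<and> morse_set X N' (a ` {0..}) \<and>
         (coarsely_equal X (a ` {0..}) (\<alpha> ` {0..}) \<or> coarsely_equal X (a ` {0..}) (\<beta> ` {0..})) \<and>
         (\<forall>t. 0 \<le> t \<and> t \<le> t0 \<longrightarrow> mdist X (a t) (\<gamma> t) \<le> D T)"
    by (rule ray_through[of N \<kappa>]) blast
  have \<alpha>\<beta>0: "\<alpha> 0 = \<beta> 0" using \<alpha>(2) \<beta>(2) by simp
  obtain T where T: "0 \<le> T" "\<forall>s\<ge>T. \<forall>s'\<ge>0. K < mdist X (\<alpha> s) (\<beta> s')"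
    using rays_diverge[OF iso(1) up(1) iso(2) up(2) \<alpha>\<beta>0 ne, of K] by blast
  have "\<exists>a. isometric_on X {0..} a \<and> a 0 = e \<and> morse_set X N' (a ` {0..}) \<and> rc a \<in> C \<and>
         (\<forall>t. 0 \<le> t \<and> t \<le> real n \<longrightarrow> mdist X (a t) (\<gamma> t) \<le> D T)" for n
  proof -
    \<comment> \<open>One \<open>T\<close> serves all \<open>n\<close>: since \<open>h n\<close>
      acts isometrically, the translated rays diverge at the same time as \<open>\<alpha>\<close>
      and \<open>\<beta>\<close>. Hence \<open>D T\<close> bounds the whole sequence.\<close>
    have far: "\<forall>s\<ge>T. \<forall>s'\<ge>0. K < mdist X ((act (h n) \<circ> \<alpha>) s) ((act (h n) \<circ> \<beta>) s')"
      using T isometric_onD(1)[OF iso(1)] isometric_onD(1)[OF iso(2)] by (simp add: act_dist[OF hG])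
    obtain a where a: "isometric_on X {0..} a" "a 0 = \<gamma> 0" "morse_set X N' (a ` {0..})"
      "coarsely_equal X (a ` {0..}) ((act (h n) \<circ> \<alpha>) ` {0..}) \<or> coarsely_equal X (a ` {0..}) ((act (h n) \<circ> \<beta>) ` {0..})"
      "\<forall>t. 0 \<le> t \<and> t \<le> real n \<longrightarrow> mdist X (a t) (\<gamma> t) \<le> D T"
      using D[OF iso(3) up(3) of_nat_0_le_iff near act_ray[OF hG iso(1) up(1)] _ act_ray[OF hG iso(2) up(2)] _ far]
        \<alpha>(2) \<beta>(2) by auto
    have in_C: "rc (act (h n) \<circ> b) \<in> C" if b: "morse_ray X b" "b 0 = e" "rc b \<in> C" for b
    proof -
      have "bact (h n) (rc b) \<in> C" using H(2)[OF h(1)[of n]] b(3) by blast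
      then show ?thesis using boundary_act_ray_class[OF hG b(1,2)] by simp
    qed
    have cong: "rc a = rc b" if "coarsely_equal X (a ` {0..}) (b ` {0..})" "isometric_on X {0..} b" for b
      using ray_class_cong[OF that(1)] ray_mspace a(1) that(2) by blast
    have "rc a \<in> C"
      using a(4) cong act_ray(1)[OF hG iso(1) up(1)] act_ray(1)[OF hG iso(2) up(2)]
        in_C[OF \<alpha>(1-3)] in_C[OF \<beta>(1-3)] by metis
    then show ?thesis using a \<gamma>(2) by auto
  qed
  then obtain a where a: "\<And>n. isometric_on X {0..} (a n)" "\<And>n. a n 0 = e" "\<And>n. morse_set X N' (a n ` {0..})"
    "\<And>n. rc (a n) \<in> C" "\<And>n t. 0 \<le> t \<Longrightarrow> t \<le> real n \<Longrightarrow> mdist X (a n t) (\<gamma> t) \<le> D T" by metis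
  define N2 where "N2 \<equiv> \<lambda>q Q. max (N q Q) (N' q Q)"
  have N2: "morse_set X N2 (\<gamma> ` {0..})" "\<And>n. morse_set X N2 (a n ` {0..})"
    using morse_set_mono[OF up(3)] morse_set_mono[OF a(3)] by (auto simp: N2_def)
  have "limitin (morse_boundary X e) (\<lambda>n. rc (a n)) (rc \<gamma>) sequentially"
    by (rule limitin_morse_boundary[where a = a, OF iso(3) N2(1) \<gamma>(2) a(1) N2(2) a(2) a(5)])
  then have "rc \<gamma> \<in> C" by (rule limitin_closedin[OF _ closed]) (simp_all add: a(4))
  then show "\<zeta> \<in> C" using \<gamma>(4) by simp
qed

text \<open>The next index is taken beyond the thresholds \<open>f m\<close> of all indices
  \<open>m\<close> up to the present one, so its value is new; finitely many thresholds have a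
  maximum.\<close>

lemma ex_inj_subsequence:
  fixes A :: "nat \<Rightarrow> 'c"
  assumes "\<And>m. \<exists>n0. \<forall>n\<ge>n0. A n \<noteq> A m"
  obtains r :: "nat \<Rightarrow> nat" where "strict_mono r" "inj (A \<circ> r)"
proof -
  obtain f where f: "\<And>m n. f m \<le> n \<Longrightarrow> A n \<noteq> A m" using assms by metis
  have "\<exists>r. \<forall>k. True \<and> (r k < r (Suc k) \<and> (\<forall>m\<le>r k. A (r (Suc k)) \<noteq> A m))"
  proof (rule dependent_nat_choice)
    fix x k :: nat
    let ?y = "Suc x + Max (f ` {..x})"
    have "f m \<le> ?y" if "m \<le> x" for m using that by (intro trans_le_add2 Max_ge) auto
    then show "\<exists>y. True \<and> (x < y \<and> (\<forall>m\<le>x. A y \<noteq> A m))" using f by (intro exI[of _ ?y]) simp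
  qed simp
  then obtain r where r: "\<And>k. r k < r (Suc k)" "\<And>k m. m \<le> r k \<Longrightarrow> A (r (Suc k)) \<noteq> A m" by blast
  have mono: "strict_mono r" using r(1) by (simp add: strict_mono_Suc_iff)
  have ne: "A (r j) \<noteq> A (r i)" if "i < j" for i j
  proof -
    have "j = Suc (j - 1)" "r i \<le> r (j - 1)" using that mono by (auto simp: strict_mono_less_eq)
    then show ?thesis using r(2) by metis
  qed
  have "inj (A \<circ> r)"
  proof (rule injI)
    fix i j assume "(A \<circ> r) i = (A \<circ> r) j"
    then show "i = j" using ne[of i j] ne[of j i] by (cases i j rule: linorder_cases) auto
  qed
  then show thesis using that mono by blast
qed

lemma subset_relative_boundary:
  assumes C: "C \<subseteq> morse_boundary_points X e" "\<not> is_singleton C"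
    and conv: "point_convergent (morse_boundary X e) (boundary_orbit G S e C)"
  shows "C \<subseteq> relative_morse_boundary X e (cayley_vertex ` boundary_stabiliser G S e C)"
proof
  define H where "H = boundary_stabiliser G S e C"
  have H: "h \<in> H \<longleftrightarrow> h \<in> carrier G \<and> bact h ` C = C" for h by (auto simp: H_def boundary_stabiliser_def)
  define o1 where "o1 = cayley_vertex \<one>\<^bsub>G\<^esub>"
  have o1: "o1 \<in> mspace X" unfolding o1_def by (simp add: vertex_points)
  have act_o1: "act g o1 = cayley_vertex g" if "g \<in> carrier G" for g
    unfolding o1_def using cayley_act_vertex[OF is_group that one_closed] that by simp
  fix \<xi> assume \<xi>: "\<xi> \<in> C"
  obtain \<alpha> \<beta> N where \<alpha>: "morse_ray X \<alpha>" "\<alpha> 0 = e" "\<xi> = rc \<alpha>" "morse_set X N (\<alpha> ` {0..})"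
    and \<beta>: "morse_ray X \<beta>" "\<beta> 0 = e" "rc \<beta> \<in> C" "morse_set X N (\<beta> ` {0..})"
    and ne: "\<not> coarsely_equal X (\<alpha> ` {0..}) (\<beta> ` {0..})"
    using two_points[OF C \<xi>] by metis
  have iso: "isometric_on X {0..} \<alpha>" "isometric_on X {0..} \<beta>"
    using \<alpha>(1) \<beta>(1) by (auto intro: morse_ray_isometric)
  have \<alpha>M: "\<alpha> t \<in> mspace X" if "0 \<le> t" for t using isometric_onD(1)[OF iso(1)] that by simp
  have "\<exists>r. coarse_in X r (\<alpha> ` {0..}) (cayley_vertex ` H)"
  proof (rule ccontr)
    assume far: "\<not> ?thesis"
    have "\<exists>t\<ge>0. \<forall>h\<in>H. real n < mdist X (\<alpha> t) (cayley_vertex h)" for n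
    proof -
      have "\<not> coarse_in X (real n) (\<alpha> ` {0..}) (cayley_vertex ` H)" using far by blast
      then show ?thesis by (force simp: coarse_in_def not_le)
    qed
    then obtain t where t: "\<And>n. 0 \<le> t n" "\<And>n h. h \<in> H \<Longrightarrow> real n < mdist X (\<alpha> (t n)) (cayley_vertex h)" by metis
    have "\<exists>g\<in>carrier G. mdist X (\<alpha> (t n)) (cayley_vertex g) \<le> 1" for n
      using near_vertex[OF \<alpha>M[OF t(1)], of n] by blast
    then obtain g where g: "\<And>n. g n \<in> carrier G" "\<And>n. mdist X (\<alpha> (t n)) (cayley_vertex (g n)) \<le> 1" by metis
    have gi: "inv\<^bsub>G\<^esub> (g n) \<in> carrier G" for n using g(1) by simp
    have gM: "cayley_vertex (g n) \<in> mspace X" for n using g(1) vertex_points by blast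
    define A where "A \<equiv> \<lambda>n. bact (inv\<^bsub>G\<^esub> (g n)) ` C"
    \<comment> \<open>Equal translates would put \<open>g n\<close> times the inverse of
      \<open>g m\<close> into \<open>H\<close>. That element is as far from \<open>g n\<close> as
      \<open>g m\<close> is from the identity, a bound free of \<open>n\<close>, while the points
      \<open>\<alpha> (t n)\<close> move away from \<open>H\<close>.\<close>
    have "A n \<noteq> A m" if n: "1 + mdist X o1 (cayley_vertex (g m)) \<le> real n" for m n
    proof
      assume eq: "A n = A m"
      define h where "h = g n \<otimes>\<^bsub>G\<^esub> inv\<^bsub>G\<^esub> (g m)"
      have hG: "h \<in> carrier G" unfolding h_def using g(1) by simp
      have "bact h ` C = bact (g n) ` A m"
        unfolding h_def A_def by (rule boundary_act_image(1)[OF C(1) g(1) gi, symmetric])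
      also have "\<dots> = bact (g n) ` A n" using eq by simp
      also have "\<dots> = C"
        unfolding A_def boundary_act_image(1)[OF C(1) g(1) gi] using boundary_act_image(2)[OF C(1)] g(1) by simp
      finally have "h \<in> H" using H hG by simp
      have "h \<otimes>\<^bsub>G\<^esub> g m = g n" unfolding h_def using g(1) by (simp add: m_assoc)
      then have "act h (cayley_vertex (g m)) = cayley_vertex (g n)"
        using cayley_act_vertex[OF is_group hG g(1)] by simp
      then have "mdist X (cayley_vertex (g n)) (cayley_vertex h) = mdist X (cayley_vertex (g m)) o1"
        using act_dist[OF hG gM o1, of m] act_o1[OF hG] by simp
      moreover have "mdist X (\<alpha> (t n)) (cayley_vertex h) \<le>
          mdist X (\<alpha> (t n)) (cayley_vertex (g n)) + mdist X (cayley_vertex (g n)) (cayley_vertex h)"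
        using \<alpha>M t(1) gM vertex_points[OF hG] by (intro mdist_triangle) auto
      ultimately show False
        using t(2)[OF \<open>h \<in> H\<close>, of n] g(2)[of n] n by (simp add: mdist_commute)
    qed
    then have "\<exists>n0. \<forall>n\<ge>n0. A n \<noteq> A m" for m
      by (intro exI[of _ "nat \<lceil>1 + mdist X o1 (cayley_vertex (g m))\<rceil>"]) (auto simp: nat_le_iff ceiling_le_iff)
    then obtain r0 :: "nat \<Rightarrow> nat" where r0: "strict_mono r0" "inj (A \<circ> r0)"
      using ex_inj_subsequence by blast
    define \<kappa> where "\<kappa> = 1 + mdist X o1 e"
    \<comment> \<open>Rays from these translates of \<open>e\<close> are carried to rays from
      \<open>e\<close> itself by the inverses of \<open>g n\<close>, and there they can be
      compared.\<close>
    define x where "x \<equiv> \<lambda>n. act (g n) e"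
    have xM: "x n \<in> mspace X" for n unfolding x_def using act_mspace[OF g(1) e] .
    have x: "mdist X (x n) (\<alpha> (t n)) \<le> \<kappa>" for n
    proof -
      have "mdist X (x n) (cayley_vertex (g n)) = mdist X e o1"
        using act_dist[OF g(1) e o1, of n] act_o1[OF g(1)] by (simp add: x_def)
      moreover have "mdist X (x n) (\<alpha> (t n)) \<le> mdist X (x n) (cayley_vertex (g n)) + mdist X (cayley_vertex (g n)) (\<alpha> (t n))"
        using xM gM \<alpha>M t(1) by (intro mdist_triangle) auto
      ultimately show ?thesis using g(2)[of n] by (simp add: \<kappa>_def mdist_commute)
    qed
    have ab0: "\<alpha> 0 = \<beta> 0" using \<alpha>(2) \<beta>(2) by simp
    obtain N' D T0 where two: "\<And>t0 x. 0 \<le> t0 \<Longrightarrow> x \<in> mspace X \<Longrightarrow> mdist X x (\<alpha> t0) \<le> \<kappa> \<Longrightarrow>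
       \<exists>a b. isometric_on X {0..} a \<and> a 0 = x \<and> morse_set X N' (a ` {0..}) \<and> coarsely_equal X (a ` {0..}) (\<alpha> ` {0..}) \<and>
         isometric_on X {0..} b \<and> b 0 = x \<and> morse_set X N' (b ` {0..}) \<and> coarsely_equal X (b ` {0..}) (\<beta> ` {0..}) \<and>
         (\<forall>\<tau>. 0 \<le> \<tau> \<and> \<tau> + T0 \<le> t0 \<longrightarrow> 2 * \<tau> - D \<le> mdist X (a \<tau>) (b \<tau>))"
      by (rule two_rays[OF iso(1) \<alpha>(4) iso(2) \<beta>(4) ab0 ne, of \<kappa>]) blast
    have "\<forall>n. \<exists>a b. isometric_on X {0..} a \<and> a 0 = x n \<and> morse_set X N' (a ` {0..}) \<and> coarsely_equal X (a ` {0..}) (\<alpha> ` {0..}) \<and>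
         isometric_on X {0..} b \<and> b 0 = x n \<and> morse_set X N' (b ` {0..}) \<and> coarsely_equal X (b ` {0..}) (\<beta> ` {0..}) \<and>
         (\<forall>\<tau>. 0 \<le> \<tau> \<and> \<tau> + T0 \<le> t n \<longrightarrow> 2 * \<tau> - D \<le> mdist X (a \<tau>) (b \<tau>))"
      using two[OF t(1) xM x] by blast
    then obtain a b where a: "\<And>n. isometric_on X {0..} (a n)" "\<And>n. a n 0 = x n" "\<And>n. morse_set X N' (a n ` {0..})"
      "\<And>n. coarsely_equal X (a n ` {0..}) (\<alpha> ` {0..})"
      and b: "\<And>n. isometric_on X {0..} (b n)" "\<And>n. b n 0 = x n" "\<And>n. morse_set X N' (b n ` {0..})"
      "\<And>n. coarsely_equal X (b n ` {0..}) (\<beta> ` {0..})"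
      and apart: "\<And>n \<tau>. 0 \<le> \<tau> \<Longrightarrow> \<tau> + T0 \<le> t n \<Longrightarrow> 2 * \<tau> - D \<le> mdist X (a n \<tau>) (b n \<tau>)" by metis
    define a' where "a' \<equiv> \<lambda>n. act (inv\<^bsub>G\<^esub> (g n)) \<circ> a n"
    define b' where "b' \<equiv> \<lambda>n. act (inv\<^bsub>G\<^esub> (g n)) \<circ> b n"
    have x_to_e: "act (inv\<^bsub>G\<^esub> (g n)) (x n) = e" for n unfolding x_def using act_inv(2)[OF g(1) e] .
    have a': "isometric_on X {0..} (a' n)" "morse_set X N' (a' n ` {0..})" "a' n 0 = e" for n
      unfolding a'_def using act_ray[OF gi a(1,3)] a(2) x_to_e by auto
    have b': "isometric_on X {0..} (b' n)" "morse_set X N' (b' n ` {0..})" "b' n 0 = e" for n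
      unfolding b'_def using act_ray[OF gi b(1,3)] b(2) x_to_e by auto
    have class_in: "rc (act (inv\<^bsub>G\<^esub> (g n)) \<circ> c) \<in> A n"
      if c: "isometric_on X {0..} c" "coarsely_equal X (c ` {0..}) (\<gamma> ` {0..})"
        and \<gamma>: "morse_ray X \<gamma>" "\<gamma> 0 = e" "rc \<gamma> \<in> C" for n c \<gamma>
    proof -
      have M: "c ` {0..} \<subseteq> mspace X" "\<gamma> ` {0..} \<subseteq> mspace X"
        using ray_mspace c(1) morse_ray_isometric[OF \<gamma>(1)] by blast+
      have "coarsely_equal X ((act (inv\<^bsub>G\<^esub> (g n)) \<circ> c) ` {0..}) ((act (inv\<^bsub>G\<^esub> (g n)) \<circ> \<gamma>) ` {0..})"
        using act_coarsely_equal[OF gi M c(2)] by (simp add: image_comp)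
      then have "rc (act (inv\<^bsub>G\<^esub> (g n)) \<circ> c) = bact (inv\<^bsub>G\<^esub> (g n)) (rc \<gamma>)"
        unfolding boundary_act_ray_class[OF gi \<gamma>(1,2)]
        by (rule ray_class_cong) (intro ray_mspace act_isometric[OF gi] c(1) morse_ray_isometric[OF \<gamma>(1)])+
      then show ?thesis using \<gamma>(3) by (simp add: A_def)
    qed
    have a'A: "rc (a' n) \<in> A n" for n
      unfolding a'_def using class_in[OF a(1,4) \<alpha>(1,2)] \<xi> \<alpha>(3) by simp
    have b'A: "rc (b' n) \<in> A n" for n
      unfolding b'_def using class_in[OF b(1,4) \<beta>(1,2,3)] .
    have unbounded: "\<exists>n0. \<forall>n\<ge>n0. k \<le> real n" for k
      by (rule exI[of _ "nat \<lceil>k\<rceil>"]) (auto simp: nat_le_iff ceiling_le_iff)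
    have cut: "isometric_on X {0..real n} c" if "isometric_on X {0..} c" for c n
      using that by (rule isometric_on_subset) auto
    obtain a\<^sub>0 and r1 :: "nat \<Rightarrow> nat" where a0: "isometric_on X {0..} a\<^sub>0" "a\<^sub>0 0 = e" "strict_mono r1"
      "\<forall>k. real k \<le> real (r1 k) \<and> (\<forall>t. 0 \<le> t \<and> t \<le> real k \<longrightarrow> mdist X (a' (r0 (r1 k)) t) (a\<^sub>0 t) \<le> 3)"
      by (rule ray_limit[where \<sigma> = "\<lambda>n. a' (r0 n)" and T = real, OF cut[OF a'(1)] a'(3) _ unbounded]) auto
    obtain b\<^sub>0 and r2 :: "nat \<Rightarrow> nat" where b0: "isometric_on X {0..} b\<^sub>0" "b\<^sub>0 0 = e" "strict_mono r2"
      "\<forall>k. real k \<le> real (r2 k) \<and> (\<forall>t. 0 \<le> t \<and> t \<le> real k \<longrightarrow> mdist X (b' (r0 (r1 (r2 k))) t) (b\<^sub>0 t) \<le> 3)"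
      by (rule ray_limit[where \<sigma> = "\<lambda>n. b' (r0 (r1 n))" and T = real, OF cut[OF b'(1)] b'(3) _ unbounded]) auto
    \<comment> \<open>The second limit was taken along the subsequence of the first, so both
      approximations hold along \<open>s\<close>.\<close>
    define s where "s \<equiv> \<lambda>k. r0 (r1 (r2 k))"
    have near_a: "mdist X (a' (s k) t) (a\<^sub>0 t) \<le> 3" if "0 \<le> t" "t \<le> real k" for k t
    proof -
      have "t \<le> real (r2 k)" using that b0(4) order_trans by blast
      then show ?thesis using a0(4) that(1) by (simp add: s_def)
    qed
    have near_b: "mdist X (b' (s k) t) (b\<^sub>0 t) \<le> 3" if "0 \<le> t" "t \<le> real k" for k t
      using b0(4) that by (simp add: s_def)
    have lim: "rc c\<^sub>0 \<in> point_limit (morse_boundary X e) (A \<circ> s) \<and> (\<exists>N''. morse_set X N'' (c\<^sub>0 ` {0..}))"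
      if c: "\<And>n. isometric_on X {0..} (c n)" "\<And>n. morse_set X N' (c n ` {0..})" "\<And>n. c n 0 = e" "\<And>n. rc (c n) \<in> A n"
        and c0: "isometric_on X {0..} c\<^sub>0" "c\<^sub>0 0 = e" and near: "\<And>k t. 0 \<le> t \<Longrightarrow> t \<le> real k \<Longrightarrow> mdist X (c (s k) t) (c\<^sub>0 t) \<le> 3"
      for c c\<^sub>0
    proof -
      define N'' where "N'' \<equiv> \<lambda>q Q. N' q (Q + 2 * 3 + 2) + 3"
      have "\<exists>\<sigma> T. real k \<le> T \<and> isometric_on X {0..T} \<sigma> \<and> morse_set X N' (\<sigma> ` {0..T}) \<and>
          (\<forall>t. 0 \<le> t \<and> t \<le> real k \<longrightarrow> mdist X (\<sigma> t) (c\<^sub>0 t) \<le> 3)" for k :: nat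
      proof (intro exI[of _ "c (s k)"] exI[of _ "real k"] conjI)
        show "morse_set X N' (c (s k) ` {0..real k})" by (intro morse_set_subinterval[OF c(1,2)]) auto
      qed (use cut[OF c(1)] near in auto)
      then have N'': "morse_set X N'' (c\<^sub>0 ` {0..})" unfolding N''_def by (intro morse_set_limit[OF c0(1)]) auto
      define N3 where "N3 \<equiv> \<lambda>q Q. max (N' q Q) (N'' q Q)"
      have N3: "morse_set X N3 (c\<^sub>0 ` {0..})" "\<And>n. morse_set X N3 (c (s n) ` {0..})"
        using morse_set_mono[OF N''] morse_set_mono[OF c(2)] by (auto simp: N3_def)
      have "limitin (morse_boundary X e) (\<lambda>n. rc (c (s n))) (rc c\<^sub>0) sequentially"
        by (rule limitin_morse_boundary[where a = "\<lambda>n. c (s n)", OF c0(1) N3(1) c0(2) c(1) N3(2) c(3) near])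
      then have "rc c\<^sub>0 \<in> point_limit (morse_boundary X e) (A \<circ> s)"
        unfolding point_limit_def using c(4) by (auto intro!: exI[of _ "\<lambda>n. rc (c (s n))"])
      then show ?thesis using N'' by blast
    qed
    have a0_lim: "rc a\<^sub>0 \<in> point_limit (morse_boundary X e) (A \<circ> s)" "morse_ray X a\<^sub>0"
      using lim[OF a' a'A a0(1,2) near_a] a0(1) by (auto simp: morse_ray_iff)
    have b0_lim: "rc b\<^sub>0 \<in> point_limit (morse_boundary X e) (A \<circ> s)"
      using lim[OF b' b'A b0(1,2) near_b] by blast
    have "inj (A \<circ> s)"
    proof -
      have "inj (r1 \<circ> r2)" using a0(3) b0(3) by (simp add: inj_compose strict_mono_imp_inj_on)
      then have "inj ((A \<circ> r0) \<circ> (r1 \<circ> r2))" by (rule inj_compose[OF r0(2)])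
      moreover have "(A \<circ> r0) \<circ> (r1 \<circ> r2) = A \<circ> s" by (auto simp: s_def)
      ultimately show ?thesis by simp
    qed
    moreover have "range (A \<circ> s) \<subseteq> boundary_orbit G S e C"
      using gi unfolding A_def boundary_orbit_def by auto
    ultimately obtain \<zeta> where "point_limit (morse_boundary X e) (A \<circ> s) \<subseteq> {\<zeta>}"
      using conv unfolding point_convergent_def by blast
    then have "rc a\<^sub>0 = rc b\<^sub>0" using a0_lim(1) b0_lim by blast
    then have "coarsely_equal X (a\<^sub>0 ` {0..}) (b\<^sub>0 ` {0..})"
      using ray_class_eq_iff[OF a0_lim(2) a0(2)] ray_mspace[OF b0(1)] by blast
    then obtain R where R: "coarse_in X R (a\<^sub>0 ` {0..}) (b\<^sub>0 ` {0..})" unfolding coarsely_equal_def by blast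
    have M: "a\<^sub>0 t \<in> mspace X" "b\<^sub>0 t \<in> mspace X" "a' n t \<in> mspace X" "b' n t \<in> mspace X"
      "a n t \<in> mspace X" "b n t \<in> mspace X" if "0 \<le> t" for t n
      using isometric_onD(1) a0(1) b0(1) a'(1) b'(1) a(1) b(1) that by (metis atLeast_iff)+
    \<comment> \<open>Both rays start at \<open>e\<close>, so a point of \<open>b\<^sub>0\<close>
      within \<open>R\<close> of \<open>a\<^sub>0 \<tau>\<close> has time within \<open>R\<close> of
      \<open>\<tau>\<close>; passing to equal times costs another \<open>R\<close>.\<close>
    have close: "mdist X (a\<^sub>0 \<tau>) (b\<^sub>0 \<tau>) \<le> 2 * R" if \<tau>: "0 \<le> \<tau>" for \<tau>
    proof -
      obtain \<tau>' where \<tau>': "0 \<le> \<tau>'" "mdist X (a\<^sub>0 \<tau>) (b\<^sub>0 \<tau>') \<le> R" using coarse_inD[OF R, of "a\<^sub>0 \<tau>"] \<tau> by auto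
      have "\<bar>\<tau> - \<tau>'\<bar> \<le> R" using ray_dist[OF a0(1) b0(1) _ \<tau> \<tau>'(1)] a0(2) b0(2) \<tau>' by simp
      moreover have "mdist X (b\<^sub>0 \<tau>') (b\<^sub>0 \<tau>) = \<bar>\<tau>' - \<tau>\<bar>" using isometric_onD(2)[OF b0(1)] \<tau> \<tau>' by simp
      moreover have "mdist X (a\<^sub>0 \<tau>) (b\<^sub>0 \<tau>) \<le> mdist X (a\<^sub>0 \<tau>) (b\<^sub>0 \<tau>') + mdist X (b\<^sub>0 \<tau>') (b\<^sub>0 \<tau>)"
        using M \<tau> \<tau>' by (intro mdist_triangle) auto
      ultimately show ?thesis using \<tau>' by linarith
    qed
    \<comment> \<open>Chosen so that \<open>2 * \<tau> - D\<close> exceeds \<open>2 * R + 6\<close>,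
      where the 6 is the error of replacing two rays of the sequences by their limits.\<close>
    define \<tau> where "\<tau> = \<bar>R\<bar> + \<bar>D\<bar> + 4"
    have \<tau>: "0 \<le> \<tau>" by (simp add: \<tau>_def)
    define k where "k = nat \<lceil>max \<tau> (\<tau> + T0 + mdist X e o1)\<rceil>"
    have k: "\<tau> \<le> real k" "\<tau> + T0 + mdist X e o1 \<le> real k" by (simp_all add: k_def) linarith+
    have "k \<le> s k"
      unfolding s_def using r0(1) a0(3) b0(3) strict_mono_imp_increasing order_trans by metis
    then have ks: "real k \<le> real (s k)" by simp
    \<comment> \<open>The identity lies in \<open>H\<close>, so \<open>\<alpha> (t n)\<close> is
      more than \<open>n\<close> away from its vertex. Hence \<open>t n\<close> tends to infinity,
      and \<open>apart\<close> becomes available at time \<open>\<tau>\<close>.\<close>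
    have "\<one>\<^bsub>G\<^esub> \<in> H" using H boundary_act_image(2)[OF C(1)] by simp
    then have "real (s k) < mdist X (\<alpha> (t (s k))) o1" using t(2) by (simp add: o1_def)
    moreover have "mdist X (\<alpha> (t (s k))) o1 \<le> mdist X (\<alpha> (t (s k))) e + mdist X e o1"
      using \<alpha>M t(1) e o1 by (intro mdist_triangle) auto
    moreover have "mdist X (\<alpha> (t (s k))) e = t (s k)"
      using isometric_onD(2)[OF iso(1), of "t (s k)" 0] t(1) \<alpha>(2) by simp
    ultimately have "2 * \<tau> - D \<le> mdist X (a (s k) \<tau>) (b (s k) \<tau>)"
      using k(2) ks by (intro apart[OF \<tau>]) linarith
    also have "\<dots> = mdist X (a' (s k) \<tau>) (b' (s k) \<tau>)"
      unfolding a'_def b'_def using act_dist[OF gi M(5,6)[OF \<tau>]] by simp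
    also have "\<dots> \<le> mdist X (a\<^sub>0 \<tau>) (b\<^sub>0 \<tau>) + (3 + 3)"
    proof -
      have "\<bar>mdist X (a' (s k) \<tau>) (b' (s k) \<tau>) - mdist X (a\<^sub>0 \<tau>) (b\<^sub>0 \<tau>)\<bar> \<le> 3 + 3"
        using M[OF \<tau>] near_a[OF \<tau> k(1)] near_b[OF \<tau> k(1)] by (intro mdist_quadrilateral) auto
      then show ?thesis by linarith
    qed
    also have "\<dots> \<le> 2 * R + 6" using close[OF \<tau>] by simp
    finally show False unfolding \<tau>_def by argo
  qed
  then obtain k where "\<alpha> ` {0..} \<subseteq> closed_nbhd X k (cayley_vertex ` H)"
    using subset_closed_nbhd_iff[OF ray_mspace[OF iso(1)]] by blast
  then show "\<xi> \<in> relative_morse_boundary X e (cayley_vertex ` boundary_stabiliser G S e C)"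
    unfolding relative_morse_boundary_def H_def[symmetric] using \<alpha>(1,3) by blast
qed

end

end

theorem theorem1p1:
  fixes G :: "('a, 'b) monoid_scheme" and S :: "'a set" and e :: "'a \<Rightarrow> real"
    and C :: "(real \<Rightarrow> 'a \<Rightarrow> real) set set"
  assumes "group G"
    and "finite S" and "S \<subseteq> carrier G" and "generate G S = carrier G"
    and "e \<in> mspace (cayley_graph G S)"
    and "C \<in> connected_components_of (morse_boundary (cayley_graph G S) e)"
    and "\<not> is_singleton C"
    and "point_convergent (morse_boundary (cayley_graph G S) e) (boundary_orbit G S e C)"
  shows "relative_morse_boundary (cayley_graph G S) e
           (cayley_vertex ` boundary_stabiliser G S e C) = C"
proof -
  interpret finitely_generated_group G S
    using assms(1-4) by (simp add: finitely_generated_group_def finitely_generated_group_axioms_def)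
  have C: "C \<subseteq> morse_boundary_points (cayley_graph G S) e" "C \<noteq> {}"
    using connected_components_of_subset[OF assms(6)] nonempty_connected_components_of[OF assms(6)] by auto
  show ?thesis
  proof
    show "relative_morse_boundary (cayley_graph G S) e (cayley_vertex ` boundary_stabiliser G S e C) \<subseteq> C"
      by (rule relative_boundary_subset[OF assms(5) C(1) assms(7) C(2) closedin_connected_components_of[OF assms(6)]])
        (auto simp: boundary_stabiliser_def)
    show "C \<subseteq> relative_morse_boundary (cayley_graph G S) e (cayley_vertex ` boundary_stabiliser G S e C)"
      by (rule subset_relative_boundary[OF assms(5) C(1) assms(7,8)])
  qed
qed

end
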